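(* Let $U:T^d\partial\Omega\to\mathbb{R}$ be tangentially polyconvex. Then $U$ is tangentially quasiconvex.
   Context: $\Omega\subset\mathbb{R}^d$ ($d\ge2$) is a bounded open set with Lipschitz boundary, $T_x\partial\Omega$ is the tangent space of $\partial\Omega$ at $x$, and $T^d\partial\Omega:=\{(x,F):x\in\partial\Omega,\ F\in(T_x\partial\Omega)^d\}$. $\mathcal{L}(V;V')$ is the space of linear maps from $V$ to $V'$, and $\mathcal{H}^{d-1}$ is Hausdorff measure. Tangential quasiconvexity: let $U:T^d\partial\Omega\to[0,\infty)$ be a Borel function. $U$ is said to be tangentially quasiconvex if for all $(z,\xi)\in T^d\partial\Omega$ and all $\varphi\in W^{1,\infty}(B(0;1);T_z\partial\Omega)$ such that $\varphi(y)=\xi y$ on $\partial B(0;1)$ one has $$U(z,\xi)\le\frac{1}{|B(0;1)|}\int_{B(0;1)}U(z,D\varphi(y))\,dy.$$ Here $B(0;1)$ is the unit ball of $\mathbb{R}^d$ and $\xi$ is regarded as a $d\times d$ matrix: a $d$-tuple $\xi=(w_1,\dots,w_d)\in(T_z\partial\Omega)^d$ acts on $y\in\mathbb{R}^d$ by $\xi y=\sum_jy_jw_j\in T_z\partial\Omega$; and $D\varphi(y)\in(T_z\partial\Omega)^d$ for a.e. $y\in B(0;1)$, being the $d$-tuple of partial derivatives $(\partial_1\varphi(y),\dots,\partial_d\varphi(y))$. The space $(T_z\partial\Omega)^d$ is also identified with $\mathcal{L}(T_z\partial\Omega;\mathbb{R}^d)$, a $d$-tuple $(w_1,\dots,w_d)$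 corresponding to the map $v\mapsto(w_1\cdot v,\dots,w_d\cdot v)$. A measurable basis of $T\partial\Omega$ is a family of measurable maps $v_1,\dots,v_{d-1}:\partial\Omega\to\mathbb{R}^d$ such that $\{v_1(x),\dots,v_{d-1}(x)\}$ is a basis of $T_x\partial\Omega$ for $\mathcal{H}^{d-1}$-a.e. $x\in\partial\Omega$. For a $d\times(d-1)$ matrix $F$, $M(F)\in\mathbb{R}^{\nu_{d-1}}$ is the sequence (in a fixed order) of all its minors of all orders $1\le k\le d-1$, with $\nu_{d-1}=\sum_{k=1}^{d-1}\binom{d-1}k\binom dk$. Tangential polyconvexity: $U:T^d\partial\Omega\to\mathbb{R}$ is tangentially polyconvex if there exist a measurable basis of $T\partial\Omega$ and a function $\Phi:\partial\Omega\times\mathbb{R}^{\nu_{d-1}}\to\mathbb{R}$ such that $\Phi(x,\cdot)$ is convex for $\mathcal{H}^{d-1}$-a.e. $x\in\partial\Omega$ and $U(x,F)=\Phi(x,M(F))$ for every $F\in\mathcal{L}(T_x\partial\Omega;\mathbb{R}^d)$, where $M(F)$ is computed from the matrix of $F$ with respect to that basis and the canonical basis of $\mathbb{R}^d$.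
   Formalization: Since polyconvexity allows a null set of base points, quasiconvexity at every z can fail; proved instead: polyconvexity at a.e. x gives quasiconvexity at a.e. z, and polyconvexity at every x having a tangent space gives it at every such z. *)

theory Defs
  imports "HOL-Analysis.Analysis" "Jordan_Normal_Form.Determinant"
begin

no_notation vec_index (infixl \<open>$\<close> 100)

type_synonym 'n point = "real^'n"

text \<open>A \<open>d\<close>-tuple \<open>(w\<^sub>1, \<dots>, w\<^sub>d)\<close> of vectors is \<open>F :: 'n tuple\<close> with \<open>F $ i = w\<^sub>i\<close>. Hence
  \<open>F *v v = (w\<^sub>1 \<bullet> v, \<dots>, w\<^sub>d \<bullet> v)\<close>, and the matrix denoted \<open>\<xi>\<close> in \<open>\<xi> y = \<Sum>\<^sub>j y\<^sub>j w\<^sub>j\<close> is the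
  transpose of \<open>F\<close>.\<close>

type_synonym 'n tuple = "(real^'n)^'n"

section \<open>Hausdorff measure\<close>

definition hausdorff_gauge :: "nat \<Rightarrow> 'a::metric_space set \<Rightarrow> ennreal" where
  "hausdorff_gauge s A =
     (if A = {} then 0 else ennreal (unit_ball_vol (real s) * (diameter A / 2) ^ s))"

text \<open>The covering sets are required to be bounded because \<^const>\<open>diameter\<close> is only meaningful
  for bounded sets.\<close>

definition hausdorff_content :: "nat \<Rightarrow> real \<Rightarrow> 'a::metric_space set \<Rightarrow> ennreal" where
  "hausdorff_content s \<delta> X =
     (INF C \<in> {C :: nat \<Rightarrow> 'a set. X \<subseteq> (\<Union>i. C i) \<and> (\<forall>i. bounded (C i) \<and> diameter (C i) \<le> \<delta>)}.
        \<Sum>i. hausdorff_gauge s (C i))"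

definition hausdorff_outer :: "nat \<Rightarrow> 'a::metric_space set \<Rightarrow> ennreal" where
  "hausdorff_outer s X = (SUP \<delta> \<in> {0<..}. hausdorff_content s \<delta> X)"

text \<open>The measure lives on the \<open>\<sigma>\<close>-algebra of all Caratheodory-measurable sets.\<close>

definition hausdorff_measure :: "nat \<Rightarrow> 'a::metric_space measure" where
  "hausdorff_measure s =
     measure_of UNIV (lambda_system UNIV UNIV (hausdorff_outer s)) (hausdorff_outer s)"

lemma hausdorff_content_empty:
  assumes "\<delta> > 0"
  shows "hausdorff_content s \<delta> ({} :: 'a::metric_space set) = 0"
proof -
  have "hausdorff_content s \<delta> ({} :: 'a set) \<le> (\<Sum>i::nat. hausdorff_gauge s ({} :: 'a set))"
    unfolding hausdorff_content_def
    by (rule INF_lower2[of "\<lambda>_. {}"]) (use assms in auto)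
  then show ?thesis by (simp add: hausdorff_gauge_def)
qed

lemma hausdorff_content_mono: "X \<subseteq> Y \<Longrightarrow> hausdorff_content s \<delta> X \<le> hausdorff_content s \<delta> Y"
  unfolding hausdorff_content_def by (rule INF_superset_mono) auto

lemma hausdorff_content_countably_subadditive:
  fixes A :: "nat \<Rightarrow> 'a::metric_space set"
  shows "hausdorff_content s \<delta> (\<Union>i. A i) \<le> (\<Sum>n. hausdorff_content s \<delta> (A n))"
proof (rule ennreal_le_epsilon)
  fix e :: real
  assume e: "0 < e" and fin: "(\<Sum>n. hausdorff_content s \<delta> (A n)) < Orderings.top"
  then have lt: "hausdorff_content s \<delta> (A n) < hausdorff_content s \<delta> (A n) + e * (1/2)^Suc n" for n
    by (auto simp add: less_top dest!: ennreal_suminf_lessD)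
  have "\<exists>C :: nat \<Rightarrow> 'a set. A n \<subseteq> (\<Union>i. C i) \<and> (\<forall>i. bounded (C i) \<and> diameter (C i) \<le> \<delta>) \<and>
      (\<Sum>i. hausdorff_gauge s (C i)) \<le> hausdorff_content s \<delta> (A n) + e * (1/2)^Suc n" for n
    using lt[of n] unfolding hausdorff_content_def[of s \<delta> "A n"] INF_less_iff
    by (auto intro: less_imp_le)
  then obtain B :: "nat \<Rightarrow> nat \<Rightarrow> 'a set" where
    cov: "\<And>n. A n \<subseteq> (\<Union>i. B n i)" and
    adm: "\<And>n i. bounded (B n i) \<and> diameter (B n i) \<le> \<delta>" and
    le: "\<And>n. (\<Sum>i. hausdorff_gauge s (B n i)) \<le> hausdorff_content s \<delta> (A n) + e * (1/2)^Suc n"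
    by metis
  define C where "C = case_prod B o prod_decode"
  have "(\<Union>i. A i) \<subseteq> (\<Union>i. C i)"
    using cov by (auto simp add: C_def subset_eq) (metis prod.case prod_encode_inverse)
  moreover have "\<forall>i. bounded (C i) \<and> diameter (C i) \<le> \<delta>"
    using adm by (simp add: C_def split_beta)
  ultimately have "hausdorff_content s \<delta> (\<Union>i. A i) \<le> (\<Sum>i. hausdorff_gauge s (C i))"
    unfolding hausdorff_content_def by (intro INF_lower) auto
  also have "\<dots> = (\<Sum>n. \<Sum>i. hausdorff_gauge s (B n i))"
    unfolding C_def comp_def
    using suminf_ennreal_2dimen[of "\<lambda>n. \<Sum>i. hausdorff_gauge s (B n i)"
        "\<lambda>(n, i). hausdorff_gauge s (B n i)"]
    by (simp add: split_beta)
  also have "\<dots> \<le> (\<Sum>n. hausdorff_content s \<delta> (A n) + e * (1/2) ^ Suc n)"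
    by (intro suminf_le allI le) auto
  also have "\<dots> = (\<Sum>n. hausdorff_content s \<delta> (A n)) + (\<Sum>n. ennreal e * ennreal ((1/2) ^ Suc n))"
    using e by (subst suminf_add[symmetric])
      (auto simp del: ennreal_suminf_cmult simp add: ennreal_mult[symmetric])
  also have "\<dots> = (\<Sum>n. hausdorff_content s \<delta> (A n)) + e"
    unfolding ennreal_suminf_cmult
    by (subst suminf_ennreal_eq[OF zero_le_power power_half_series]) auto
  finally show "hausdorff_content s \<delta> (\<Union>i. A i) \<le> (\<Sum>n. hausdorff_content s \<delta> (A n)) + e" .
qed

lemma hausdorff_outer_measure_space:
  "outer_measure_space (UNIV :: 'a::metric_space set set) (hausdorff_outer s)"
proof -
  have "positive (UNIV :: 'a set set) (hausdorff_outer s)"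
    unfolding positive_def hausdorff_outer_def 
    by (simp add: hausdorff_content_empty image_constant_conv cong: image_cong_simp)
  moreover have "increasing (UNIV :: 'a set set) (hausdorff_outer s)"
    unfolding increasing_def hausdorff_outer_def
    by (auto intro!: SUP_mono' hausdorff_content_mono)
  moreover have "hausdorff_outer s (\<Union>i. A i) \<le> (\<Sum>n. hausdorff_outer s (A n))"
    for A :: "nat \<Rightarrow> 'a set"
    unfolding hausdorff_outer_def[of s "\<Union>i. A i"]
  proof (rule SUP_least)
    fix \<delta> :: real assume "\<delta> \<in> {0<..}"
    have "hausdorff_content s \<delta> (\<Union>i. A i) \<le> (\<Sum>n. hausdorff_content s \<delta> (A n))"
      by (rule hausdorff_content_countably_subadditive)
    also have "\<dots> \<le> (\<Sum>n. hausdorff_outer s (A n))"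
      unfolding hausdorff_outer_def using \<open>\<delta> \<in> {0<..}\<close>
      by (intro suminf_le) (auto intro: SUP_upper)
    finally show "hausdorff_content s \<delta> (\<Union>i. A i) \<le> (\<Sum>n. hausdorff_outer s (A n))" .
  qed
  ultimately show ?thesis
    by (simp add: outer_measure_space_def countably_subadditive_def)
qed

lemma hausdorff_measure_space:
  "measure_space (UNIV :: 'a::metric_space set)
     (lambda_system UNIV UNIV (hausdorff_outer s)) (hausdorff_outer s)"
  using sigma_algebra.caratheodory_lemma[OF sigma_algebra_Pow, of UNIV "hausdorff_outer s"]
    hausdorff_outer_measure_space[of s] by simp

lemma space_hausdorff_measure [simp]: "space (hausdorff_measure s) = UNIV"
  unfolding hausdorff_measure_def by (rule space_measure_of) auto

lemma sets_hausdorff_measure: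
  "sets (hausdorff_measure s :: 'a::metric_space measure) =
     lambda_system UNIV UNIV (hausdorff_outer s)"
  unfolding hausdorff_measure_def
  using hausdorff_measure_space[of s, where ?'a = 'a]
  by (simp add: measure_space_def sigma_algebra.sigma_sets_eq)

lemma emeasure_hausdorff_measure:
  assumes "X \<in> sets (hausdorff_measure s)"
  shows "emeasure (hausdorff_measure s) X = hausdorff_outer s X"
  using assms hausdorff_measure_space[of s, where ?'a = 'a] unfolding sets_hausdorff_measure
  unfolding hausdorff_measure_def
  by (subst emeasure_measure_of_sigma) (auto simp: measure_space_def)


section \<open>Lipschitz boundary and tangent spaces\<close>

text \<open>Near every boundary point the set is the strict epigraph, in some unit direction \<open>e\<close>, of a
  Lipschitz function \<open>\<gamma>\<close> of the component \<open>y - (y \<bullet> e) e\<close> orthogonal to \<open>e\<close>.\<close>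

definition lipschitz_boundary :: "'a::euclidean_space set \<Rightarrow> bool" where
  "lipschitz_boundary \<Omega> \<longleftrightarrow>
     (\<forall>x \<in> frontier \<Omega>. \<exists>e \<gamma> L r. norm e = 1 \<and> r > 0 \<and> L-lipschitz_on UNIV \<gamma> \<and>
        \<Omega> \<inter> ball x r = {y \<in> ball x r. \<gamma> (y - (y \<bullet> e) *\<^sub>R e) < y \<bullet> e})"

text \<open>The contingent (Bouligand) cone.\<close>

definition tangent_cone :: "'a::real_normed_vector set \<Rightarrow> 'a \<Rightarrow> 'a set" where
  "tangent_cone S x =
     {v. \<exists>y t. (\<forall>k::nat. y k \<in> S \<and> (t k :: real) > 0) \<and> y \<longlonglongrightarrow> x \<and>
           (\<lambda>k. t k *\<^sub>R (y k - x)) \<longlonglongrightarrow> v}"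

text \<open>A Lipschitz boundary has a tangent space only at almost every point: those at which the
  tangent cone is a hyperplane, i.e. at which the local graph function is differentiable. At these
  points \<open>tangent_cone (frontier \<Omega>) x\<close> is \<open>T\<^sub>x\<partial>\<Omega>\<close>; the bundle \<open>T\<^sup>d\<partial>\<Omega>\<close> contains no other points.\<close>

definition regular_boundary :: "'a::euclidean_space set \<Rightarrow> 'a set" where
  "regular_boundary \<Omega> =
     {x \<in> frontier \<Omega>. subspace (tangent_cone (frontier \<Omega>) x) \<and>
        dim (tangent_cone (frontier \<Omega>) x) = DIM('a) - 1}"

definition tangent_bundle_d :: "'n::finite point set \<Rightarrow> ('n point \<times> 'n tuple) set" where
  "tangent_bundle_d \<Omega> =
     {(x, F). x \<in> regular_boundary \<Omega> \<and> (\<forall>i. F $ i \<in> tangent_cone (frontier \<Omega>) x)}"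


section \<open>The space \<open>W\<^sup>1\<^sup>,\<^sup>\<infinity>\<close>\<close>

text \<open>\<open>\<psi>\<close> is a compactly supported \<open>C\<^sup>1\<close> function on \<open>B\<close>, with gradient \<open>g\<close>.\<close>

definition test_function :: "(real^'n) set \<Rightarrow> (real^'n \<Rightarrow> real) \<Rightarrow> (real^'n \<Rightarrow> real^'n) \<Rightarrow> bool" where
  "test_function B \<psi> g \<longleftrightarrow>
     (\<exists>K. compact K \<and> K \<subseteq> B \<and> (\<forall>y. y \<notin> K \<longrightarrow> \<psi> y = 0)) \<and>
     (\<forall>y. (\<psi> has_derivative (\<lambda>h. g y \<bullet> h)) (at y)) \<and> continuous_on UNIV g"

text \<open>\<open>G y $ j\<close> is the \<open>j\<close>-th weak partial derivative of \<open>\<phi>\<close>; all functions are bounded.\<close>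

definition weak_gradient ::
    "(real^'n) set \<Rightarrow> (real^'n \<Rightarrow> 'b::euclidean_space) \<Rightarrow> (real^'n \<Rightarrow> 'b^'n) \<Rightarrow> bool" where
  "weak_gradient B \<phi> G \<longleftrightarrow>
     (\<forall>\<psi> g. test_function B \<psi> g \<longrightarrow>
        (\<forall>j. (LINT y|lebesgue_on B. (g y $ j) *\<^sub>R \<phi> y) =
             - (LINT y|lebesgue_on B. \<psi> y *\<^sub>R (G y $ j))))"

definition ess_bounded :: "(real^'n) set \<Rightarrow> (real^'n \<Rightarrow> 'b::euclidean_space) \<Rightarrow> bool" where
  "ess_bounded B f \<longleftrightarrow>
     f \<in> borel_measurable (lebesgue_on B) \<and> (\<exists>C. AE y in lebesgue_on B. norm (f y) \<le> C)"

text \<open>\<open>\<phi> \<in> W\<^sup>1\<^sup>,\<^sup>\<infinity>(B; V)\<close> with \<open>D\<phi> = G\<close>.\<close>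

definition sobolev_W1inf ::
    "(real^'n) set \<Rightarrow> 'b::euclidean_space set \<Rightarrow> (real^'n \<Rightarrow> 'b) \<Rightarrow> (real^'n \<Rightarrow> 'b^'n) \<Rightarrow> bool" where
  "sobolev_W1inf B V \<phi> G \<longleftrightarrow>
     ess_bounded B \<phi> \<and> ess_bounded B G \<and> weak_gradient B \<phi> G \<and>
     (AE y in lebesgue_on B. \<phi> y \<in> V)"


section \<open>Tangential quasiconvexity\<close>

text \<open>An element of \<open>W\<^sup>1\<^sup>,\<^sup>\<infinity>\<close> of the ball has a unique representative that is continuous on the
  closed ball; the boundary condition refers to it, so \<open>\<phi>\<close> ranges over these representatives.
  For real-valued \<open>U\<close> the mean value is meaningful only if the integrand is integrable, so this is
  part of the condition; it implies the inequality with values in \<open>[0, \<infinity>]\<close> when \<open>U \<ge> 0\<close>.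
  Values of \<open>U\<close> off \<^const>\<open>tangent_bundle_d\<close> are irrelevant, as \<open>(z, G y)\<close> lies in it for
  almost every \<open>y\<close>.\<close>

definition tangentially_quasiconvex_at ::
    "'n::finite point set \<Rightarrow> ('n point \<times> 'n tuple \<Rightarrow> real) \<Rightarrow> 'n point \<Rightarrow> bool" where
  "tangentially_quasiconvex_at \<Omega> U z \<longleftrightarrow>
     (\<forall>\<xi> \<phi> G. (z, \<xi>) \<in> tangent_bundle_d \<Omega> \<and>
        sobolev_W1inf (ball 0 1) (tangent_cone (frontier \<Omega>) z) \<phi> G \<and>
        continuous_on (cball 0 1) \<phi> \<and>
        (\<forall>y \<in> sphere 0 1. \<phi> y = (\<Sum>j\<in>UNIV. (y $ j) *\<^sub>R (\<xi> $ j))) \<longrightarrow>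
        integrable (lebesgue_on (ball 0 1)) (\<lambda>y. U (z, G y)) \<and>
        U (z, \<xi>) \<le> 1 / measure lebesgue (ball (0 :: real^'n) 1) *
                      (LINT y|lebesgue_on (ball 0 1). U (z, G y)))"

definition tangentially_quasiconvex ::
    "'n::finite point set \<Rightarrow> ('n point \<times> 'n tuple \<Rightarrow> real) \<Rightarrow> bool" where
  "tangentially_quasiconvex \<Omega> U \<longleftrightarrow>
     (\<forall>z \<in> regular_boundary \<Omega>. tangentially_quasiconvex_at \<Omega> U z)"

text \<open>Polyconvexity below restricts \<open>U(x, \<cdot>)\<close> only for almost every \<open>x\<close>, so on its own it can
  imply the inequality only up to a null set of base points \<open>z\<close>.\<close>

definition tangentially_quasiconvex_ae ::
    "'n::finite point set \<Rightarrow> ('n point \<times> 'n tuple \<Rightarrow> real) \<Rightarrow> bool" where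
  "tangentially_quasiconvex_ae \<Omega> U \<longleftrightarrow>
     (AE z in hausdorff_measure (CARD('n) - 1).
        z \<in> regular_boundary \<Omega> \<longrightarrow> tangentially_quasiconvex_at \<Omega> U z)"


section \<open>Minors\<close>

text \<open>Index type of the minors of a matrix with rows \<open>'n\<close> and columns \<open>'m\<close>: pairs of a set of rows
  and a set of columns of the same positive size. The space \<open>\<real>\<^sup>\<nu>\<close> of all sequences of minors is
  then \<open>real^('n, 'm) minor_index\<close>.\<close>

typedef ('n, 'm) minor_index =
  "{(I :: 'n set, J :: 'm set). card I = card J \<and> 1 \<le> card I}"
  by (rule exI[of _ "({undefined}, {undefined})"]) simp

instance minor_index :: (finite, finite) finite
proof
  have "finite (Rep_minor_index ` (UNIV :: ('a, 'b) minor_index set))"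
    by (rule finite_subset[OF subset_UNIV finite])
  then show "finite (UNIV :: ('a, 'b) minor_index set)"
    by (rule finite_imageD) (simp add: inj_on_def Rep_minor_index_inject)
qed

lemma CARD_minor_index:
  "CARD(('n::finite, 'm::finite) minor_index) =
     (\<Sum>k = 1..CARD('m). (CARD('m) choose k) * (CARD('n) choose k))"
proof -
  let ?S = "{(I :: 'n set, J :: 'm set). card I = card J \<and> 1 \<le> card I}"
  have "CARD(('n, 'm) minor_index) = card ?S"
    by (rule type_definition.card[OF type_definition_minor_index])
  also have "?S = (\<Union>k\<in>{1..CARD('m)}. {I. card I = k} \<times> {J. card J = k})"
    by (auto simp: card_mono)
  also have "card \<dots> =
      (\<Sum>k = 1..CARD('m). card ({I :: 'n set. card I = k} \<times> {J :: 'm set. card J = k}))"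
    by (rule card_UN_disjoint) auto
  also have "\<dots> = (\<Sum>k = 1..CARD('m). (CARD('m) choose k) * (CARD('n) choose k))"
    using n_subsets[of "UNIV :: 'n set"] n_subsets[of "UNIV :: 'm set"]
    by (simp add: card_cartesian_product mult.commute)
  finally show ?thesis .
qed

definition minor ::
    "real^'m::{finite,linorder}^'n::{finite,linorder} \<Rightarrow> 'n set \<Rightarrow> 'm set \<Rightarrow> real" where
  "minor A I J =
     Determinant.det (Matrix.mat (card I) (card J)
       (\<lambda>(a, b). A $ (sorted_list_of_set I ! a) $ (sorted_list_of_set J ! b)))"

definition minors ::
    "real^'m::{finite,linorder}^'n::{finite,linorder} \<Rightarrow> real^('n, 'm) minor_index" where
  "minors A = (\<chi> p. case Rep_minor_index p of (I, J) \<Rightarrow> minor A I J)"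


section \<open>Tangential polyconvexity\<close>

text \<open>The columns \<open>'m\<close> index the vectors of a basis of \<open>T\<^sub>x\<partial>\<Omega>\<close>, so that \<open>CARD('m) = CARD('n) - 1\<close>.\<close>

definition tangent_basis_at ::
    "'n::finite point set \<Rightarrow> ('m::finite \<Rightarrow> 'n point \<Rightarrow> 'n point) \<Rightarrow> 'n point \<Rightarrow> bool" where
  "tangent_basis_at \<Omega> v x \<longleftrightarrow>
     inj (\<lambda>j. v j x) \<and> independent (range (\<lambda>j. v j x)) \<and>
     span (range (\<lambda>j. v j x)) = tangent_cone (frontier \<Omega>) x"

text \<open>Matrix of \<open>v \<mapsto> (w\<^sub>1 \<bullet> v, \<dots>, w\<^sub>d \<bullet> v)\<close> with respect to the basis \<open>v\<close> and the canonical basis.\<close>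

definition tangent_matrix ::
    "('m::finite \<Rightarrow> 'n::finite point \<Rightarrow> 'n point) \<Rightarrow> 'n point \<Rightarrow> 'n tuple \<Rightarrow> real^'m^'n" where
  "tangent_matrix v x F = (\<chi> i j. (F *v v j x) $ i)"

definition polyconvex_representation_at ::
    "'n::{finite,linorder} point set \<Rightarrow> ('n point \<times> 'n tuple \<Rightarrow> real) \<Rightarrow>
     ('m::{finite,linorder} \<Rightarrow> 'n point \<Rightarrow> 'n point) \<Rightarrow>
     ('n point \<Rightarrow> real^('n, 'm) minor_index \<Rightarrow> real) \<Rightarrow> 'n point \<Rightarrow> bool" where
  "polyconvex_representation_at \<Omega> U v \<Phi> x \<longleftrightarrow>
     tangent_basis_at \<Omega> v x \<and> convex_on UNIV (\<Phi> x) \<and>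
     (\<forall>F. (x, F) \<in> tangent_bundle_d \<Omega> \<longrightarrow> U (x, F) = \<Phi> x (minors (tangent_matrix v x F)))"

definition tangentially_polyconvex ::
    "'m::{finite,linorder} itself \<Rightarrow> 'n::{finite,linorder} point set \<Rightarrow>
     ('n point \<times> 'n tuple \<Rightarrow> real) \<Rightarrow> bool" where
  "tangentially_polyconvex _ \<Omega> U \<longleftrightarrow>
     (\<exists>(v :: 'm \<Rightarrow> 'n point \<Rightarrow> 'n point) \<Phi>.
        (\<forall>j. v j \<in> borel_measurable
                (restrict_space (hausdorff_measure (CARD('n) - 1)) (frontier \<Omega>))) \<and>
        (AE x in hausdorff_measure (CARD('n) - 1).
           x \<in> regular_boundary \<Omega> \<longrightarrow> polyconvex_representation_at \<Omega> U v \<Phi> x))"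

text \<open>The same notion without exceptional null set.\<close>

definition tangentially_polyconvex_everywhere ::
    "'m::{finite,linorder} itself \<Rightarrow> 'n::{finite,linorder} point set \<Rightarrow>
     ('n point \<times> 'n tuple \<Rightarrow> real) \<Rightarrow> bool" where
  "tangentially_polyconvex_everywhere _ \<Omega> U \<longleftrightarrow>
     (\<exists>(v :: 'm \<Rightarrow> 'n point \<Rightarrow> 'n point) \<Phi>.
        (\<forall>j. v j \<in> borel_measurable
                (restrict_space (hausdorff_measure (CARD('n) - 1)) (frontier \<Omega>))) \<and>
        (\<forall>x \<in> regular_boundary \<Omega>. polyconvex_representation_at \<Omega> U v \<Phi> x))"

end

theory Submission
  imports Defs
begin

text \<open>
  Fix a base point \<open>z\<close> at which \<open>U (z, F) = \<Phi> (M F)\<close> with \<open>\<Phi>\<close> convex and \<open>M F\<close> the list of minors of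
  the matrix \<open>(F $ i \<bullet> v j)\<close>, the \<open>v j\<close> being the tangent basis at \<open>z\<close>. The minors are null
  Lagrangians: if \<open>\<phi>\<close> lies in \<open>W\<^sup>1\<^sup>,\<^sup>\<infinity>\<close> of the unit ball and equals the linear map \<open>\<xi>\<close> on the sphere, then the mean value of \<open>M (D\<phi>)\<close> over the ball is
  \<open>M \<xi>\<close> (\<open>integral_minor_weak_gradient\<close>). Jensen's inequality for \<open>\<Phi>\<close> (\<open>jensen_inequality_euclidean\<close>)
  then says \<open>U (z, \<xi>) = \<Phi> (M \<xi>) \<le> \<close> mean of \<open>\<Phi> (M (D\<phi>))\<close>, and the integrand is \<open>U (z, D\<phi>)\<close> because
  \<open>D\<phi>\<close> takes values in the tangent space almost everywhere (\<open>AE_weak_gradient_in_subspace\<close>).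

  The substance is the null Lagrangian property for merely weak derivatives. A minor with column set
  \<open>J\<close> and row set \<open>I\<close> is the full Jacobian determinant of the map whose coordinates in \<open>I\<close> are the
  selected components of \<open>\<phi>\<close> and whose other coordinates are those of the identity
  (\<open>minor_eq_det\<close>), so only full determinants have to be treated.

  For a map \<open>f\<close> with bounded derivative that equals a linear map \<open>L\<close> outside a box, the integral of \<open>det Df\<close>
  over the box is its volume times \<open>det L\<close> (\<open>integral_det_derivative\<close>). The argument is the one of
  Milnor and Rogers: for large \<open>s\<close> the map \<open>f + s id\<close> is a bijection of the whole space that agrees
  with \<open>L + s id\<close> outside the box, hence both have the same image of the box, and the change of
  variables formula gives the identity for \<open>f + s id\<close> and \<open>L + s id\<close>. Both sides are polynomials in
  \<open>s\<close>, so they agree at \<open>s = 0\<close>. No second derivatives occur.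

  For weak derivatives, subtract the linear boundary values. What remains is continuous and vanishes
  on the sphere, so extension by zero keeps it weakly differentiable
  (\<open>weak_gradient_extension_by_zero\<close>). Its mollifications are differentiable with gradients that are
  uniformly bounded and converge almost everywhere, and dominated convergence carries the identity
  over to the limit (\<open>null_lagrangian_det\<close>).
\<close>

no_notation scalar_prod (infix "\<bullet>" 70)
hide_const (open) Determinant.det Matrix.mat Polynomial.content

section \<open>Integrals of bounded and of continuous functions\<close>

lemma integrable_lebesgue_bounded_support:
  fixes f :: "'a::euclidean_space \<Rightarrow> 'b::euclidean_space"
  assumes "f \<in> borel_measurable lebesgue" and "\<And>x. norm (f x) \<le> C"
    and "bounded S" and "\<And>x. x \<notin> S \<Longrightarrow> f x = 0"
  shows "integrable lebesgue f"
proof -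
  obtain R where R: "S \<subseteq> ball 0 R"
    using assms(3) bounded_subset_ballD[of S 0] by blast
  have "emeasure lebesgue (ball (0::'a) R) < \<infinity>"
    using emeasure_lborel_ball_finite[of "0::'a" R] by simp
  then have "integrable lebesgue (\<lambda>x::'a. indicator (ball 0 R) x *\<^sub>R C)"
    by (intro integrable_scaleR_left integrable_real_indicator) auto
  then show ?thesis
  proof (rule Bochner_Integration.integrable_bound[OF _ assms(1)])
    show "AE x in lebesgue. norm (f x) \<le> norm (indicator (ball 0 R) x *\<^sub>R C)"
    proof (intro AE_I2)
      fix x
      show "norm (f x) \<le> norm (indicator (ball 0 R) x *\<^sub>R C)"
      proof (cases "x \<in> S")
        case True
        then have "x \<in> ball 0 R" using R by blast
        moreover have "norm (f x) \<le> \<bar>C\<bar>" using assms(2)[of x] by linarith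
        ultimately show ?thesis by simp
      qed (simp add: assms(4))
    qed
  qed
qed

lemma borel_measurable_lebesgue_continuous:
  fixes h :: "'a::euclidean_space \<Rightarrow> 'b::topological_space"
  assumes "continuous_on UNIV h"
  shows "h \<in> borel_measurable lebesgue"
  using borel_measurable_continuous_onI[OF assms] by (intro measurable_completion) simp

lemma integrable_continuous_bounded_support:
  fixes f :: "'a::euclidean_space \<Rightarrow> 'b::euclidean_space"
  assumes "continuous_on UNIV f" and "bounded S" and "\<And>x. x \<notin> S \<Longrightarrow> f x = 0"
  shows "integrable lebesgue f"
proof -
  obtain a where a: "S \<subseteq> cbox (-a) a"
    using bounded_subset_cbox_symmetric[OF assms(2)] by blast
  have "f absolutely_integrable_on cbox (-a) a"
    using assms(1) by (intro absolutely_integrable_continuous) (rule continuous_on_subset, auto)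
  moreover have "(\<lambda>x. indicator (cbox (-a) a) x *\<^sub>R f x) = f"
    using a assms(3) by (auto simp: fun_eq_iff indicator_def)
  ultimately show ?thesis by (simp add: set_integrable_def)
qed

lemma lebesgue_integral_eq_integral_support:
  fixes f :: "'a::euclidean_space \<Rightarrow> 'b::euclidean_space"
  assumes "integrable lebesgue f" and "\<And>x. x \<notin> S \<Longrightarrow> f x = 0"
  shows "(LINT x|lebesgue. f x) = integral S f"
proof -
  have eq: "(\<lambda>x. indicator S x *\<^sub>R f x) = f"
    using assms(2) by (auto simp: fun_eq_iff indicator_def)
  then have "set_integrable lebesgue S f" using assms(1) by (simp add: set_integrable_def)
  from set_lebesgue_integral_eq_integral(2)[OF this] show ?thesis
    by (simp add: set_lebesgue_integral_def eq)
qed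

lemma integral_lebesgue_shift:
  fixes f :: "'a::euclidean_space \<Rightarrow> 'b::euclidean_space"
  assumes "continuous_on UNIV f"
  shows "(LINT y|lebesgue. f (y + c)) = (LINT y|lebesgue. f y)"
proof -
  have m: "f \<in> borel_measurable borel" using assms by (rule borel_measurable_continuous_onI)
  have m': "(\<lambda>y. f (y + c)) \<in> borel_measurable borel"
    by (intro borel_measurable_continuous_onI continuous_on_compose2[OF assms] continuous_intros) auto
  have "(LINT y|lebesgue. f (y + c)) = (LINT y|lborel. f (c + y))"
    using m' by (subst integral_completion) (auto simp: add.commute)
  also have "\<dots> = (LINT y|distr lborel borel ((+) c). f y)"
    using m by (subst integral_distr) auto
  also have "\<dots> = (LINT y|lebesgue. f y)"
    using m by (subst integral_completion) (auto simp: lborel_distr_plus)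
  finally show ?thesis .
qed

section \<open>Lebesgue points along cubes\<close>

text \<open>The cubes have \<open>x\<close> as their lower corner; accordingly the mollifier below is supported in such a
  corner cube instead of a ball around the origin.\<close>

definition cube_lebesgue_point :: "('a::euclidean_space \<Rightarrow> 'b::euclidean_space) \<Rightarrow> 'a \<Rightarrow> bool" where
  "cube_lebesgue_point f x \<longleftrightarrow> (\<forall>e>0. \<exists>d>0. \<forall>h. 0 < h \<and> h < d \<longrightarrow>
     integral (cbox x (x + h *\<^sub>R One)) (\<lambda>y. norm (f y - f x)) < e * h ^ DIM('a))"

text \<open>Averages of \<open>norm (f y - q)\<close> converge to \<open>norm (f x - q)\<close> almost everywhere for each fixed \<open>q\<close>.
  Letting \<open>q\<close> range over a countable dense set, one may choose \<open>q\<close> close to \<open>f x\<close>.\<close>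

lemma AE_cube_lebesgue_point:
  fixes f :: "'a::euclidean_space \<Rightarrow> 'b::euclidean_space"
  assumes meas: "f \<in> borel_measurable lebesgue" and bdd: "\<And>x. norm (f x) \<le> C"
  shows "AE x in lebesgue. cube_lebesgue_point f x"
proof -
  have int: "(\<lambda>y. norm (f y - q)) integrable_on cbox a b" for q a b
  proof (rule measurable_bounded_by_integrable_imp_integrable)
    show "(\<lambda>y. norm (f y - q)) \<in> borel_measurable (lebesgue_on (cbox a b))"
      using meas by (intro measurable_restrict_space1 borel_measurable_norm borel_measurable_diff) auto
    show "norm (norm (f x - q)) \<le> C + norm q" for x
      using bdd[of x] norm_triangle_ineq4[of "f x" q] by simp
  qed auto
  obtain D :: "'b set" where D: "countable D" "\<And>X. open X \<Longrightarrow> X \<noteq> {} \<Longrightarrow> \<exists>d \<in> D. d \<in> X"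
    using countable_dense_setE by blast
  define avg_tendsto where "avg_tendsto q x \<longleftrightarrow> (\<forall>e>0. \<exists>d>0. \<forall>h. 0 < h \<and> h < d \<longrightarrow>
      norm (integral (cbox x (x + h *\<^sub>R One)) (\<lambda>y. norm (f y - q)) /\<^sub>R h ^ DIM('a) - norm (f x - q)) < e)"
    for q x
  have "AE x in lebesgue. avg_tendsto q x" for q
  proof (rule integrable_ccontinuous_explicit[of "\<lambda>y. norm (f y - q)", OF int])
    fix N :: "'a set"
    assume N: "negligible N" and *: "\<And>x e. \<lbrakk>x \<notin> N; 0 < e\<rbrakk> \<Longrightarrow> \<exists>d>0. \<forall>h. 0 < h \<and> h < d \<longrightarrow>
      norm (integral (cbox x (x + h *\<^sub>R One)) (\<lambda>y. norm (f y - q)) /\<^sub>R h ^ DIM('a) - norm (f x - q)) < e"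
    have "avg_tendsto q x" if "x \<notin> N" for x
      unfolding avg_tendsto_def using *[OF that] by blast
    then show ?thesis
      using N by (intro AE_I'[of N]) (auto simp: negligible_iff_null_sets)
  qed
  then have "AE x in lebesgue. \<forall>q\<in>D. avg_tendsto q x"
    using AE_ball_countable[OF D(1), of "\<lambda>x q. avg_tendsto q x"] by simp
  then show ?thesis
  proof (rule eventually_mono)
    fix x assume x: "\<forall>q\<in>D. avg_tendsto q x"
    show "cube_lebesgue_point f x"
      unfolding cube_lebesgue_point_def
    proof (intro allI impI)
      fix e :: real assume e: "0 < e"
      obtain q where q: "q \<in> D" "q \<in> ball (f x) (e/3)"
        using D(2)[of "ball (f x) (e/3)"] e by auto
      then have xq: "norm (f x - q) < e/3" by (simp add: dist_norm)
      have "e/3 > 0" using e by simp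
      then obtain d where d: "d > 0" "\<And>h. 0 < h \<and> h < d \<Longrightarrow>
        norm (integral (cbox x (x + h *\<^sub>R One)) (\<lambda>y. norm (f y - q)) /\<^sub>R h ^ DIM('a) - norm (f x - q)) < e/3"
        using x q(1) unfolding avg_tendsto_def by blast
      show "\<exists>d>0. \<forall>h. 0 < h \<and> h < d \<longrightarrow>
           integral (cbox x (x + h *\<^sub>R One)) (\<lambda>y. norm (f y - f x)) < e * h ^ DIM('a)"
      proof (intro exI[of _ d] conjI allI impI d(1))
        fix h assume h: "0 < h \<and> h < d"
        let ?Q = "cbox x (x + h *\<^sub>R One)"
        have cont: "content ?Q = h ^ DIM('a)"
          using h by (subst content_cbox') (auto simp: box_ne_empty algebra_simps inner_add_left)
        have le: "norm (f y - f x) \<le> norm (f y - q) + e/3" for y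
          using xq norm_triangle_ineq4[of "f y - q" "f x - q"] by simp
        have "integral ?Q (\<lambda>y. norm (f y - f x)) \<le> integral ?Q (\<lambda>y. norm (f y - q) + e/3)"
          by (intro integral_le int integrable_add integrable_const le)
        also have "\<dots> = integral ?Q (\<lambda>y. norm (f y - q)) + e/3 * h ^ DIM('a)"
          using cont h by (subst Henstock_Kurzweil_Integration.integral_add) (auto intro: int integrable_const)
        also have "integral ?Q (\<lambda>y. norm (f y - q)) < (2*e/3) * h ^ DIM('a)"
        proof -
          let ?I = "integral ?Q (\<lambda>y. norm (f y - q))"
          have "\<bar>?I /\<^sub>R h ^ DIM('a) - norm (f x - q)\<bar> < e/3"
            using d(2)[OF h] by (simp only: real_norm_def)
          then have "?I /\<^sub>R h ^ DIM('a) < 2*e/3"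
            using xq by linarith
          then have "h ^ DIM('a) * (?I /\<^sub>R h ^ DIM('a)) < h ^ DIM('a) * (2*e/3)"
            using h by (intro mult_strict_left_mono) auto
          moreover have "h ^ DIM('a) * (?I /\<^sub>R h ^ DIM('a)) = ?I" using h by simp
          ultimately show ?thesis by (simp only: mult.commute)
        qed
        finally show "integral ?Q (\<lambda>y. norm (f y - f x)) < e * h ^ DIM('a)"
          by (simp add: algebra_simps)
      qed
    qed
  qed
qed

section \<open>Mollification\<close>

text \<open>The simplest nonnegative function with a continuous derivative that vanishes on a half line;
  mollifiers and cutoffs are both built from it.\<close>

definition pos_square :: "real \<Rightarrow> real" where "pos_square t = (max 0 t)\<^sup>2"

lemma DERIV_pos_square: "(pos_square has_real_derivative 2 * max 0 t) (at t)"
proof -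
  consider "t < 0" | "t > 0" | "t = 0" by linarith
  then show ?thesis
  proof cases
    case 1
    have "((\<lambda>_. 0) has_real_derivative 0) (at t)" by simp
    then have "(pos_square has_real_derivative 0) (at t)"
      by (rule has_field_derivative_transform_within_open[of _ _ _ "{..<0}"])
         (use 1 in \<open>auto simp: pos_square_def\<close>)
    then show ?thesis using 1 by simp
  next
    case 2
    have "((\<lambda>t. t\<^sup>2) has_real_derivative 2 * t) (at t)"
      by (auto intro!: derivative_eq_intros)
    then have "(pos_square has_real_derivative 2 * t) (at t)"
      by (rule has_field_derivative_transform_within_open[of _ _ _ "{0<..}"])
         (use 2 in \<open>auto simp: pos_square_def\<close>)
    then show ?thesis using 2 by simp
  next
    case 3
    have "((\<lambda>h. pos_square h / h) \<longlongrightarrow> 0) (at 0)"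
    proof (rule Lim_null_comparison)
      show "\<forall>\<^sub>F h in at 0. norm (pos_square h / h) \<le> \<bar>h\<bar>"
        by (intro always_eventually allI) (auto simp: pos_square_def max_def power2_eq_square)
      show "((\<lambda>h::real. \<bar>h\<bar>) \<longlongrightarrow> 0) (at 0)"
        by (intro tendsto_rabs_zero tendsto_ident_at)
    qed
    then show ?thesis using 3 by (simp add: DERIV_def pos_square_def)
  qed
qed

lemma has_derivative_pos_square [derivative_intros]:
  assumes "(f has_derivative f') (at x within S)"
  shows "((\<lambda>y. pos_square (f y)) has_derivative (\<lambda>h. 2 * max 0 (f x) * f' h)) (at x within S)"
  using has_derivative_compose[OF assms DERIV_pos_square[unfolded has_field_derivative_def]]
  by (simp add: o_def)

lemma continuous_on_pos_square [continuous_intros]: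
  assumes "continuous_on S f"
  shows " continuous_on S (\<lambda>y. pos_square (f y))"
  unfolding pos_square_def by (intro continuous_intros assms)

text \<open>A nonnegative function with continuous gradient whose support is the ball inscribed in the cube
  with lower corner \<open>0\<close> and side \<open>\<epsilon>\<close>. It is not normalised; dividing by \<open>bump_mass\<close> does that.\<close>

definition bump :: "real \<Rightarrow> real^'n \<Rightarrow> real" where
  "bump \<epsilon> y = pos_square ((\<epsilon>/2)\<^sup>2 - (y - (\<epsilon>/2) *\<^sub>R One) \<bullet> (y - (\<epsilon>/2) *\<^sub>R One))"

definition bump_gradient :: "real \<Rightarrow> real^'n \<Rightarrow> real^'n" where
  "bump_gradient \<epsilon> y = (- 4 * max 0 ((\<epsilon>/2)\<^sup>2 - (y - (\<epsilon>/2) *\<^sub>R One) \<bullet> (y - (\<epsilon>/2) *\<^sub>R One))) *\<^sub>R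
     (y - (\<epsilon>/2) *\<^sub>R One)"

lemma bump_has_derivative:
  fixes y :: "real^'n"
  shows "(bump \<epsilon> has_derivative (\<lambda>h. bump_gradient \<epsilon> y \<bullet> h)) (at y)"
proof -
  let ?c = "(\<epsilon>/2) *\<^sub>R One :: real^'n"
  have "((\<lambda>y. (\<epsilon>/2)\<^sup>2 - (y - ?c) \<bullet> (y - ?c)) has_derivative (\<lambda>h. - (2 * ((y - ?c) \<bullet> h)))) (at y)"
    by (auto intro!: derivative_eq_intros simp: inner_commute)
  from has_derivative_pos_square[OF this] show ?thesis
    unfolding bump_def bump_gradient_def
    by (rule has_derivative_eq_rhs) (simp add: fun_eq_iff)
qed

lemma continuous_on_bump [continuous_intros]:
  assumes "continuous_on S f"
  shows " continuous_on S (\<lambda>y. bump \<epsilon> (f y))"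
  unfolding bump_def by (intro continuous_intros assms)

lemma continuous_on_bump_gradient [continuous_intros]:
  assumes "continuous_on S f"
  shows " continuous_on S (\<lambda>y. bump_gradient \<epsilon> (f y))"
  unfolding bump_gradient_def by (intro continuous_intros assms)

lemma bump_nonneg: "0 \<le> bump \<epsilon> y" by (simp add: bump_def pos_square_def)

lemma bump_le: "bump \<epsilon> y \<le> \<epsilon>^4 / 16"
proof -
  have "bump \<epsilon> y \<le> ((\<epsilon>/2)\<^sup>2)\<^sup>2"
    unfolding bump_def pos_square_def by (intro power_mono) auto
  then show ?thesis by (simp add: power_divide)
qed

lemma bump_eq_0: "bump \<epsilon> y = 0" if "y \<notin> cball ((\<epsilon>/2) *\<^sub>R One) (\<epsilon>/2)" "\<epsilon> > 0"
proof -
  have "\<epsilon>/2 < norm (y - (\<epsilon>/2) *\<^sub>R One)"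
    using that by (simp add: dist_norm norm_minus_commute)
  then have "(\<epsilon>/2)\<^sup>2 < (norm (y - (\<epsilon>/2) *\<^sub>R One))\<^sup>2"
    using that by (intro power_strict_mono) auto
  then show ?thesis
    by (simp add: bump_def pos_square_def power2_norm_eq_inner)
qed

lemma bump_support_subset_cube:
  "cball ((\<epsilon>/2) *\<^sub>R One) (\<epsilon>/2) \<subseteq> cbox (0 :: real^'n) (\<epsilon> *\<^sub>R One)"
proof
  fix y :: "real^'n" assume y: "y \<in> cball ((\<epsilon>/2) *\<^sub>R One) (\<epsilon>/2)"
  show "y \<in> cbox 0 (\<epsilon> *\<^sub>R One)"
    unfolding mem_box
  proof (intro ballI)
    fix b :: "real^'n" assume b: "b \<in> Basis"
    have "\<bar>(y - (\<epsilon>/2) *\<^sub>R One) \<bullet> b\<bar> \<le> \<epsilon>/2"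
      using Basis_le_norm[OF b, of "y - (\<epsilon>/2) *\<^sub>R One"] y by (simp add: dist_norm norm_minus_commute)
    then show "0 \<bullet> b \<le> y \<bullet> b \<and> y \<bullet> b \<le> (\<epsilon> *\<^sub>R One) \<bullet> b"
      using b by (simp add: inner_diff_left abs_le_iff abs_if split: if_splits)
  qed
qed

lemma borel_measurable_bump: "(\<lambda>y. bump \<epsilon> (y - x)) \<in> borel_measurable lebesgue"
proof -
  have "(\<lambda>y. bump \<epsilon> (y - x)) \<in> borel_measurable borel"
    by (intro borel_measurable_continuous_onI continuous_intros)
  then show ?thesis by (intro measurable_completion) simp
qed

lemma integrable_bump:
  assumes "\<epsilon> > 0"
  shows "integrable lebesgue (bump \<epsilon> :: real^'n \<Rightarrow> real)"
proof (rule integrable_lebesgue_bounded_support[where C = "\<epsilon>^4/16" and S = "cball ((\<epsilon>/2) *\<^sub>R One) (\<epsilon>/2)"])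
  show "(bump \<epsilon> :: real^'n \<Rightarrow> real) \<in> borel_measurable lebesgue"
    using borel_measurable_bump[of \<epsilon> "0::real^'n"] by simp
  show "norm (bump \<epsilon> y) \<le> \<epsilon>^4/16" for y :: "real^'n"
    using bump_le[of \<epsilon> y] bump_nonneg[of \<epsilon> y] by (simp add: abs_of_nonneg)
  show "bump \<epsilon> y = 0" if "y \<notin> cball ((\<epsilon>/2) *\<^sub>R One) (\<epsilon>/2)" for y :: "real^'n"
    using bump_eq_0[OF that assms] .
  show "bounded (cball ((\<epsilon>/2) *\<^sub>R One) (\<epsilon>/2) :: (real^'n) set)"
    by (rule bounded_cball)
qed

definition bump_mass :: "'n::finite itself \<Rightarrow> real \<Rightarrow> real" where
  "bump_mass _ \<epsilon> = (LINT y|lebesgue. bump \<epsilon> (y :: real^'n))"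

text \<open>Together with \<open>bump_le\<close> this bounds the normalised mollifier by a constant times \<open>1 / \<epsilon>^n\<close>, which
  is what Lebesgue points require. On the ball of radius \<open>\<epsilon>/3\<close> the defining expression is at least
  \<open>\<epsilon>\<^sup>2/4 - \<epsilon>\<^sup>2/9 \<ge> \<epsilon>\<^sup>2/8\<close>.\<close>

lemma bump_mass_ge:
  assumes "\<epsilon> > 0"
  shows "\<epsilon>^4 / 64 * (unit_ball_vol (CARD('n)) * (\<epsilon>/3) ^ CARD('n)) \<le> bump_mass TYPE('n::finite) \<epsilon>"
proof -
  let ?B = "cball ((\<epsilon>/2) *\<^sub>R One) (\<epsilon>/3) :: (real^'n) set"
  have "(LINT y|lebesgue. indicator ?B y *\<^sub>R (\<epsilon>^4/64)) \<le> bump_mass TYPE('n) \<epsilon>"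
    unfolding bump_mass_def
  proof (rule integral_mono)
    show "integrable lebesgue (\<lambda>y. indicator ?B y *\<^sub>R (\<epsilon>^4/64))"
    proof (rule integrable_lebesgue_bounded_support[of _ "\<epsilon>^4/64" ?B])
      show "(\<lambda>y. indicator ?B y *\<^sub>R (\<epsilon>^4/64)) \<in> borel_measurable lebesgue"
        by (intro borel_measurable_scaleR borel_measurable_indicator borel_measurable_const lmeasurable_cball[THEN fmeasurableD])
    qed (auto split: split_indicator)
    show "integrable lebesgue (bump \<epsilon> :: real^'n \<Rightarrow> real)"
      using assms by (rule integrable_bump)
    fix y :: "real^'n"
    show "indicator ?B y *\<^sub>R (\<epsilon>^4/64) \<le> bump \<epsilon> y"
    proof (cases "y \<in> ?B")
      case True
      have "(norm (y - (\<epsilon>/2) *\<^sub>R One))\<^sup>2 \<le> (\<epsilon>/3)\<^sup>2"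
        using True by (intro power_mono) (auto simp: dist_norm norm_minus_commute)
      also have "\<dots> \<le> \<epsilon>\<^sup>2/8" by (simp add: power_divide)
      finally have *: "\<epsilon>\<^sup>2/8 \<le> (\<epsilon>/2)\<^sup>2 - (y - (\<epsilon>/2) *\<^sub>R One) \<bullet> (y - (\<epsilon>/2) *\<^sub>R One)"
        by (simp add: power2_norm_eq_inner power_divide)
      have "(\<epsilon>\<^sup>2/8)\<^sup>2 \<le> bump \<epsilon> y"
        unfolding bump_def pos_square_def using * by (intro power_mono) (auto simp: le_max_iff_disj)
      then show ?thesis using True by (simp add: power_divide)
    qed (simp add: bump_nonneg)
  qed
  moreover have "(LINT y|lebesgue. indicator ?B y *\<^sub>R (\<epsilon>^4/64)) = \<epsilon>^4/64 * measure lebesgue ?B"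
    by simp
  ultimately show ?thesis using assms by (simp add: content_cball mult_ac)
qed

lemma bump_mass_pos: "\<epsilon> > 0 \<Longrightarrow> bump_mass TYPE('n::finite) \<epsilon> > 0"
  by (rule less_le_trans[OF _ bump_mass_ge]) simp_all

lemma integral_bump_shift: "(LINT y|lebesgue. bump \<epsilon> (y - x)) = bump_mass TYPE('n) \<epsilon>"
  for x :: "real^'n"
  using integral_lebesgue_shift[OF continuous_on_bump[OF continuous_on_id], of \<epsilon> "- x"]
  by (simp add: bump_mass_def)

definition mollify :: "real \<Rightarrow> (real^'n \<Rightarrow> 'b::euclidean_space) \<Rightarrow> real^'n \<Rightarrow> 'b" where
  "mollify \<epsilon> f x = (LINT y|lebesgue. bump \<epsilon> (y - x) *\<^sub>R f y) /\<^sub>R bump_mass TYPE('n) \<epsilon>"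

lemma test_function_bump:
  fixes x :: "real^'n"
  assumes "\<epsilon> > 0" and "cball (x + (\<epsilon>/2) *\<^sub>R One) (\<epsilon>/2) \<subseteq> B"
  shows "test_function B (\<lambda>y. bump \<epsilon> (y - x)) (\<lambda>y. bump_gradient \<epsilon> (y - x))"
  unfolding test_function_def
proof (intro conjI allI)
  have "bump \<epsilon> (y - x) = 0" if "y \<notin> cball (x + (\<epsilon>/2) *\<^sub>R One) (\<epsilon>/2)" for y :: "real^'n"
    using that assms(1) by (intro bump_eq_0) (auto simp: dist_norm algebra_simps)
  with assms show "\<exists>K. compact K \<and> K \<subseteq> B \<and> (\<forall>y. y \<notin> K \<longrightarrow> bump \<epsilon> (y - x) = 0)"
    by (intro exI[of _ "cball (x + (\<epsilon>/2) *\<^sub>R One) (\<epsilon>/2)"]) auto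
  show "((\<lambda>y. bump \<epsilon> (y - x)) has_derivative (\<lambda>h. bump_gradient \<epsilon> (y - x) \<bullet> h)) (at y)" for y
    by (rule has_derivative_eq_rhs[OF has_derivative_compose[OF _ bump_has_derivative]])
       (auto intro!: derivative_eq_intros)
  show "continuous_on UNIV (\<lambda>y. bump_gradient \<epsilon> (y - x))"
    by (intro continuous_intros)
qed

lemma integrable_bump_mult:
  fixes f :: "real^'n \<Rightarrow> 'b::euclidean_space"
  assumes "f \<in> borel_measurable lebesgue" and "\<And>x. norm (f x) \<le> C" and "\<epsilon> > 0"
  shows "integrable lebesgue (\<lambda>y. bump \<epsilon> (y - x) *\<^sub>R f y)"
proof (rule integrable_lebesgue_bounded_support[of _ "\<epsilon>^4/16 * C" "cball (x + (\<epsilon>/2) *\<^sub>R One) (\<epsilon>/2)"])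
  show "(\<lambda>y. bump \<epsilon> (y - x) *\<^sub>R f y) \<in> borel_measurable lebesgue"
    by (intro borel_measurable_scaleR borel_measurable_bump assms(1))
  show "norm (bump \<epsilon> (y - x) *\<^sub>R f y) \<le> \<epsilon>^4/16 * C" for y
    unfolding norm_scaleR using bump_nonneg[of \<epsilon> "y - x"] bump_le[of \<epsilon> "y - x"] assms(2)[of y]
    by (intro mult_mono) auto
  show "bump \<epsilon> (y - x) *\<^sub>R f y = 0" if "y \<notin> cball (x + (\<epsilon>/2) *\<^sub>R One) (\<epsilon>/2)" for y
    using that assms(3) bump_eq_0[of "y - x" \<epsilon>] by (auto simp: dist_norm algebra_simps)
qed auto

lemma norm_mollify_le:
  fixes f :: "real^'n \<Rightarrow> 'b::euclidean_space"
  assumes "f \<in> borel_measurable lebesgue" and "\<And>x. norm (f x) \<le> C" and "\<epsilon> > 0"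
  shows "norm (mollify \<epsilon> f x) \<le> C"
proof -
  have "norm (LINT y|lebesgue. bump \<epsilon> (y - x) *\<^sub>R f y) \<le> (LINT y|lebesgue. bump \<epsilon> (y - x) *\<^sub>R C)"
  proof (rule Bochner_Integration.integral_norm_bound_integral)
    show "integrable lebesgue (\<lambda>y. bump \<epsilon> (y - x) *\<^sub>R C)"
      by (rule integrable_bump_mult[of _ "\<bar>C\<bar>"]) (use assms in auto)
    show "norm (bump \<epsilon> (y - x) *\<^sub>R f y) \<le> bump \<epsilon> (y - x) *\<^sub>R C" for y
      using assms(2)[of y] bump_nonneg[of \<epsilon> "y - x"] by (simp add: mult_left_mono)
    show "integrable lebesgue (\<lambda>y. bump \<epsilon> (y - x) *\<^sub>R f y)"
      by (rule integrable_bump_mult[OF assms])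
  qed
  also have "\<dots> = bump_mass TYPE('n) \<epsilon> * C"
    by (simp add: integral_bump_shift)
  finally show ?thesis
    using bump_mass_pos[OF assms(3), where 'n='n]
    by (simp add: mollify_def divide_inverse_commute[symmetric] pos_divide_le_eq mult.commute)
qed

text \<open>The kernel is at most \<open>M / \<epsilon>^n\<close> and lives on the cube of side \<open>\<epsilon>\<close>, so the error at \<open>x\<close> is at most
  \<open>M\<close> times the average of \<open>norm (f y - f x)\<close> over that cube.\<close>

lemma AE_mollify_tendsto:
  fixes f :: "real^'n \<Rightarrow> 'b::euclidean_space"
  assumes meas: "f \<in> borel_measurable lebesgue" and bdd: "\<And>x. norm (f x) \<le> C"
  shows "AE x in lebesgue. ((\<lambda>\<epsilon>. mollify \<epsilon> f x) \<longlongrightarrow> f x) (at_right 0)"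
proof -
  \<comment> \<open>The quotient of the upper bound \<open>\<epsilon>^4/16\<close> for the bump and the lower bound for its mass is \<open>M / \<epsilon>^n\<close>.\<close>
  define M where "M = 4 * 3 ^ CARD('n) / unit_ball_vol (CARD('n))"
  have M: "M > 0" by (simp add: M_def)
  have key: "norm (mollify \<epsilon> f x - f x) \<le> M / \<epsilon>^CARD('n) * integral (cbox x (x + \<epsilon> *\<^sub>R One)) (\<lambda>y. norm (f y - f x))"
    if \<epsilon>: "\<epsilon> > 0" for \<epsilon> x
  proof -
    let ?m = "bump_mass TYPE('n) \<epsilon>" and ?Q = "cbox x (x + \<epsilon> *\<^sub>R One)"
    have m: "?m > 0" using bump_mass_pos[OF \<epsilon>] .
    have bd: "norm (f y - f x) \<le> 2 * C" for y
      using norm_triangle_ineq4[of "f y" "f x"] bdd[of x] bdd[of y] by linarith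
    have measd: "(\<lambda>y. f y - f x) \<in> borel_measurable lebesgue" using meas by measurable
    have intd: "integrable lebesgue (\<lambda>y. indicator ?Q y *\<^sub>R norm (f y - f x))"
    proof (rule integrable_lebesgue_bounded_support[of _ "2*C" ?Q])
      show "(\<lambda>y. indicator ?Q y *\<^sub>R norm (f y - f x)) \<in> borel_measurable lebesgue"
        by (intro borel_measurable_scaleR borel_measurable_indicator fmeasurableD[OF lmeasurable_cbox])
           (use measd in measurable)
    qed (use bd order_trans[OF norm_ge_zero bd[of x]] in \<open>auto split: split_indicator\<close>)
    have quot: "bump \<epsilon> z / ?m \<le> M / \<epsilon>^CARD('n)" for z :: "real^'n"
    proof -
      have "bump \<epsilon> z / ?m \<le> (\<epsilon>^4/16) / (\<epsilon>^4 / 64 * (unit_ball_vol (CARD('n)) * (\<epsilon>/3) ^ CARD('n)))"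
        using \<epsilon> by (intro frac_le bump_le bump_mass_ge bump_nonneg) auto
      also have "\<dots> = M / \<epsilon>^CARD('n)" using \<epsilon> by (simp add: M_def field_simps)
      finally show ?thesis .
    qed
    have "mollify \<epsilon> f x - f x = (LINT y|lebesgue. bump \<epsilon> (y - x) *\<^sub>R (f y - f x)) /\<^sub>R ?m"
    proof -
      have "(LINT y|lebesgue. bump \<epsilon> (y - x) *\<^sub>R (f y - f x)) =
          (LINT y|lebesgue. bump \<epsilon> (y - x) *\<^sub>R f y) - (LINT y|lebesgue. bump \<epsilon> (y - x) *\<^sub>R f x)"
        unfolding scaleR_diff_right
        by (intro Bochner_Integration.integral_diff integrable_bump_mult[of _ C] meas bdd \<epsilon>) auto
      also have "(LINT y|lebesgue. bump \<epsilon> (y - x) *\<^sub>R f x) = ?m *\<^sub>R f x"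
        using integrable_bump_mult[of "\<lambda>_. 1::real" 1 \<epsilon> x] \<epsilon>
        by (subst integral_scaleR_left) (auto simp: integral_bump_shift)
      finally show ?thesis using m by (simp add: mollify_def scaleR_diff_right)
    qed
    also have "\<dots> = (LINT y|lebesgue. (bump \<epsilon> (y - x) / ?m) *\<^sub>R (f y - f x))"
      by (simp add: divide_inverse_commute integral_scaleR_right[symmetric] del: integral_scaleR_right)
    finally have eq: "mollify \<epsilon> f x - f x = (LINT y|lebesgue. (bump \<epsilon> (y - x) / ?m) *\<^sub>R (f y - f x))" .
    have "norm (mollify \<epsilon> f x - f x) \<le> (LINT y|lebesgue. M / \<epsilon>^CARD('n) * (indicator ?Q y *\<^sub>R norm (f y - f x)))"
      unfolding eq
    proof (rule Bochner_Integration.integral_norm_bound_integral)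
      show "integrable lebesgue (\<lambda>y. (bump \<epsilon> (y - x) / ?m) *\<^sub>R (f y - f x))"
        using integrable_scaleR_right[OF integrable_bump_mult[OF measd bd \<epsilon>, of x], of "inverse ?m"]
        by (simp add: divide_inverse_commute)
      show "integrable lebesgue (\<lambda>y. M / \<epsilon>^CARD('n) * (indicator ?Q y *\<^sub>R norm (f y - f x)))"
        using intd by (intro integrable_mult_right) auto
      fix y
      show "norm ((bump \<epsilon> (y - x) / ?m) *\<^sub>R (f y - f x)) \<le> M / \<epsilon>^CARD('n) * (indicator ?Q y *\<^sub>R norm (f y - f x))"
      proof (cases "y \<in> ?Q")
        case True
        have "norm ((bump \<epsilon> (y - x) / ?m) *\<^sub>R (f y - f x)) = bump \<epsilon> (y - x) / ?m * norm (f y - f x)"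
          using bump_nonneg[of \<epsilon> "y - x"] m by simp
        also have "\<dots> \<le> M / \<epsilon>^CARD('n) * norm (f y - f x)"
          by (intro mult_right_mono quot norm_ge_zero)
        finally show ?thesis using True by simp
      next
        case False
        then have "y - x \<notin> cbox 0 (\<epsilon> *\<^sub>R One)"
          by (auto simp: mem_box algebra_simps inner_diff_left inner_add_left)
        then have "bump \<epsilon> (y - x) = 0"
          using bump_support_subset_cube bump_eq_0[OF _ \<epsilon>] by blast
        then show ?thesis using False by simp
      qed
    qed
    also have "\<dots> = M / \<epsilon>^CARD('n) * integral ?Q (\<lambda>y. norm (f y - f x))"
      using set_lebesgue_integral_eq_integral(2)[of ?Q "\<lambda>y. norm (f y - f x)"] intd
      unfolding set_integrable_def set_lebesgue_integral_def by simp
    finally show ?thesis .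
  qed
  show ?thesis
    using AE_cube_lebesgue_point[OF assms]
  proof (rule eventually_mono)
    fix x assume x: "cube_lebesgue_point f x"
    show "((\<lambda>\<epsilon>. mollify \<epsilon> f x) \<longlongrightarrow> f x) (at_right 0)"
      unfolding tendsto_iff
    proof (intro allI impI)
      fix e :: real assume e: "e > 0"
      obtain d where d: "d > 0" "\<And>h. 0 < h \<and> h < d \<Longrightarrow>
           integral (cbox x (x + h *\<^sub>R One)) (\<lambda>y. norm (f y - f x)) < e / M * h ^ CARD('n)"
        using x M e unfolding cube_lebesgue_point_def by (metis divide_pos_pos DIM_cart DIM_real mult.right_neutral)
      have "dist (mollify \<epsilon> f x) (f x) < e" if "0 < \<epsilon>" "\<epsilon> < d" for \<epsilon>
      proof -
        have "norm (mollify \<epsilon> f x - f x) \<le> M / \<epsilon>^CARD('n) * integral (cbox x (x + \<epsilon> *\<^sub>R One)) (\<lambda>y. norm (f y - f x))"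
          by (rule key[OF that(1)])
        also have "\<dots> < M / \<epsilon>^CARD('n) * (e / M * \<epsilon> ^ CARD('n))"
          using d(2)[of \<epsilon>] that M by (intro mult_strict_left_mono) auto
        also have "\<dots> = e" using M that by simp
        finally show ?thesis by (simp add: dist_norm)
      qed
      then show "\<forall>\<^sub>F \<epsilon> in at_right 0. dist (mollify \<epsilon> f x) (f x) < e"
        unfolding eventually_at_right_field using d(1) by (intro exI[of _ d]) auto
    qed
  qed
qed

text \<open>Mollification enlarges the support only towards smaller coordinates, by at most one side length.\<close>

lemma mollify_eq_0:
  fixes f :: "real^'n \<Rightarrow> 'b::euclidean_space"
  assumes "\<And>y. y \<notin> cbox p q \<Longrightarrow> f y = 0" and "0 < \<epsilon>" "\<epsilon> \<le> 1" and x: "x \<notin> cbox (p - One) q"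
  shows "mollify \<epsilon> f x = 0"
proof -
  have "bump \<epsilon> (y - x) *\<^sub>R f y = 0" for y
  proof (rule ccontr)
    assume "bump \<epsilon> (y - x) *\<^sub>R f y \<noteq> 0"
    then have f: "f y \<noteq> 0" and b: "bump \<epsilon> (y - x) \<noteq> 0" by auto
    have "y \<in> cbox p q" using assms(1)[of y] f by blast
    moreover have "y - x \<in> cbox 0 (\<epsilon> *\<^sub>R One)"
      using bump_eq_0[OF _ assms(2), of "y - x"] bump_support_subset_cube[of \<epsilon>] b by blast
    ultimately have "x \<in> cbox (p - One) q"
      using assms(3) unfolding mem_box by (force simp: inner_diff_left)
    with x show False by simp
  qed
  then have eq: "(\<lambda>y. bump \<epsilon> (y - x) *\<^sub>R f y) = (\<lambda>_. 0)" by (rule ext)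
  show ?thesis unfolding mollify_def eq by simp
qed

lemma mollify_component:
  fixes G :: "real^'n \<Rightarrow> 'b::euclidean_space^'m"
  assumes "G \<in> borel_measurable lebesgue" and "\<And>y. norm (G y) \<le> C" and "\<epsilon> > 0"
  shows "mollify \<epsilon> (\<lambda>y. G y $ j) x = mollify \<epsilon> G x $ j"
  using integral_bounded_linear[OF bounded_linear_vec_nth[of j] integrable_bump_mult[OF assms, of x]]
  by (simp add: mollify_def)

section \<open>Weak gradients of essentially bounded functions\<close>

lemma continuous_on_test_function:
  assumes "test_function B \<psi> g"
  shows "continuous_on UNIV \<psi>"
  using assms unfolding test_function_def
  by (intro continuous_at_imp_continuous_on) (auto intro: has_derivative_continuous)

text \<open>Passing to a representative that is bounded everywhere and extended by zero makes all later
  integrability arguments pointwise.\<close>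

lemma ess_bounded_representative:
  fixes f :: "real^'n \<Rightarrow> 'b::euclidean_space"
  assumes "ess_bounded B f" and B: "open B"
  obtains f\<^sub>0 C where "f\<^sub>0 \<in> borel_measurable lebesgue" and "\<And>y. norm (f\<^sub>0 y) \<le> C"
    and "\<And>y. y \<notin> B \<Longrightarrow> f\<^sub>0 y = 0" and "AE y in lebesgue_on B. f\<^sub>0 y = f y"
proof -
  obtain C where C: "AE y in lebesgue_on B. norm (f y) \<le> C"
    and meas: "f \<in> borel_measurable (lebesgue_on B)"
    using assms(1) unfolding ess_bounded_def by blast
  have Bs: "B \<inter> space lebesgue \<in> sets lebesgue" using B by simp
  define f1 where "f1 y = indicator B y *\<^sub>R f y" for y
  have f1: "f1 \<in> borel_measurable lebesgue"
    using meas borel_measurable_restrict_space_iff[OF Bs, of f]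
    by (simp add: f1_def[abs_def])
  define f\<^sub>0 where "f\<^sub>0 y = (if norm (f1 y) \<le> C then f1 y else 0)" for y
  have f0: "f\<^sub>0 \<in> borel_measurable lebesgue"
    unfolding f\<^sub>0_def[abs_def] using f1 by measurable
  have ae: "AE y in lebesgue_on B. f\<^sub>0 y = f y"
    using C AE_space by eventually_elim (simp add: f\<^sub>0_def f1_def)
  show ?thesis
  proof (rule that[OF f0 _ _ ae])
    show "norm (f\<^sub>0 y) \<le> \<bar>C\<bar>" for y by (auto simp: f\<^sub>0_def)
    show "f\<^sub>0 y = 0" if "y \<notin> B" for y using that by (simp add: f\<^sub>0_def f1_def)
  qed
qed

lemma integral_representative:
  fixes f f\<^sub>0 :: "real^'n \<Rightarrow> 'b::euclidean_space"
  assumes B: "open B" and f: "f \<in> borel_measurable (lebesgue_on B)" and f0: "f\<^sub>0 \<in> borel_measurable lebesgue"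
    and out: "\<And>y. y \<notin> B \<Longrightarrow> f\<^sub>0 y = 0" and ae: "AE y in lebesgue_on B. f\<^sub>0 y = f y"
    and "continuous_on UNIV \<psi>"
  shows "(LINT y|lebesgue_on B. \<psi> y *\<^sub>R f y) = (LINT y|lebesgue. \<psi> y *\<^sub>R f\<^sub>0 y)"
proof -
  have Bs: "B \<inter> space lebesgue \<in> sets lebesgue" using B by simp
  have \<psi>: "\<psi> \<in> borel_measurable lebesgue"
    using assms(6) by (rule borel_measurable_lebesgue_continuous)
  have "(LINT y|lebesgue_on B. \<psi> y *\<^sub>R f y) = (LINT y|lebesgue_on B. \<psi> y *\<^sub>R f\<^sub>0 y)"
  proof (rule integral_cong_AE)
    show "(\<lambda>y. \<psi> y *\<^sub>R f y) \<in> borel_measurable (lebesgue_on B)"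
      using f measurable_restrict_space1[OF \<psi>] by measurable
    show "(\<lambda>y. \<psi> y *\<^sub>R f\<^sub>0 y) \<in> borel_measurable (lebesgue_on B)"
      using \<psi> f0 by (intro measurable_restrict_space1) measurable
    show "AE y in lebesgue_on B. \<psi> y *\<^sub>R f y = \<psi> y *\<^sub>R f\<^sub>0 y"
      using ae by eventually_elim simp
  qed
  also have "\<dots> = (LINT y|lebesgue. indicator B y *\<^sub>R (\<psi> y *\<^sub>R f\<^sub>0 y))"
    by (rule integral_restrict_space[OF Bs])
  also have "\<dots> = (LINT y|lebesgue. \<psi> y *\<^sub>R f\<^sub>0 y)"
    using out by (intro Bochner_Integration.integral_cong refl) (auto simp: indicator_def)
  finally show ?thesis .
qed

text \<open>The shifted bump functions are test functions, so at each point of \<open>B\<close> the mollifications of \<open>f\<close>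
  vanish for small \<open>\<epsilon>\<close>, while they converge to \<open>f\<close> almost everywhere.\<close>

lemma fundamental_lemma_calculus_of_variations:
  fixes f :: "real^'n \<Rightarrow> 'b::euclidean_space"
  assumes B: "open B" and f: "ess_bounded B f"
    and zero: "\<And>\<psi> g. test_function B \<psi> g \<Longrightarrow> (LINT y|lebesgue_on B. \<psi> y *\<^sub>R f y) = 0"
  shows "AE y in lebesgue_on B. f y = 0"
proof -
  obtain f\<^sub>0 C where f0: "f\<^sub>0 \<in> borel_measurable lebesgue" "\<And>y. norm (f\<^sub>0 y) \<le> C"
    and out: "\<And>y. y \<notin> B \<Longrightarrow> f\<^sub>0 y = 0" and ae: "AE y in lebesgue_on B. f\<^sub>0 y = f y"
    by (rule ess_bounded_representative[OF f B]) blast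
  have meas: "f \<in> borel_measurable (lebesgue_on B)" using f unfolding ess_bounded_def by blast
  have int: "(LINT y|lebesgue_on B. \<psi> y *\<^sub>R f y) = (LINT y|lebesgue. \<psi> y *\<^sub>R f\<^sub>0 y)"
    if "continuous_on UNIV \<psi>" for \<psi>
    by (rule integral_representative[OF B meas f0(1) out ae that])
  have "AE x in lebesgue. x \<in> B \<longrightarrow> f\<^sub>0 x = 0"
    using AE_mollify_tendsto[OF f0]
  proof (rule eventually_mono, intro impI)
    fix x assume lim: "((\<lambda>\<epsilon>. mollify \<epsilon> f\<^sub>0 x) \<longlongrightarrow> f\<^sub>0 x) (at_right 0)" and "x \<in> B"
    then obtain r where r: "r > 0" "cball x r \<subseteq> B" using B open_contains_cball by blast
    \<comment> \<open>The support of the bump shifted by \<open>x\<close> lies within distance \<open>\<epsilon> (norm One + 1)\<close> of \<open>x\<close>.\<close>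
    define d where "d = r / (norm (One :: real^'n) + 1)"
    have d: "d > 0" using r by (simp add: d_def add_nonneg_pos)
    have "mollify \<epsilon> f\<^sub>0 x = 0" if \<epsilon>: "0 < \<epsilon>" "\<epsilon> < d" for \<epsilon>
    proof -
      have "cball (x + (\<epsilon>/2) *\<^sub>R One) (\<epsilon>/2) \<subseteq> cball x r"
      proof
        fix y assume "y \<in> cball (x + (\<epsilon>/2) *\<^sub>R One) (\<epsilon>/2)"
        then have "dist x y \<le> norm ((\<epsilon>/2) *\<^sub>R (One :: real^'n)) + \<epsilon>/2"
          using dist_triangle[of x y "x + (\<epsilon>/2) *\<^sub>R One"] by (simp add: dist_norm)
        also have "\<dots> \<le> \<epsilon> * (norm (One :: real^'n) + 1)"
        proof -
          have eq: "norm ((\<epsilon>/2) *\<^sub>R (One :: real^'n)) = \<epsilon>/2 * norm (One :: real^'n)"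
            using \<epsilon> by simp
          have "\<epsilon>/2 * norm (One :: real^'n) \<le> \<epsilon> * norm (One :: real^'n)"
            using \<epsilon> by (intro mult_right_mono) auto
          then show ?thesis
            unfolding eq distrib_left mult_1_right using \<epsilon> by linarith
        qed
        also have "\<dots> \<le> d * (norm (One :: real^'n) + 1)"
          using \<epsilon> by (intro mult_right_mono) auto
        also have "\<dots> = r"
          using norm_ge_zero[of "One :: real^'n"] unfolding d_def by (simp add: add_nonneg_eq_0_iff)
        finally show "y \<in> cball x r" by simp
      qed
      then have test: "test_function B (\<lambda>y. bump \<epsilon> (y - x)) (\<lambda>y. bump_gradient \<epsilon> (y - x))"
        using r \<epsilon> by (intro test_function_bump) auto
      then show ?thesis
        using zero[OF test] int[OF continuous_on_test_function[OF test]] by (simp add: mollify_def)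
    qed
    then have "\<forall>\<^sub>F \<epsilon> in at_right 0. mollify \<epsilon> f\<^sub>0 x = 0"
      unfolding eventually_at_right_field using d by blast
    then have "((\<lambda>\<epsilon>. mollify \<epsilon> f\<^sub>0 x) \<longlongrightarrow> 0) (at_right 0)"
      by (rule tendsto_eventually)
    with lim show "f\<^sub>0 x = 0" using tendsto_unique[OF trivial_limit_at_right_real] by blast
  qed
  then have "AE x in lebesgue_on B. f\<^sub>0 x = 0"
    using B by (simp add: AE_restrict_space_iff)
  with ae show ?thesis by eventually_elim simp
qed

lemma test_function_gradient_eq_0:
  fixes \<psi> :: "real^'n \<Rightarrow> real"
  assumes K: "compact K" "\<And>y. y \<notin> K \<Longrightarrow> \<psi> y = 0"
    and der: "(\<psi> has_derivative (\<lambda>h. g \<bullet> h)) (at y)" and y: "y \<notin> K"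
  shows "g = 0"
proof -
  have "(\<psi> has_derivative (\<lambda>h. 0)) (at y)"
    by (rule has_derivative_transform_within_open[OF has_derivative_const, of "- K"])
       (use K y compact_imp_closed in auto)
  then have "(\<lambda>h. g \<bullet> h) = (\<lambda>h. 0)" using der has_derivative_unique by blast
  then have "g \<bullet> g = 0" by (rule fun_cong)
  then show ?thesis by simp
qed

text \<open>The integral of \<open>\<psi> (y + s e\<^sub>j)\<close> does not depend on \<open>s\<close>; differentiate at \<open>s = 0\<close>.\<close>

lemma integral_test_function_gradient:
  fixes \<psi> :: "real^'n \<Rightarrow> real"
  assumes test: "test_function B \<psi> g"
  shows "(LINT y|lebesgue. g y $ j) = 0"
proof -
  obtain K where K: "compact K" "\<And>y. y \<notin> K \<Longrightarrow> \<psi> y = 0"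
    using test unfolding test_function_def by blast
  have der: "(\<psi> has_derivative (\<lambda>h. g y \<bullet> h)) (at y)" for y
    using test unfolding test_function_def by blast
  have g: "continuous_on UNIV g" using test unfolding test_function_def by blast
  have \<psi>: "continuous_on UNIV \<psi>" using continuous_on_test_function[OF test] .
  have g0: "g y = 0" if "y \<notin> K" for y
    using test_function_gradient_eq_0[OF K der that] .
  define e where "e = (axis j 1 :: real^'n)"
  have ne: "norm e = 1" by (simp add: e_def)
  obtain R where R: "K \<subseteq> ball 0 R"
    using bounded_subset_ballD[OF compact_imp_bounded[OF K(1)], of 0] by blast
  obtain a where a: "cball 0 (R + 1) \<subseteq> cbox (-a) (a :: real^'n)"
    using bounded_subset_cbox_symmetric[OF bounded_cball] by blast
  have far: "y + s *\<^sub>R e \<notin> K" if "y \<notin> cbox (-a) a" "\<bar>s\<bar> \<le> 1" for y s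
  proof
    assume "y + s *\<^sub>R e \<in> K"
    then have "y + s *\<^sub>R e \<in> ball 0 R" using R by blast
    then have "norm (y + s *\<^sub>R e) \<le> R" by simp
    moreover have "norm (s *\<^sub>R e) \<le> 1" using that ne by simp
    ultimately have "norm y \<le> R + 1"
      using norm_triangle_ineq4[of "y + s *\<^sub>R e" "s *\<^sub>R e"] by simp
    then show False using a that by auto
  qed
  let ?m = "\<lambda>s. integral (cbox (-a) a) (\<lambda>y. \<psi> (y + s *\<^sub>R e))"
  have const: "?m s = (LINT y|lebesgue. \<psi> y)" if "s \<in> {-1<..<1}" for s
  proof -
    have "(LINT y|lebesgue. \<psi> (y + s *\<^sub>R e)) = ?m s"
    proof (rule lebesgue_integral_eq_integral_support)
      show "\<psi> (y + s *\<^sub>R e) = 0" if "y \<notin> cbox (-a) a" for y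
        using far[OF that, of s] \<open>s \<in> {-1<..<1}\<close> K(2) by auto
      then show "integrable lebesgue (\<lambda>y. \<psi> (y + s *\<^sub>R e))"
        by (intro integrable_continuous_bounded_support[of _ "cbox (-a) a"]
            continuous_on_compose2[OF \<psi>] continuous_intros) auto
    qed
    then show ?thesis using integral_lebesgue_shift[OF \<psi>] by simp
  qed
  have "(?m has_field_derivative integral (cbox (-a) a) (\<lambda>y. g (y + 0 *\<^sub>R e) $ j)) (at 0 within {-1<..<1})"
  proof (rule leibniz_rule_field_derivative)
    fix s y
    have "((\<lambda>s. y + s *\<^sub>R e) has_derivative (\<lambda>h. h *\<^sub>R e)) (at s)"
      by (auto intro!: derivative_eq_intros)
    from has_derivative_compose[OF this der]
    have "((\<lambda>s. \<psi> (y + s *\<^sub>R e)) has_derivative (\<lambda>h. g (y + s *\<^sub>R e) \<bullet> (h *\<^sub>R e))) (at s)" .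
    then have "((\<lambda>s. \<psi> (y + s *\<^sub>R e)) has_field_derivative g (y + s *\<^sub>R e) $ j) (at s)"
      unfolding has_field_derivative_def
      by (rule has_derivative_eq_rhs) (simp add: fun_eq_iff e_def inner_axis)
    then show "((\<lambda>s. \<psi> (y + s *\<^sub>R e)) has_field_derivative g (y + s *\<^sub>R e) $ j) (at s within {-1<..<1})"
      by (rule has_field_derivative_at_within)
  next
    show "(\<lambda>y. \<psi> (y + s *\<^sub>R e)) integrable_on cbox (-a) a" for s
      by (intro integrable_continuous continuous_on_compose2[OF \<psi>] continuous_intros) auto
    show "continuous_on ({-1<..<1} \<times> cbox (-a) a) (\<lambda>(s, y). g (y + s *\<^sub>R e) $ j)"
      unfolding case_prod_unfold
      by (intro continuous_on_component continuous_on_compose2[OF g] continuous_intros) auto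
  qed auto
  then have D: "(?m has_field_derivative integral (cbox (-a) a) (\<lambda>y. g y $ j)) (at 0)"
    by (simp add: at_within_open[of 0 "{-1<..<1::real}"])
  have "((\<lambda>_. LINT y|lebesgue. \<psi> y) has_field_derivative 0) (at (0::real))" by simp
  then have "(?m has_field_derivative 0) (at 0)"
    by (rule has_field_derivative_transform_within_open[of _ _ _ "{-1<..<1}"]) (use const in auto)
  with D have "integral (cbox (-a) a) (\<lambda>y. g y $ j) = 0" by (rule DERIV_unique)
  moreover have "(LINT y|lebesgue. g y $ j) = integral (cbox (-a) a) (\<lambda>y. g y $ j)"
  proof (rule lebesgue_integral_eq_integral_support)
    show z: "g y $ j = 0" if "y \<notin> cbox (-a) a" for y
      using far[OF that, of 0] g0[of y] by simp
    show "integrable lebesgue (\<lambda>y. g y $ j)"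
      by (rule integrable_continuous_bounded_support[of _ "cbox (-a) a"])
         (use z g in \<open>auto intro!: continuous_intros\<close>)
  qed
  ultimately show ?thesis by simp
qed

text \<open>Integration by parts for linear functions reduces to the previous lemma, applied to the test
  functions \<open>y $ k * \<psi> y\<close>.\<close>

lemma weak_gradient_linear:
  fixes \<xi> :: "'b::euclidean_space^'n"
  assumes B: "open B"
  shows "weak_gradient B (\<lambda>y. \<Sum>k\<in>UNIV. y $ k *\<^sub>R \<xi> $ k) (\<lambda>_. \<xi>)"
  unfolding weak_gradient_def
proof (intro allI impI)
  fix \<psi> g j assume test: "test_function B \<psi> g"
  obtain K where K: "compact K" "K \<subseteq> B" "\<And>y. y \<notin> K \<Longrightarrow> \<psi> y = 0"
    using test unfolding test_function_def by blast
  have der: "(\<psi> has_derivative (\<lambda>h. g y \<bullet> h)) (at y)" for y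
    using test unfolding test_function_def by blast
  have g: "continuous_on UNIV g" using test unfolding test_function_def by blast
  have \<psi>: "continuous_on UNIV \<psi>" using continuous_on_test_function[OF test] .
  have g0: "g y = 0" if "y \<notin> K" for y
    using test_function_gradient_eq_0[OF K(1,3) der that] by blast
  have Bs: "B \<inter> space lebesgue \<in> sets lebesgue" using B by simp
  have int: "integrable lebesgue k" if "continuous_on UNIV k" "\<And>y. y \<notin> K \<Longrightarrow> k y = 0"
    for k :: "real^'n \<Rightarrow> real"
    using integrable_continuous_bounded_support[OF that(1) compact_imp_bounded[OF K(1)] that(2)] .
  have part: "(LINT y|lebesgue. y $ k * g y $ j) = - (if j = k then LINT y|lebesgue. \<psi> y else 0)" for k
  proof -
    have "test_function B (\<lambda>y. y $ k * \<psi> y) (\<lambda>y. y $ k *\<^sub>R g y + \<psi> y *\<^sub>R axis k 1)"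
      unfolding test_function_def
    proof (intro conjI allI)
      show "\<exists>K. compact K \<and> K \<subseteq> B \<and> (\<forall>y. y \<notin> K \<longrightarrow> y $ k * \<psi> y = 0)"
        using K by auto
      show "((\<lambda>y. y $ k * \<psi> y) has_derivative (\<lambda>h. (y $ k *\<^sub>R g y + \<psi> y *\<^sub>R axis k 1) \<bullet> h)) (at y)" for y
        by (rule has_derivative_eq_rhs[OF has_derivative_mult[OF
              bounded_linear_imp_has_derivative[OF bounded_linear_vec_nth] der]])
           (simp add: fun_eq_iff inner_add_left inner_axis' mult.commute)
      show "continuous_on UNIV (\<lambda>y. y $ k *\<^sub>R g y + \<psi> y *\<^sub>R axis k 1)"
        by (intro continuous_intros g \<psi>)
    qed
    from integral_test_function_gradient[OF this, of j]
    have "(LINT y|lebesgue. y $ k * g y $ j + (if j = k then \<psi> y else 0)) = 0"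
      by (simp add: axis_def if_distrib cong: if_cong)
    moreover have "(LINT y|lebesgue. y $ k * g y $ j + (if j = k then \<psi> y else 0)) =
        (LINT y|lebesgue. y $ k * g y $ j) + (LINT y|lebesgue. (if j = k then \<psi> y else 0))"
    proof (rule Bochner_Integration.integral_add)
      show "integrable lebesgue (\<lambda>y. y $ k * g y $ j)"
        by (intro int continuous_intros g) (simp add: g0)
      show "integrable lebesgue (\<lambda>y. if j = k then \<psi> y else 0)"
        using int[OF \<psi> K(3)] by (cases "j = k") simp_all
    qed
    ultimately show ?thesis by (cases "j = k") simp_all
  qed
  have "(LINT y|lebesgue_on B. g y $ j *\<^sub>R (\<Sum>k\<in>UNIV. y $ k *\<^sub>R \<xi> $ k))
      = (LINT y|lebesgue. indicator B y *\<^sub>R (g y $ j *\<^sub>R (\<Sum>k\<in>UNIV. y $ k *\<^sub>R \<xi> $ k)))"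
    by (rule integral_restrict_space[OF Bs])
  also have "\<dots> = (LINT y|lebesgue. (\<Sum>k\<in>UNIV. (y $ k * g y $ j) *\<^sub>R \<xi> $ k))"
  proof (intro Bochner_Integration.integral_cong refl)
    have "g y = 0" if "y \<notin> B" for y using g0 K(2) that by blast
    then show "indicator B y *\<^sub>R (g y $ j *\<^sub>R (\<Sum>k\<in>UNIV. y $ k *\<^sub>R \<xi> $ k)) =
        (\<Sum>k\<in>UNIV. (y $ k * g y $ j) *\<^sub>R \<xi> $ k)" for y
      by (cases "y \<in> B") (simp_all add: scaleR_sum_right mult.commute)
  qed
  also have "\<dots> = (\<Sum>k\<in>UNIV. (LINT y|lebesgue. y $ k * g y $ j) *\<^sub>R \<xi> $ k)"
  proof -
    have i: "integrable lebesgue (\<lambda>y. y $ k * g y $ j)" for k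
      by (intro int continuous_intros g) (simp add: g0)
    show ?thesis
      by (subst Bochner_Integration.integral_sum)
         (rule integrable_scaleR_left, rule i, intro sum.cong refl integral_scaleR_left i)
  qed
  also have "\<dots> = (\<Sum>k\<in>UNIV. if j = k then - (LINT y|lebesgue. \<psi> y) *\<^sub>R \<xi> $ k else 0)"
    by (intro sum.cong refl) (simp add: part)
  also have "\<dots> = - ((LINT y|lebesgue. \<psi> y) *\<^sub>R \<xi> $ j)" by simp
  also have "(LINT y|lebesgue. \<psi> y) *\<^sub>R \<xi> $ j = (LINT y|lebesgue. \<psi> y *\<^sub>R \<xi> $ j)"
    using int[OF \<psi> K(3)] by (intro integral_scaleR_left[symmetric]) simp
  also have "\<dots> = (LINT y|lebesgue. indicator B y *\<^sub>R (\<psi> y *\<^sub>R \<xi> $ j))"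
    using K(2,3) by (intro Bochner_Integration.integral_cong refl) (auto simp: indicator_def)
  also have "\<dots> = (LINT y|lebesgue_on B. \<psi> y *\<^sub>R \<xi> $ j)"
    by (rule integral_restrict_space[OF Bs, symmetric])
  finally show "(LINT y|lebesgue_on B. g y $ j *\<^sub>R (\<Sum>k\<in>UNIV. y $ k *\<^sub>R \<xi> $ k)) =
      - (LINT y|lebesgue_on B. \<psi> y *\<^sub>R \<xi> $ j)" .
qed

lemma ess_bounded_compose:
  fixes f :: "real^'n \<Rightarrow> 'b::euclidean_space" and h :: "'b \<Rightarrow> 'c::euclidean_space"
  assumes f: "ess_bounded B f" and h: "continuous_on UNIV h"
  shows "ess_bounded B (\<lambda>y. h (f y))"
proof -
  obtain C where meas: "f \<in> borel_measurable (lebesgue_on B)" and C: "AE y in lebesgue_on B. norm (f y) \<le> C"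
    using f unfolding ess_bounded_def by blast
  have "bounded (h ` cball 0 C)"
    by (intro compact_imp_bounded compact_continuous_image continuous_on_subset[OF h]) auto
  then obtain D where D: "\<forall>v\<in>h ` cball 0 C. norm v \<le> D" unfolding bounded_iff by blast
  have "AE y in lebesgue_on B. norm (h (f y)) \<le> D"
    using C by eventually_elim (use D in auto)
  moreover have "(\<lambda>y. h (f y)) \<in> borel_measurable (lebesgue_on B)"
    using meas borel_measurable_continuous_onI[OF h] by (rule measurable_compose)
  ultimately show ?thesis unfolding ess_bounded_def by blast
qed

lemma ess_bounded_compose_linear:
  fixes f :: "real^'n \<Rightarrow> 'b::euclidean_space" and T :: "'b \<Rightarrow> 'c::euclidean_space"
  assumes "ess_bounded B f" and "bounded_linear T"
  shows "ess_bounded B (\<lambda>y. T (f y))"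
  using assms(1) linear_continuous_on[OF assms(2)] by (rule ess_bounded_compose)

lemma ess_bounded_diff:
  fixes f h :: "real^'n \<Rightarrow> 'b::euclidean_space"
  assumes "ess_bounded B f" and "ess_bounded B h"
  shows "ess_bounded B (\<lambda>y. f y - h y)"
proof -
  obtain C D where C: "AE y in lebesgue_on B. norm (f y) \<le> C" and D: "AE y in lebesgue_on B. norm (h y) \<le> D"
    and m: "f \<in> borel_measurable (lebesgue_on B)" "h \<in> borel_measurable (lebesgue_on B)"
    using assms unfolding ess_bounded_def by blast
  have "AE y in lebesgue_on B. norm (f y - h y) \<le> C + D"
    using C D by eventually_elim (rule order_trans[OF norm_triangle_ineq4 add_mono])
  moreover have "(\<lambda>y. f y - h y) \<in> borel_measurable (lebesgue_on B)"
    using m by (rule borel_measurable_diff)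
  ultimately show ?thesis unfolding ess_bounded_def by blast
qed

lemma ess_bounded_continuous:
  fixes f :: "real^'n \<Rightarrow> 'b::euclidean_space"
  assumes "open B" "bounded B" "continuous_on (closure B) f"
  shows "ess_bounded B f"
proof -
  have "bounded (f ` closure B)"
    using assms by (intro compact_imp_bounded compact_continuous_image) auto
  then obtain C where "\<forall>v\<in>f ` closure B. norm v \<le> C" unfolding bounded_iff by blast
  then have "norm (f y) \<le> C" if "y \<in> B" for y using that closure_subset by blast
  then have "AE y in lebesgue_on B. norm (f y) \<le> C"
    using assms(1) by (intro AE_I2) simp
  moreover have "f \<in> borel_measurable (lebesgue_on B)"
    using assms(1) by (intro continuous_imp_measurable_on_sets_lebesgue
        continuous_on_subset[OF assms(3) closure_subset]) auto
  ultimately show ?thesis unfolding ess_bounded_def by blast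
qed

lemma integrable_ess_bounded:
  fixes f :: "real^'n \<Rightarrow> 'b::euclidean_space"
  assumes f: "ess_bounded B f" and B: "open B" "bounded B" and \<psi>: "continuous_on UNIV \<psi>"
  shows "integrable (lebesgue_on B) (\<lambda>y. \<psi> y *\<^sub>R f y)"
proof -
  obtain C where meas: "f \<in> borel_measurable (lebesgue_on B)" and C: "AE y in lebesgue_on B. norm (f y) \<le> C"
    using f unfolding ess_bounded_def by blast
  have "bounded (\<psi> ` closure B)"
    using B by (intro compact_imp_bounded compact_continuous_image continuous_on_subset[OF \<psi>]) auto
  then obtain M where "\<forall>v\<in>\<psi> ` closure B. norm v \<le> M" unfolding bounded_iff by blast
  then have M: "\<bar>\<psi> y\<bar> \<le> M" if "y \<in> B" for y
    using that closure_subset by force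
  have "B \<in> lmeasurable" using B by (intro lmeasurable_open)
  then interpret finite_measure "lebesgue_on B" by (rule finite_measure_lebesgue_on)
  show ?thesis
  proof (rule integrable_const_bound)
    show "AE y in lebesgue_on B. norm (\<psi> y *\<^sub>R f y) \<le> M * C"
      using C AE_space
    proof eventually_elim
      case (elim y)
      then have "y \<in> B" using B by simp
      then show ?case using elim M[of y] by (auto intro!: mult_mono)
    qed
    show "(\<lambda>y. \<psi> y *\<^sub>R f y) \<in> borel_measurable (lebesgue_on B)"
      using meas measurable_restrict_space1[OF borel_measurable_lebesgue_continuous[OF \<psi>], of B]
      by measurable
  qed
qed

lemma weak_gradient_compose_linear:
  fixes \<phi> :: "real^'n \<Rightarrow> 'b::euclidean_space" and T :: "'b \<Rightarrow> 'c::euclidean_space"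
  assumes weak: "weak_gradient B \<phi> G" and B: "open B" "bounded B"
    and ess: "ess_bounded B \<phi>" "ess_bounded B G" and T: "bounded_linear T"
  shows "weak_gradient B (\<lambda>y. T (\<phi> y)) (\<lambda>y. \<chi> j. T (G y $ j))"
  unfolding weak_gradient_def
proof (intro allI impI)
  fix \<psi> g j assume test: "test_function B \<psi> g"
  have g: "continuous_on UNIV (\<lambda>y. g y $ j)"
    using test unfolding test_function_def by (intro continuous_on_component) blast
  note \<psi> = continuous_on_test_function[OF test]
  have eG: "ess_bounded B (\<lambda>y. G y $ j)"
    using ess_bounded_compose_linear[OF ess(2) bounded_linear_vec_nth] .
  have "(LINT y|lebesgue_on B. g y $ j *\<^sub>R T (\<phi> y)) = (LINT y|lebesgue_on B. T (g y $ j *\<^sub>R \<phi> y))"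
    by (simp add: linear_cmul[OF bounded_linear.linear[OF T]])
  also have "\<dots> = T (LINT y|lebesgue_on B. g y $ j *\<^sub>R \<phi> y)"
    by (rule integral_bounded_linear[OF T integrable_ess_bounded[OF ess(1) B g]])
  also have "(LINT y|lebesgue_on B. g y $ j *\<^sub>R \<phi> y) = - (LINT y|lebesgue_on B. \<psi> y *\<^sub>R G y $ j)"
    using weak test unfolding weak_gradient_def by blast
  also have "T (- (LINT y|lebesgue_on B. \<psi> y *\<^sub>R G y $ j)) = - T (LINT y|lebesgue_on B. \<psi> y *\<^sub>R G y $ j)"
    by (rule linear_neg[OF bounded_linear.linear[OF T]])
  also have "T (LINT y|lebesgue_on B. \<psi> y *\<^sub>R G y $ j) = (LINT y|lebesgue_on B. T (\<psi> y *\<^sub>R G y $ j))"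
    by (rule integral_bounded_linear[OF T integrable_ess_bounded[OF eG B \<psi>], symmetric])
  also have "\<dots> = (LINT y|lebesgue_on B. \<psi> y *\<^sub>R (\<chi> j. T (G y $ j)) $ j)"
    by (simp add: linear_cmul[OF bounded_linear.linear[OF T]])
  finally show "(LINT y|lebesgue_on B. g y $ j *\<^sub>R T (\<phi> y)) =
      - (LINT y|lebesgue_on B. \<psi> y *\<^sub>R (\<chi> j. T (G y $ j)) $ j)" .
qed

lemma weak_gradient_diff:
  fixes \<phi> \<theta> :: "real^'n \<Rightarrow> 'b::euclidean_space"
  assumes "weak_gradient B \<phi> G" "weak_gradient B \<theta> H" and B: "open B" "bounded B"
    and ess: "ess_bounded B \<phi>" "ess_bounded B G" "ess_bounded B \<theta>" "ess_bounded B H"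
  shows "weak_gradient B (\<lambda>y. \<phi> y - \<theta> y) (\<lambda>y. G y - H y)"
  unfolding weak_gradient_def
proof (intro allI impI)
  fix \<psi> g j assume test: "test_function B \<psi> g"
  have g: "continuous_on UNIV (\<lambda>y. g y $ j)"
    using test unfolding test_function_def by (intro continuous_on_component) blast
  note \<psi> = continuous_on_test_function[OF test]
  have comp: "ess_bounded B (\<lambda>y. F y $ j)" if "ess_bounded B F" for F :: "real^'n \<Rightarrow> 'b^'n"
    using ess_bounded_compose_linear[OF that bounded_linear_vec_nth] .
  have "(LINT y|lebesgue_on B. g y $ j *\<^sub>R (\<phi> y - \<theta> y)) =
      (LINT y|lebesgue_on B. g y $ j *\<^sub>R \<phi> y) - (LINT y|lebesgue_on B. g y $ j *\<^sub>R \<theta> y)"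
    unfolding scaleR_diff_right
    by (intro Bochner_Integration.integral_diff integrable_ess_bounded ess B g)
  also have "\<dots> = - (LINT y|lebesgue_on B. \<psi> y *\<^sub>R G y $ j) + (LINT y|lebesgue_on B. \<psi> y *\<^sub>R H y $ j)"
    using assms(1,2) test unfolding weak_gradient_def by force
  also have "\<dots> = - ((LINT y|lebesgue_on B. \<psi> y *\<^sub>R G y $ j) - (LINT y|lebesgue_on B. \<psi> y *\<^sub>R H y $ j))"
    by simp
  also have "(LINT y|lebesgue_on B. \<psi> y *\<^sub>R G y $ j) - (LINT y|lebesgue_on B. \<psi> y *\<^sub>R H y $ j) =
      (LINT y|lebesgue_on B. \<psi> y *\<^sub>R (G y - H y) $ j)"
    unfolding vector_minus_component scaleR_diff_right
    by (intro Bochner_Integration.integral_diff[symmetric] integrable_ess_bounded comp ess B \<psi>)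
  finally show "(LINT y|lebesgue_on B. g y $ j *\<^sub>R (\<phi> y - \<theta> y)) =
      - (LINT y|lebesgue_on B. \<psi> y *\<^sub>R (G y - H y) $ j)" .
qed

text \<open>For \<open>n\<close> orthogonal to \<open>V\<close> the scalar function \<open>\<phi> \<bullet> n\<close> vanishes, hence so does its weak gradient.
  Finitely many such \<open>n\<close> cut out \<open>V\<close>.\<close>

lemma AE_weak_gradient_in_subspace:
  fixes \<phi> :: "real^'n \<Rightarrow> real^'m" and V :: "(real^'m) set"
  assumes sob: "sobolev_W1inf B V \<phi> G" and V: "subspace V" and B: "open B" "bounded B"
  shows "AE y in lebesgue_on B. \<forall>j. G y $ j \<in> V"
proof -
  have ess: "ess_bounded B \<phi>" "ess_bounded B G" and weak: "weak_gradient B \<phi> G"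
    and inV: "AE y in lebesgue_on B. \<phi> y \<in> V"
    using sob unfolding sobolev_W1inf_def by auto
  obtain N where N: "N \<subseteq> V\<^sup>\<bottom>" "finite N" "V\<^sup>\<bottom> \<subseteq> span N"
    using basis_subspace_exists[OF subspace_orthogonal_comp[of V]] by (metis independent_imp_finite equalityD2)
  have V_iff: "w \<in> V \<longleftrightarrow> (\<forall>n\<in>N. w \<bullet> n = 0)" for w
  proof
    assume "w \<in> V" then show "\<forall>n\<in>N. w \<bullet> n = 0"
      using N(1) by (auto simp: orthogonal_comp_def real_inner_class.orthogonal_def inner_commute)
  next
    assume *: "\<forall>n\<in>N. w \<bullet> n = 0"
    have "real_inner_class.orthogonal w x" if "x \<in> V\<^sup>\<bottom>" for x
      using N(3) that * by (intro orthogonal_to_span[of x N]) (auto simp: real_inner_class.orthogonal_def)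
    then have "w \<in> (V\<^sup>\<bottom>)\<^sup>\<bottom>" by (auto simp: orthogonal_comp_def orthogonal_commute)
    then show "w \<in> V" using orthogonal_comp_self[OF V] by simp
  qed
  have "AE y in lebesgue_on B. G y $ j \<bullet> n = 0" if n: "n \<in> N" for n j
  proof (rule fundamental_lemma_calculus_of_variations[OF B(1)])
    have bl: "bounded_linear (\<lambda>w. w \<bullet> n)" by (rule bounded_linear_inner_left)
    show "ess_bounded B (\<lambda>y. G y $ j \<bullet> n)"
      using ess_bounded_compose_linear[OF ess(2) bounded_linear_compose[OF bl bounded_linear_vec_nth]] .
    fix \<psi> g assume test: "test_function B \<psi> g"
    have "(LINT y|lebesgue_on B. g y $ j *\<^sub>R (\<phi> y \<bullet> n)) = - (LINT y|lebesgue_on B. \<psi> y *\<^sub>R (G y $ j \<bullet> n))"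
      using weak_gradient_compose_linear[OF weak B ess bl] test unfolding weak_gradient_def by fastforce
    moreover have "AE y in lebesgue_on B. g y $ j *\<^sub>R (\<phi> y \<bullet> n) = 0"
      using inV by eventually_elim (use n V_iff in auto)
    then have "(LINT y|lebesgue_on B. g y $ j *\<^sub>R (\<phi> y \<bullet> n)) = 0"
      by (rule integral_eq_zero_AE)
    ultimately show "(LINT y|lebesgue_on B. \<psi> y *\<^sub>R (G y $ j \<bullet> n)) = 0" by simp
  qed
  then have "AE y in lebesgue_on B. \<forall>j. \<forall>n\<in>N. G y $ j \<bullet> n = 0"
    using N(2) by (simp add: AE_all_countable AE_finite_all)
  then show ?thesis by eventually_elim (simp add: V_iff)
qed

text \<open>Differentiating under the integral puts the gradient on the kernel, which is a test function; the
  weak gradient moves it back to \<open>u\<close>.\<close>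

lemma mollify_has_derivative:
  fixes u :: "real^'n \<Rightarrow> 'b::euclidean_space" and G :: "real^'n \<Rightarrow> 'b^'n"
  assumes u: "continuous_on UNIV u" and supp: "bounded S" "\<And>y. y \<notin> S \<Longrightarrow> u y = 0"
    and weak: "weak_gradient UNIV u G"
    and \<epsilon>: "\<epsilon> > 0"
  shows "(mollify \<epsilon> u has_derivative (\<lambda>h. \<Sum>j\<in>UNIV. h $ j *\<^sub>R mollify \<epsilon> (\<lambda>y. G y $ j) x)) (at x)"
proof -
  obtain a where a: "S \<subseteq> cbox (-a) a"
    using bounded_subset_cbox_symmetric[OF supp(1)] by blast
  then have out: "u y = 0" if "y \<notin> cbox (-a) a" for y using that supp(2) by blast
  define f' where "f' z t = blinfun_scaleR_left (u t) o\<^sub>L blinfun_inner_right (- bump_gradient \<epsilon> (t - z))" for z t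
  have int: "integrable lebesgue (\<lambda>y. k y *\<^sub>R u y)" if "continuous_on UNIV k" for k :: "real^'n \<Rightarrow> real"
    by (rule integrable_continuous_bounded_support[OF _ supp(1)])
       (use that u supp(2) in \<open>auto intro!: continuous_intros\<close>)
  have eq: "(LINT y|lebesgue. bump \<epsilon> (y - z) *\<^sub>R u y) = integral (cbox (-a) a) (\<lambda>y. bump \<epsilon> (y - z) *\<^sub>R u y)" for z
    by (intro lebesgue_integral_eq_integral_support int continuous_intros) (simp add: out)
  have cont: "continuous_on (UNIV \<times> cbox (-a) a) (\<lambda>(z, t). f' z t)"
    unfolding f'_def case_prod_unfold
    by (intro bounded_bilinear.continuous_on[OF bounded_bilinear_blinfun_compose]
        bounded_linear.continuous_on[OF bounded_linear_blinfun_scaleR_left]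
        bounded_linear.continuous_on[OF bounded_linear_blinfun_inner_right]
        continuous_on_compose2[OF u] continuous_intros) auto
  have D: "((\<lambda>z. integral (cbox (-a) a) (\<lambda>t. bump \<epsilon> (t - z) *\<^sub>R u t)) has_derivative
      blinfun_apply (integral (cbox (-a) a) (f' x))) (at x within UNIV)"
  proof (rule leibniz_rule)
    show "((\<lambda>z. bump \<epsilon> (t - z) *\<^sub>R u t) has_derivative blinfun_apply (f' z t)) (at z within UNIV)" for z t
    proof -
      have "((\<lambda>z. t - z) has_derivative (\<lambda>h. - h)) (at z)"
        by (auto intro!: derivative_eq_intros)
      from has_derivative_scaleR_left[OF has_derivative_compose[OF this bump_has_derivative], of \<epsilon> "u t"]
      show ?thesis by (rule has_derivative_eq_rhs) (simp add: f'_def fun_eq_iff)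
    qed
    show "(\<lambda>t. bump \<epsilon> (t - z) *\<^sub>R u t) integrable_on cbox (-a) a" for z
      by (intro integrable_continuous continuous_intros continuous_on_subset[OF u]) auto
  qed (use cont in auto)
  have app: "blinfun_apply (integral (cbox (-a) a) (f' x)) h =
      (\<Sum>j\<in>UNIV. h $ j *\<^sub>R (LINT y|lebesgue. bump \<epsilon> (y - x) *\<^sub>R G y $ j))" for h
  proof -
    have fx: "continuous_on (cbox (-a) a) (f' x)"
      using continuous_on_compose2[OF cont, of "cbox (-a) a" "Pair x"] continuous_on_Pair[OF continuous_on_const continuous_on_id]
      by (auto simp: image_subset_iff)
    have i: "integrable lebesgue (\<lambda>y. (bump_gradient \<epsilon> (y - x) $ j) *\<^sub>R u y)" for j
      by (intro int continuous_intros)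
    have "blinfun_apply (integral (cbox (-a) a) (f' x)) h = integral (cbox (-a) a) (\<lambda>t. f' x t h)"
      by (rule blinfun_apply_integral) (rule integrable_continuous[OF fx])
    also have "\<dots> = (LINT t|lebesgue. (- (bump_gradient \<epsilon> (t - x) \<bullet> h)) *\<^sub>R u t)"
    proof -
      have "(LINT t|lebesgue. (- (bump_gradient \<epsilon> (t - x) \<bullet> h)) *\<^sub>R u t) =
          integral (cbox (-a) a) (\<lambda>t. (- (bump_gradient \<epsilon> (t - x) \<bullet> h)) *\<^sub>R u t)"
        by (intro lebesgue_integral_eq_integral_support int continuous_intros) (simp add: out)
      then show ?thesis by (simp add: f'_def)
    qed
    also have "\<dots> = (LINT t|lebesgue. (\<Sum>j\<in>UNIV. (- h $ j) *\<^sub>R ((bump_gradient \<epsilon> (t - x) $ j) *\<^sub>R u t)))"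
      by (intro Bochner_Integration.integral_cong refl)
         (simp add: inner_vec_def scaleR_sum_left sum_negf mult.commute)
    also have "\<dots> = (\<Sum>j\<in>UNIV. (- h $ j) *\<^sub>R (LINT t|lebesgue. (bump_gradient \<epsilon> (t - x) $ j) *\<^sub>R u t))"
      by (subst Bochner_Integration.integral_sum)
         (rule integrable_scaleR_right, rule i, simp only: Bochner_Integration.integral_scaleR_right)
    also have "\<dots> = (\<Sum>j\<in>UNIV. h $ j *\<^sub>R (LINT y|lebesgue. bump \<epsilon> (y - x) *\<^sub>R G y $ j))"
      using weak test_function_bump[OF \<epsilon>, of x UNIV]
      by (intro sum.cong refl) (simp add: weak_gradient_def lebesgue_on_UNIV_eq)
    finally show ?thesis .
  qed
  have "((\<lambda>z. LINT y|lebesgue. bump \<epsilon> (y - z) *\<^sub>R u y) has_derivative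
      (\<lambda>h. \<Sum>j\<in>UNIV. h $ j *\<^sub>R (LINT y|lebesgue. bump \<epsilon> (y - x) *\<^sub>R G y $ j))) (at x)"
    unfolding eq by (rule has_derivative_eq_rhs[OF D[simplified]]) (rule ext, rule app)
  from has_derivative_scaleR_right[OF this, of "inverse (bump_mass TYPE('n) \<epsilon>)"] show ?thesis
    unfolding mollify_def
    by (rule has_derivative_eq_rhs) (simp add: fun_eq_iff scaleR_sum_right mult.commute)
qed

section \<open>Extension by zero across the sphere\<close>

text \<open>A spline of two parabolas rising from \<open>0\<close> at \<open>0\<close> to \<open>1\<close> at \<open>1\<close>.\<close>

definition smooth_step :: "real \<Rightarrow> real" where
  "smooth_step t = 2 * (pos_square t - 2 * pos_square (t - 1/2) + pos_square (t - 1))"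

definition smooth_step_deriv :: "real \<Rightarrow> real" where
  "smooth_step_deriv t = 4 * (max 0 t - 2 * max 0 (t - 1/2) + max 0 (t - 1))"

lemma has_derivative_smooth_step:
  assumes "(f has_derivative f') (at x)"
  shows "((\<lambda>y. smooth_step (f y)) has_derivative (\<lambda>h. smooth_step_deriv (f x) * f' h)) (at x)"
proof -
  have D: "((\<lambda>y. pos_square (f y - c)) has_derivative (\<lambda>h. 2 * max 0 (f x - c) * f' h)) (at x)" for c
    using has_derivative_pos_square[OF has_derivative_diff[OF assms has_derivative_const[of c]]] by simp
  show ?thesis
    unfolding smooth_step_def
    by (rule has_derivative_eq_rhs[OF has_derivative_mult_right[OF has_derivative_add[OF has_derivative_diff[OF
           D[of 0, unfolded diff_0_right] has_derivative_mult_right[OF D]] D]]])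
       (simp add: fun_eq_iff smooth_step_deriv_def algebra_simps)
qed

lemma smooth_step_eq_0: "t \<le> 0 \<Longrightarrow> smooth_step t = 0"
  by (simp add: smooth_step_def pos_square_def)

lemma smooth_step_eq_1: "1 \<le> t \<Longrightarrow> smooth_step t = 1"
  by (simp add: smooth_step_def pos_square_def power2_eq_square algebra_simps)

lemma smooth_step_bounds: "0 \<le> smooth_step t \<and> smooth_step t \<le> 1"
proof -
  consider "t \<le> 0" | "0 \<le> t" "t \<le> 1/2" | "1/2 \<le> t" "t \<le> 1" | "1 \<le> t" by linarith
  then show ?thesis
  proof cases
    case 2
    then have "smooth_step t = 2 * t\<^sup>2" by (simp add: smooth_step_def pos_square_def)
    moreover have "t\<^sup>2 \<le> (1/2)\<^sup>2" using 2 by (intro power_mono) auto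
    ultimately show ?thesis by (simp add: power2_eq_square)
  next
    case 3
    then have "smooth_step t = 1 - 2 * (1 - t)\<^sup>2"
      by (simp add: smooth_step_def pos_square_def power2_eq_square algebra_simps)
    moreover have "(1 - t)\<^sup>2 \<le> (1/2)\<^sup>2" using 3 by (intro power_mono) auto
    ultimately show ?thesis by (simp add: power2_eq_square)
  qed (simp_all add: smooth_step_eq_0 smooth_step_eq_1)
qed

lemma smooth_step_deriv_bounds: "\<bar>smooth_step_deriv t\<bar> \<le> 2"
  by (simp add: smooth_step_deriv_def max_def)

lemma smooth_step_deriv_eq_0: "1 \<le> t \<or> t \<le> 0 \<Longrightarrow> smooth_step_deriv t = 0"
  by (auto simp: smooth_step_deriv_def max_def)

lemma continuous_on_smooth_step_deriv:
  assumes "continuous_on S f"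
  shows "continuous_on S (\<lambda>y. smooth_step_deriv (f y))"
  unfolding smooth_step_deriv_def by (intro continuous_intros assms)

text \<open>For small \<open>t\<close>, a radial function equal to \<open>1\<close> for \<open>norm y \<le> 1 - 2 t\<close> and to \<open>0\<close> for \<open>norm y \<ge> 1 - t\<close>.\<close>

definition cutoff :: "real \<Rightarrow> real^'n \<Rightarrow> real" where
  "cutoff t y = smooth_step (((1 - t)\<^sup>2 - y \<bullet> y) / t)"

definition cutoff_gradient :: "real \<Rightarrow> real^'n \<Rightarrow> real^'n" where
  "cutoff_gradient t y = (- 2 / t * smooth_step_deriv (((1 - t)\<^sup>2 - y \<bullet> y) / t)) *\<^sub>R y"

lemma cutoff_has_derivative: "(cutoff t has_derivative (\<lambda>h. cutoff_gradient t y \<bullet> h)) (at y)"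
  for y :: "real^'n"
proof -
  have "((\<lambda>y. (1 - t)\<^sup>2 - y \<bullet> y) has_derivative (\<lambda>h. - (2 * (y \<bullet> h)))) (at y)"
    by (auto intro!: derivative_eq_intros simp: inner_commute)
  from has_derivative_mult_left[OF this, of "inverse t"]
  have "((\<lambda>y. ((1 - t)\<^sup>2 - y \<bullet> y) / t) has_derivative (\<lambda>h. - 2 / t * (y \<bullet> h))) (at y)"
    unfolding divide_inverse by (rule has_derivative_eq_rhs) (simp add: fun_eq_iff)
  from has_derivative_smooth_step[OF this] show ?thesis
    unfolding cutoff_def by (rule has_derivative_eq_rhs) (simp add: cutoff_gradient_def fun_eq_iff)
qed

lemma continuous_on_cutoff_gradient: "continuous_on UNIV (cutoff_gradient t)"
proof (cases "t = 0")
  case False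
  then show ?thesis
    unfolding cutoff_gradient_def by (intro continuous_intros continuous_on_smooth_step_deriv) auto
qed (simp add: cutoff_gradient_def)

lemma cutoff_eq_0:
  assumes "0 < t" "t < 1" "1 - t \<le> norm y"
  shows "cutoff t y = 0" "cutoff_gradient t y = 0"
proof -
  have "(1 - t)\<^sup>2 \<le> y \<bullet> y"
    using assms power_mono[of "1 - t" "norm y" 2] by (simp add: power2_norm_eq_inner)
  then have "((1 - t)\<^sup>2 - y \<bullet> y) / t \<le> 0" using assms by (simp add: divide_nonpos_pos)
  then show "cutoff t y = 0" "cutoff_gradient t y = 0"
    by (simp_all add: cutoff_def cutoff_gradient_def smooth_step_eq_0 smooth_step_deriv_eq_0)
qed

lemma cutoff_eq_1:
  assumes "0 < t" "t \<le> 1/3" "norm y \<le> 1 - 2 * t"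
  shows "cutoff t y = 1" "cutoff_gradient t y = 0"
proof -
  have "y \<bullet> y \<le> (1 - 2 * t)\<^sup>2"
    using assms power_mono[of "norm y" "1 - 2 * t" 2] by (simp add: power2_norm_eq_inner)
  moreover have "(1 - t)\<^sup>2 - (1 - 2 * t)\<^sup>2 = t * (2 - 3 * t)"
    by (simp add: power2_eq_square algebra_simps)
  moreover have "t * (2 - 3 * t) \<ge> t * 1"
    using assms by (intro mult_left_mono) auto
  ultimately have "t \<le> (1 - t)\<^sup>2 - y \<bullet> y" by linarith
  then have "((1 - t)\<^sup>2 - y \<bullet> y) / t \<ge> 1" using assms by (simp add: pos_le_divide_eq)
  then show "cutoff t y = 1" "cutoff_gradient t y = 0"
    by (simp_all add: cutoff_def cutoff_gradient_def smooth_step_eq_1 smooth_step_deriv_eq_0)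
qed

lemma abs_cutoff_le: "\<bar>cutoff t y\<bar> \<le> 1"
  using smooth_step_bounds unfolding cutoff_def by (simp add: abs_of_nonneg)

lemma norm_cutoff_gradient_le:
  assumes "0 < t" "t < 1"
  shows "norm (cutoff_gradient t y) \<le> 4 / t"
proof (cases "norm y \<le> 1")
  case True
  have "norm (cutoff_gradient t y) = (2 / t * \<bar>smooth_step_deriv (((1 - t)\<^sup>2 - y \<bullet> y) / t)\<bar>) * norm y"
    using assms by (simp add: cutoff_gradient_def abs_mult)
  also have "\<dots> \<le> (2 / t * 2) * 1"
    using assms True by (intro mult_mono smooth_step_deriv_bounds) auto
  finally show ?thesis by simp
next
  case False
  then show ?thesis using assms cutoff_eq_0[of t y] by simp
qed

text \<open>The volume of the transition zone of \<open>cutoff t\<close> is of order \<open>t\<close>, which compensates the bound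
  \<open>4 / t\<close> on its gradient.\<close>

lemma measure_annulus_le:
  assumes "0 < t" "2 * t \<le> 1"
  shows "measure lebesgue (cball 0 1 - ball 0 (1 - 2 * t) :: (real^'n) set)
    \<le> 2 * real (CARD('n)) * unit_ball_vol (CARD('n)) * t"
proof -
  have "measure lebesgue (cball 0 1 - ball 0 (1 - 2 * t) :: (real^'n) set)
      = measure lebesgue (cball (0 :: real^'n) 1) - measure lebesgue (ball (0 :: real^'n) (1 - 2 * t))"
    using assms by (intro measurable_measure_Diff) auto
  also have "\<dots> = unit_ball_vol (CARD('n)) * (1 - (1 - 2 * t) ^ CARD('n))"
    using assms by (simp add: content_cball content_ball algebra_simps)
  also have "\<dots> \<le> unit_ball_vol (CARD('n)) * (real (CARD('n)) * (2 * t))"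
    using Bernoulli_inequality[of "- (2 * t)" "CARD('n)"] assms by (intro mult_left_mono) auto
  finally show ?thesis by (simp add: mult_ac)
qed

text \<open>Test functions on the whole space become test functions on the ball after multiplication by
  \<open>cutoff t\<close>. The product rule produces one extra term, containing the gradient of the cutoff: that
  gradient is \<open>O(1/t)\<close> on a set of measure \<open>O(t)\<close> where \<open>u\<close> is uniformly small, because \<open>u\<close> is
  continuous up to the sphere and vanishes there. Hence the term disappears as \<open>t\<close> tends to \<open>0\<close>.\<close>

lemma weak_gradient_extension_by_zero:
  fixes u :: "real^'n \<Rightarrow> 'b::euclidean_space" and G :: "real^'n \<Rightarrow> 'b^'n"
  assumes u: "continuous_on (cball 0 1) u" and bdry: "\<And>y. y \<in> sphere 0 1 \<Longrightarrow> u y = 0"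
    and G: "G \<in> borel_measurable (lebesgue_on (ball 0 1))"
    and G0: "G\<^sub>0 \<in> borel_measurable lebesgue" and C: "\<And>y. norm (G\<^sub>0 y) \<le> C"
    and out: "\<And>y. y \<notin> ball 0 1 \<Longrightarrow> G\<^sub>0 y = 0" and ae: "AE y in lebesgue_on (ball 0 1). G\<^sub>0 y = G y"
    and weak: "weak_gradient (ball 0 1) u G"
  defines "u\<^sub>0 \<equiv> \<lambda>y. if y \<in> ball 0 1 then u y else 0"
  shows "continuous_on UNIV u\<^sub>0" and "weak_gradient UNIV u\<^sub>0 G\<^sub>0"
proof -
  let ?B = "ball 0 1 :: (real^'n) set"
  have "continuous_on (cball 0 1 \<union> - ?B) u\<^sub>0"
    unfolding u\<^sub>0_def using u bdry by (intro continuous_on_cases) auto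
  moreover have "cball 0 1 \<union> - ?B = UNIV" by auto
  ultimately show cont: "continuous_on UNIV u\<^sub>0" by simp
  have u0out: "u\<^sub>0 y = 0" if "y \<notin> ?B" for y using that by (simp add: u\<^sub>0_def)
  define t where "t n = 1 / real (n + 3)" for n
  have t: "0 < t n" "t n \<le> 1/3" "t n < 1" for n by (auto simp: t_def field_simps)
  have t0: "t \<longlonglongrightarrow> 0"
    unfolding t_def[abs_def] by (rule LIMSEQ_ignore_initial_segment[of "\<lambda>n. 1 / real n" 0 3, OF lim_1_over_n])
  show "weak_gradient UNIV u\<^sub>0 G\<^sub>0"
    unfolding weak_gradient_def lebesgue_on_UNIV_eq
  proof (intro allI impI)
    fix \<psi> g j assume test: "test_function (UNIV :: (real^'n) set) \<psi> g"
    have \<psi>: "continuous_on UNIV \<psi>" using continuous_on_test_function[OF test] .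
    have d\<psi>: "(\<psi> has_derivative (\<lambda>h. g y \<bullet> h)) (at y)" for y
      using test unfolding test_function_def by blast
    have g: "continuous_on UNIV g" using test unfolding test_function_def by blast
    have "bounded (\<psi> ` cball 0 1)"
      by (intro compact_imp_bounded compact_continuous_image continuous_on_subset[OF \<psi>]) auto
    then obtain M where "\<forall>v\<in>\<psi> ` cball 0 1. norm v \<le> M"
      unfolding bounded_iff by blast
    then have M: "\<bar>\<psi> y\<bar> \<le> M" if "norm y \<le> 1" for y
      using that by simp
    have M0: "0 \<le> M" using M[of 0] by simp
    have ccut: "continuous_on UNIV (cutoff (t n) :: real^'n \<Rightarrow> real)" for n
      by (intro continuous_at_imp_continuous_on ballI has_derivative_continuous[OF cutoff_has_derivative])
    note cgrad = continuous_on_cutoff_gradient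
    define I1 where "I1 n = (LINT y|lebesgue. (cutoff (t n) y * g y $ j) *\<^sub>R u\<^sub>0 y)" for n
    define I2 where "I2 n = (LINT y|lebesgue. (\<psi> y * cutoff_gradient (t n) y $ j) *\<^sub>R u\<^sub>0 y)" for n
    define I3 where "I3 n = (LINT y|lebesgue. (cutoff (t n) y * \<psi> y) *\<^sub>R (G\<^sub>0 y $ j))" for n
    have int: "integrable lebesgue (\<lambda>y. k y *\<^sub>R u\<^sub>0 y)" if "continuous_on UNIV k" for k :: "real^'n \<Rightarrow> real"
      by (rule integrable_continuous_bounded_support[of _ ?B])
         (use that cont u0out in \<open>auto intro!: continuous_intros\<close>)
    have eqn: "I1 n + I2 n = - I3 n" for n
    proof -
      have test': "test_function ?B (\<lambda>y. cutoff (t n) y * \<psi> y)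
          (\<lambda>y. cutoff (t n) y *\<^sub>R g y + \<psi> y *\<^sub>R cutoff_gradient (t n) y)"
        unfolding test_function_def
      proof (intro conjI allI)
        show "\<exists>K. compact K \<and> K \<subseteq> ?B \<and> (\<forall>y. y \<notin> K \<longrightarrow> cutoff (t n) y * \<psi> y = 0)"
          using t[of n] by (intro exI[of _ "cball 0 (1 - t n)"]) (auto simp: cutoff_eq_0)
        show "((\<lambda>y. cutoff (t n) y * \<psi> y) has_derivative
            (\<lambda>h. (cutoff (t n) y *\<^sub>R g y + \<psi> y *\<^sub>R cutoff_gradient (t n) y) \<bullet> h)) (at y)" for y
          by (rule has_derivative_eq_rhs[OF has_derivative_mult[OF cutoff_has_derivative d\<psi>]])
             (simp add: fun_eq_iff inner_add_left)
        show "continuous_on UNIV (\<lambda>y. cutoff (t n) y *\<^sub>R g y + \<psi> y *\<^sub>R cutoff_gradient (t n) y)"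
          by (intro continuous_intros ccut g \<psi> cgrad)
      qed
      have "(LINT y|lebesgue_on ?B. ((cutoff (t n) y *\<^sub>R g y + \<psi> y *\<^sub>R cutoff_gradient (t n) y) $ j) *\<^sub>R u y)
          = (LINT y|lebesgue. indicator ?B y *\<^sub>R (((cutoff (t n) y *\<^sub>R g y + \<psi> y *\<^sub>R cutoff_gradient (t n) y) $ j) *\<^sub>R u y))"
        by (intro integral_restrict_space) simp
      also have "\<dots> = (LINT y|lebesgue. (cutoff (t n) y * g y $ j) *\<^sub>R u\<^sub>0 y + (\<psi> y * cutoff_gradient (t n) y $ j) *\<^sub>R u\<^sub>0 y)"
        by (intro Bochner_Integration.integral_cong refl)
           (simp add: u\<^sub>0_def indicator_def scaleR_left_distrib)
      also have "\<dots> = I1 n + I2 n"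
        unfolding I1_def I2_def
        by (intro Bochner_Integration.integral_add int continuous_intros ccut g \<psi> cgrad)
      finally have "I1 n + I2 n =
          (LINT y|lebesgue_on ?B. ((cutoff (t n) y *\<^sub>R g y + \<psi> y *\<^sub>R cutoff_gradient (t n) y) $ j) *\<^sub>R u y)"
        by (rule sym)
      also have "\<dots> = - (LINT y|lebesgue_on ?B. (cutoff (t n) y * \<psi> y) *\<^sub>R (G y $ j))"
        using weak test' unfolding weak_gradient_def by blast
      also have "(LINT y|lebesgue_on ?B. (cutoff (t n) y * \<psi> y) *\<^sub>R (G y $ j)) = I3 n"
        unfolding I3_def
      proof (rule integral_representative)
        show "(\<lambda>y. G y $ j) \<in> borel_measurable (lebesgue_on ?B)"
          using measurable_compose[OF G borel_measurable_continuous_onI[OF continuous_on_component[OF continuous_on_id]]] by simp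
        show "(\<lambda>y. G\<^sub>0 y $ j) \<in> borel_measurable lebesgue"
          using measurable_compose[OF G0 borel_measurable_continuous_onI[OF continuous_on_component[OF continuous_on_id]]] by simp
        show "AE y in lebesgue_on ?B. G\<^sub>0 y $ j = G y $ j" using ae by eventually_elim simp
        show "continuous_on UNIV (\<lambda>y. cutoff (t n) y * \<psi> y)" by (intro continuous_intros ccut \<psi>)
      qed (simp_all add: out)
      finally show ?thesis .
    qed
    have cut1: "\<forall>\<^sub>F n in sequentially. cutoff (t n) y = 1" if y: "y \<in> ?B" for y
    proof -
      have "\<forall>\<^sub>F n in sequentially. t n < (1 - norm y) / 2"
        using y by (intro order_tendstoD[OF t0]) simp
      then show ?thesis
      proof (rule eventually_mono)
        fix n assume "t n < (1 - norm y) / 2"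
        then have "norm y < 1 - 2 * t n" by (simp add: field_simps)
        then show "cutoff (t n) y = 1" using t[of n] by (intro cutoff_eq_1) auto
      qed
    qed
    have meas: "(\<lambda>y. k y *\<^sub>R (G\<^sub>0 y $ j)) \<in> borel_measurable lebesgue" if "continuous_on UNIV k" for k :: "real^'n \<Rightarrow> real"
      using borel_measurable_lebesgue_continuous[OF that]
        measurable_compose[OF G0 borel_measurable_continuous_onI[OF continuous_on_component[OF continuous_on_id]], of j]
      by (intro borel_measurable_scaleR) simp_all
    have lim1: "I1 \<longlonglongrightarrow> (LINT y|lebesgue. (g y $ j) *\<^sub>R u\<^sub>0 y)"
      unfolding I1_def
    proof (rule integral_dominated_convergence)
      have i: "integrable lebesgue (\<lambda>y. (g y $ j) *\<^sub>R u\<^sub>0 y)"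
        by (intro int continuous_intros g)
      then show "(\<lambda>y. (g y $ j) *\<^sub>R u\<^sub>0 y) \<in> borel_measurable lebesgue" by simp
      show "integrable lebesgue (\<lambda>y. norm ((g y $ j) *\<^sub>R u\<^sub>0 y))"
        using i by (rule Bochner_Integration.integrable_norm)
      show "(\<lambda>y. (cutoff (t n) y * g y $ j) *\<^sub>R u\<^sub>0 y) \<in> borel_measurable lebesgue" for n
      proof -
        have "integrable lebesgue (\<lambda>y. (cutoff (t n) y * g y $ j) *\<^sub>R u\<^sub>0 y)"
          by (intro int continuous_intros ccut g)
        then show ?thesis by (rule borel_measurable_integrable)
      qed
      show "AE y in lebesgue. (\<lambda>n. (cutoff (t n) y * g y $ j) *\<^sub>R u\<^sub>0 y) \<longlonglongrightarrow> (g y $ j) *\<^sub>R u\<^sub>0 y"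
      proof (intro AE_I2)
        fix y
        show "(\<lambda>n. (cutoff (t n) y * g y $ j) *\<^sub>R u\<^sub>0 y) \<longlonglongrightarrow> (g y $ j) *\<^sub>R u\<^sub>0 y"
        proof (cases "y \<in> ?B")
          case True
          show ?thesis
            by (rule tendsto_eventually, rule eventually_mono[OF cut1[OF True]]) simp
        qed (simp add: u0out)
      qed
      show "AE y in lebesgue. norm ((cutoff (t n) y * g y $ j) *\<^sub>R u\<^sub>0 y) \<le> norm ((g y $ j) *\<^sub>R u\<^sub>0 y)" for n
        by (intro AE_I2) (auto simp: abs_mult abs_cutoff_le intro!: mult_right_mono mult_left_le_one_le)
    qed
    have lim3: "I3 \<longlonglongrightarrow> (LINT y|lebesgue. \<psi> y *\<^sub>R (G\<^sub>0 y $ j))"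
      unfolding I3_def
    proof (rule integral_dominated_convergence)
      have i: "integrable lebesgue (\<lambda>y. \<psi> y *\<^sub>R (G\<^sub>0 y $ j))"
      proof (rule integrable_lebesgue_bounded_support[OF meas[OF \<psi>], of _ ?B])
        show "norm (\<psi> y *\<^sub>R (G\<^sub>0 y $ j)) \<le> M * C" for y
        proof (cases "y \<in> ?B")
          case True
          have "norm (G\<^sub>0 y $ j) \<le> C" using Finite_Cartesian_Product.norm_nth_le[of "G\<^sub>0 y" j] C[of y] by linarith
          then show ?thesis using True M[of y] M0 by (auto intro!: mult_mono)
        next
          case False
          then show ?thesis using out M0 order_trans[OF norm_ge_zero C[of y]] by simp
        qed
      qed (auto simp: out)
      then show "(\<lambda>y. \<psi> y *\<^sub>R (G\<^sub>0 y $ j)) \<in> borel_measurable lebesgue" by simp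
      show "integrable lebesgue (\<lambda>y. norm (\<psi> y *\<^sub>R (G\<^sub>0 y $ j)))"
        using i by (rule Bochner_Integration.integrable_norm)
      show "(\<lambda>y. (cutoff (t n) y * \<psi> y) *\<^sub>R (G\<^sub>0 y $ j)) \<in> borel_measurable lebesgue" for n
        by (intro meas continuous_intros ccut \<psi>)
      show "AE y in lebesgue. (\<lambda>n. (cutoff (t n) y * \<psi> y) *\<^sub>R (G\<^sub>0 y $ j)) \<longlonglongrightarrow> \<psi> y *\<^sub>R (G\<^sub>0 y $ j)"
      proof (intro AE_I2)
        fix y
        show "(\<lambda>n. (cutoff (t n) y * \<psi> y) *\<^sub>R (G\<^sub>0 y $ j)) \<longlonglongrightarrow> \<psi> y *\<^sub>R (G\<^sub>0 y $ j)"
        proof (cases "y \<in> ?B")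
          case True
          show ?thesis
            by (rule tendsto_eventually, rule eventually_mono[OF cut1[OF True]]) simp
        qed (simp add: out)
      qed
      show "AE y in lebesgue. norm ((cutoff (t n) y * \<psi> y) *\<^sub>R (G\<^sub>0 y $ j)) \<le> norm (\<psi> y *\<^sub>R (G\<^sub>0 y $ j))" for n
        by (intro AE_I2) (auto simp: abs_mult abs_cutoff_le intro!: mult_right_mono mult_left_le_one_le)
    qed
    have lim2: "I2 \<longlonglongrightarrow> 0"
    proof (rule LIMSEQ_I)
      fix e :: real assume e: "0 < e"
      \<comment> \<open>The bounds on \<open>\<psi>\<close>, on the cutoff gradient and on the annulus multiply to \<open>c - 1\<close>;
        adding \<open>1\<close> makes \<open>c\<close> positive and the final inequality strict.\<close>
      define c where "c = 8 * M * real (CARD('n)) * unit_ball_vol (CARD('n)) + 1"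
      have c: "c > 0" using M0 by (simp add: c_def add_nonneg_pos)
      have "uniformly_continuous_on (cball 0 1) u"
        by (intro compact_uniformly_continuous u) auto
      then obtain d where d: "d > 0" "\<And>x y. \<lbrakk>x \<in> cball 0 1; y \<in> cball 0 1; dist y x < d\<rbrakk> \<Longrightarrow> dist (u y) (u x) < e / c"
        using e c unfolding uniformly_continuous_on_def by (metis divide_pos_pos)
      have small: "norm (u\<^sub>0 y) \<le> e / c" if y: "1 - d < norm y" for y
      proof (cases "y \<in> ?B \<and> y \<noteq> 0")
        case True
        \<comment> \<open>The radial projection of \<open>y\<close> to the sphere, where \<open>u\<close> vanishes.\<close>
        let ?x = "(1 / norm y) *\<^sub>R y"
        have "y - ?x = (1 - 1 / norm y) *\<^sub>R y" by (simp add: algebra_simps)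
        then have "dist y ?x = \<bar>1 - 1 / norm y\<bar> * norm y"
          by (simp only: dist_norm norm_scaleR)
        also have "\<bar>1 - 1 / norm y\<bar> = 1 / norm y - 1" using True by simp
        also have "(1 / norm y - 1) * norm y = 1 - norm y" using True by (simp add: algebra_simps)
        also have "\<dots> < d" using y by simp
        finally have "dist (u y) (u ?x) < e / c" using True by (intro d(2)) auto
        moreover have "u ?x = 0" using True by (intro bdry) auto
        ultimately show ?thesis using True by (simp add: u\<^sub>0_def)
      next
        case False
        show ?thesis
        proof (cases "y = 0")
          case True
          then have "d > 1" using y by simp
          obtain w :: "real^'n" where w: "norm w = 1" using vector_choose_size[of 1] by auto
          then have "dist (u 0) (u w) < e / c" using \<open>d > 1\<close> by (intro d(2)) auto
          moreover have "u w = 0" using w by (intro bdry) auto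
          ultimately show ?thesis using True by (simp add: u\<^sub>0_def)
        next
          case False
          then show ?thesis using \<open>\<not> (y \<in> ?B \<and> y \<noteq> 0)\<close> e c u0out by simp
        qed
      qed
      have "\<forall>\<^sub>F n in sequentially. t n < d / 2"
        using d(1) by (intro order_tendstoD[OF t0]) simp
      then obtain N where N: "\<And>n. n \<ge> N \<Longrightarrow> t n < d / 2"
        unfolding eventually_sequentially by blast
      have "norm (I2 n) < e" if n: "n \<ge> N" for n
      proof -
        let ?A = "cball 0 1 - ball 0 (1 - 2 * t n) :: (real^'n) set"
        have A: "?A \<in> lmeasurable" by (intro fmeasurable_Diff) auto
        have "norm (I2 n) \<le> (LINT y|lebesgue. indicator ?A y *\<^sub>R (M * (4 / t n) * (e / c)))"
          unfolding I2_def
        proof (rule Bochner_Integration.integral_norm_bound_integral)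
          show "integrable lebesgue (\<lambda>y. (\<psi> y * cutoff_gradient (t n) y $ j) *\<^sub>R u\<^sub>0 y)"
            by (intro int continuous_intros \<psi> cgrad)
          show "integrable lebesgue (\<lambda>y. indicator ?A y *\<^sub>R (M * (4 / t n) * (e / c)))"
            using A by (intro integrable_scaleR_left integrable_real_indicator) (auto simp: fmeasurable_def)
          fix y :: "real^'n"
          show "norm ((\<psi> y * cutoff_gradient (t n) y $ j) *\<^sub>R u\<^sub>0 y) \<le> indicator ?A y *\<^sub>R (M * (4 / t n) * (e / c))"
          proof (cases "y \<in> ?A")
            case True
            have "\<bar>cutoff_gradient (t n) y $ j\<bar> \<le> 4 / t n"
              using component_le_norm_cart[of "cutoff_gradient (t n) y" j] norm_cutoff_gradient_le[of "t n" y] t[of n] by linarith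
            moreover have "norm (u\<^sub>0 y) \<le> e / c"
              using True N[OF n] by (intro small) auto
            ultimately have "\<bar>\<psi> y\<bar> * \<bar>cutoff_gradient (t n) y $ j\<bar> * norm (u\<^sub>0 y) \<le> M * (4 / t n) * (e / c)"
              using True M[of y] M0 t[of n] by (intro mult_mono) auto
            then show ?thesis using True by (simp add: abs_mult)
          next
            case False
            then have "u\<^sub>0 y = 0 \<or> cutoff_gradient (t n) y = 0"
              using u0out[of y] cutoff_eq_1[of "t n" y] t[of n] by force
            then show ?thesis using False by auto
          qed
        qed
        also have "\<dots> = M * (4 / t n) * (e / c) * measure lebesgue ?A"
          using A by simp
        also have "\<dots> \<le> M * (4 / t n) * (e / c) * (2 * real (CARD('n)) * unit_ball_vol (CARD('n)) * t n)"
          using M0 e c t[of n] by (intro mult_left_mono measure_annulus_le) auto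
        also have "\<dots> = (8 * M * real (CARD('n)) * unit_ball_vol (CARD('n))) * (e / c)"
          using t(1)[of n] by simp
        also have "8 * M * real (CARD('n)) * unit_ball_vol (CARD('n)) = c - 1"
          by (simp add: c_def)
        also have "(c - 1) * (e / c) < e" using e c by (simp add: field_simps)
        finally show ?thesis .
      qed
      then show "\<exists>N. \<forall>n\<ge>N. norm (I2 n - 0) < e" by auto
    qed
    have "(\<lambda>n. I1 n + I2 n) \<longlonglongrightarrow> (LINT y|lebesgue. (g y $ j) *\<^sub>R u\<^sub>0 y) + 0"
      by (intro tendsto_add lim1 lim2)
    moreover have "(\<lambda>n. I1 n + I2 n) \<longlonglongrightarrow> - (LINT y|lebesgue. \<psi> y *\<^sub>R (G\<^sub>0 y $ j))"
      unfolding eqn by (intro tendsto_minus lim3)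
    ultimately have "(LINT y|lebesgue. (g y $ j) *\<^sub>R u\<^sub>0 y) + 0 = - (LINT y|lebesgue. \<psi> y *\<^sub>R (G\<^sub>0 y $ j))"
      by (rule LIMSEQ_unique)
    then show "(LINT y|lebesgue. (g y $ j) *\<^sub>R u\<^sub>0 y) = - (LINT y|lebesgue. \<psi> y *\<^sub>R (G\<^sub>0 y $ j))"
      by simp
  qed
qed

section \<open>The integral of a Jacobian determinant\<close>

lemma continuous_on_det:
  fixes A :: "'a::topological_space \<Rightarrow> real^'n^'n"
  assumes "continuous_on S A"
  shows "continuous_on S (\<lambda>x. det (A x))"
  unfolding Determinants.det_def by (intro continuous_intros assms)

text \<open>Written out in this form, \<open>det (A + s I)\<close> is a polynomial in \<open>s\<close> whose coefficients are products of
  entries of \<open>A\<close>, hence integrable when \<open>A\<close> depends on a point in a bounded measurable way.\<close>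

lemma det_add_scalar_expand:
  fixes A :: "real^'n^'n"
  shows "det (A + mat s) =
    (\<Sum>p | p permutes (UNIV::'n set). \<Sum>X\<in>Pow UNIV.
       (of_int (sign p) * (\<Prod>i\<in>X. A $ i $ p i) * (\<Prod>i\<in>UNIV - X. if i = p i then 1 else 0)) * s ^ card (UNIV - X))"
proof -
  have "(\<Prod>i\<in>UNIV. (A + mat s) $ i $ p i) =
     (\<Sum>X\<in>Pow UNIV. (\<Prod>i\<in>X. A $ i $ p i) * (\<Prod>i\<in>UNIV - X. if i = p i then 1 else 0) * s ^ card (UNIV - X))"
    for p :: "'n \<Rightarrow> 'n"
  proof -
    have "(\<Prod>i\<in>UNIV. (A + mat s) $ i $ p i) = (\<Prod>i\<in>UNIV. A $ i $ p i + (if i = p i then 1 else 0) * s)"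
      by (intro prod.cong) (auto simp: Finite_Cartesian_Product.mat_def)
    also have "\<dots> = (\<Sum>X\<in>Pow UNIV. (\<Prod>i\<in>X. A $ i $ p i) * (\<Prod>i\<in>UNIV - X. (if i = p i then 1 else 0) * s))"
      by (subst prod_add) auto
    finally show ?thesis by (simp add: prod.distrib mult.assoc)
  qed
  then show ?thesis
    unfolding Determinants.det_def by (simp add: sum_distrib_left mult.assoc)
qed

text \<open>The determinant is positive near the identity, and \<open>A + s I = s (A/s + I)\<close>.\<close>

lemma det_add_scalar_pos:
  obtains \<delta> where "\<delta> > 0" and
    "\<And>(A :: real^'n^'n) s. norm A < \<delta> * s \<Longrightarrow> det (A + mat s) > 0"
proof -
  have "isCont (det :: real^'n^'n \<Rightarrow> real) (mat 1)"
    using continuous_on_det[OF continuous_on_id, where S = "UNIV :: (real^'n^'n) set"] by (simp add: continuous_on_eq_continuous_at)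
  then obtain \<delta> where \<delta>: "\<delta> > 0" "\<And>M :: real^'n^'n. dist M (mat 1) < \<delta> \<Longrightarrow> dist (det M) 1 < 1"
    unfolding continuous_at_eps_delta by (auto dest: spec[of _ 1])
  show ?thesis
  proof (rule that[OF \<delta>(1)])
    fix A :: "real^'n^'n" and s assume A: "norm A < \<delta> * s"
    then have s: "s > 0" using \<delta>(1) by (smt (verit) norm_ge_zero zero_less_mult_pos)
    have "dist ((1/s) *\<^sub>R A + mat 1) (mat 1) < \<delta>"
      using A s by (simp add: dist_norm divide_less_eq)
    then have "det ((1/s) *\<^sub>R A + mat 1) > 0"
      using \<delta>(2) by (force simp: dist_real_def)
    moreover have "A + mat s = mat s ** ((1/s) *\<^sub>R A + mat 1)"
    proof -
      have "(mat s ** M) $ i $ j = s * M $ i $ j" for M :: "real^'n^'n" and i j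
      proof -
        have "(mat s ** M) $ i $ j = (\<Sum>k\<in>UNIV. (if i = k then s else 0) * M $ k $ j)"
          unfolding matrix_matrix_mult_def Finite_Cartesian_Product.mat_def by simp
        also have "\<dots> = (\<Sum>k\<in>UNIV. if i = k then s * M $ k $ j else 0)"
          by (intro sum.cong) auto
        finally show ?thesis by simp
      qed
      then show ?thesis
        using s by (simp add: Finite_Cartesian_Product.vec_eq_iff Finite_Cartesian_Product.mat_def algebra_simps)
    qed
    moreover have "det (mat s :: real^'n^'n) > 0"
      using s by (subst det_diagonal) (auto simp: Finite_Cartesian_Product.mat_def intro!: prod_pos)
    ultimately show "det (A + mat s) > 0"
      by (simp add: det_mul)
  qed
qed

text \<open>Surjectivity is the contraction principle: \<open>f x + s x = z\<close> is the fixed point equation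
  \<open>x = (z - f x) / s\<close>.\<close>

lemma bij_add_scaled_identity:
  fixes f :: "'a::{banach} \<Rightarrow> 'a"
  assumes lip: "\<And>x y. norm (f x - f y) \<le> K * norm (x - y)" and "0 \<le> K" "K < s"
  shows "bij (\<lambda>x. f x + s *\<^sub>R x)"
proof (rule bijI)
  show "inj (\<lambda>x. f x + s *\<^sub>R x)"
  proof (rule injI)
    fix x y assume "f x + s *\<^sub>R x = f y + s *\<^sub>R y"
    then have "s *\<^sub>R (x - y) = f y - f x" by (simp add: algebra_simps)
    then have "s * norm (x - y) = norm (f y - f x)"
      using assms(2,3) by (metis abs_of_nonneg le_less_trans less_imp_le norm_scaleR)
    then have "s * norm (x - y) \<le> K * norm (x - y)"
      using lip[of y x] by (simp add: norm_minus_commute)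
    then show "x = y" using assms(3) by (simp add: mult_le_cancel_right)
  qed
  show "surj (\<lambda>x. f x + s *\<^sub>R x)"
    unfolding surj_def
  proof
    fix z
    have "\<exists>!x. (1/s) *\<^sub>R (z - f x) = x"
    proof (rule banach_fix_type[of "K/s"])
      show "0 \<le> K/s" "K/s < 1" using assms(2,3) by auto
      show "\<forall>x y. dist ((1/s) *\<^sub>R (z - f x)) ((1/s) *\<^sub>R (z - f y)) \<le> K/s * dist x y"
      proof (intro allI)
        fix x y
        have "dist ((1/s) *\<^sub>R (z - f x)) ((1/s) *\<^sub>R (z - f y)) = (1/s) * norm (f y - f x)"
          using assms(2,3) by (simp add: dist_norm flip: scaleR_diff_right)
        also have "\<dots> \<le> (1/s) * (K * norm (y - x))"
          using assms(2,3) lip by (intro mult_left_mono) auto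
        finally show "dist ((1/s) *\<^sub>R (z - f x)) ((1/s) *\<^sub>R (z - f y)) \<le> K/s * dist x y"
          by (simp add: dist_norm norm_minus_commute)
      qed
    qed
    then obtain x where "(1/s) *\<^sub>R (z - f x) = x" by blast
    then have "s *\<^sub>R ((1/s) *\<^sub>R (z - f x)) = s *\<^sub>R x" by simp
    then show "\<exists>x. z = f x + s *\<^sub>R x" using assms(2,3) by (auto intro!: exI[of _ x] simp: algebra_simps)
  qed
qed

lemma norm_matrix_vector_mult_le:
  fixes A :: "real^'m^'n"
  shows "norm (A *v x) \<le> norm A * norm x"
proof -
  have "norm (A *v x) \<le> L2_set (\<lambda>i. norm (A $ i) * norm x) UNIV"
    unfolding norm_vec_def[of "A *v x"]
    by (intro L2_set_mono) (auto simp: matrix_vector_mult_def inner_vec_def[symmetric] Cauchy_Schwarz_ineq2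
       intro!: order_trans[OF _ Cauchy_Schwarz_ineq2] simp: inner_vec_def)
  then show ?thesis by (simp add: L2_set_left_distrib norm_vec_def[of A])
qed

text \<open>For large \<open>s\<close> the bijections \<open>f + s id\<close> and \<open>L + s id\<close> agree off the box, so they map the box onto
  the same set. Its volume, computed by change of variables through either map, gives the claim for
  \<open>A x + s I\<close> and \<open>L + s I\<close>; the determinants are positive, so absolute values do no harm. The
  polynomial \<open>P\<close> in \<open>s\<close> is the difference of the two sides.\<close>

lemma integral_det_derivative_wellorder:
  fixes f :: "real^'n::{finite,wellorder} \<Rightarrow> real^'n::_"
  assumes der: "\<And>x. (f has_derivative (\<lambda>h. A x *v h)) (at x)"
    and bdd: "\<And>x. norm (A x) \<le> K"
    and out: "\<And>x. x \<notin> cbox a b \<Longrightarrow> f x = L *v x"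
  shows "((\<lambda>x. det (A x)) has_integral content (cbox a b) * det L) (cbox a b)"
proof -
  let ?S = "cbox a b"
  define K' where "K' = max K (norm L)"
  obtain \<delta> where \<delta>: "\<delta> > 0" "\<And>(A :: real^'n::_^'n::_) s. norm A < \<delta> * s \<Longrightarrow> det (A + mat s) > 0"
    using det_add_scalar_pos by blast
  have meas: "(\<lambda>x. A x $ i $ j) \<in> borel_measurable (lebesgue_on ?S)" for i j
    using borel_measurable_partial_derivatives[of ?S f "\<lambda>x h. A x *v h" i j]
      has_derivative_at_withinI[OF der] by simp
  have compbd: "\<bar>A x $ i $ j\<bar> \<le> K" for x i j
    using component_le_norm_cart[of "A x $ i" j] Finite_Cartesian_Product.norm_nth_le[of "A x" i] bdd[of x] by linarith
  define c where "c p X x = of_int (sign p) * (\<Prod>i\<in>X. A x $ i $ p i) * (\<Prod>i\<in>UNIV - X. if i = p i then 1 else (0::real))"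
    for p :: "'n \<Rightarrow> 'n" and X x
  define d where "d p X = of_int (sign p) * (\<Prod>i\<in>X. L $ i $ p i) * (\<Prod>i\<in>UNIV - X. if i = p i then 1 else (0::real))"
    for p :: "'n \<Rightarrow> 'n" and X
  have expA: "det (A x + mat s) = (\<Sum>p | p permutes (UNIV::'n set). \<Sum>X\<in>Pow UNIV. c p X x * s ^ card (UNIV - X))" for x s
    unfolding det_add_scalar_expand c_def ..
  have expL: "det (L + mat s) = (\<Sum>p | p permutes (UNIV::'n set). \<Sum>X\<in>Pow UNIV. d p X * s ^ card (UNIV - X))" for s
    unfolding det_add_scalar_expand d_def ..
  have K0: "0 \<le> K" using bdd[of 0] norm_ge_zero order_trans by blast
  have intc: "c p X integrable_on ?S" for p X
  proof (rule measurable_bounded_by_integrable_imp_integrable)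
    show "c p X \<in> borel_measurable (lebesgue_on ?S)"
      unfolding c_def[abs_def] using meas by measurable
    show "norm (c p X x) \<le> K ^ card X" for x
    proof -
      have "norm (c p X x) \<le> \<bar>of_int (sign p)\<bar> * (\<Prod>i\<in>X. \<bar>A x $ i $ p i\<bar>) * 1"
        unfolding c_def real_norm_def abs_mult abs_prod
        by (intro mult_mono prod_le_1) (auto intro!: mult_nonneg_nonneg prod_nonneg)
      also have "\<dots> \<le> 1 * (\<Prod>i\<in>X. K) * 1"
        by (intro mult_mono prod_mono) (auto simp: sign_def compbd K0 intro!: prod_nonneg)
      finally show ?thesis by simp
    qed
  qed auto
  have large: "integral ?S (\<lambda>x. det (A x + mat s)) = content ?S * det (L + mat s)"
    if s: "s > K'" "s > K' / \<delta>" for s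
  proof -
    let ?f = "\<lambda>x. f x + s *\<^sub>R x" and ?L = "\<lambda>x. L *v x + s *\<^sub>R x"
    have K'0: "K' \<ge> 0" "K' \<ge> K" "K' \<ge> norm L" unfolding K'_def by (auto simp: le_max_iff_disj)
    have "norm (f x - f y) \<le> K' * norm (x - y)" for x y
    proof (rule differentiable_bound[of UNIV])
      show "onorm (\<lambda>h. A x *v h) \<le> K'" for x
      proof (rule onorm_bound[OF K'0(1)])
        show "norm (A x *v h) \<le> K' * norm h" for h
          using norm_matrix_vector_mult_le[of "A x" h] bdd[of x] K'0
          by (meson mult_right_mono norm_ge_zero order_trans)
      qed
    qed (use der in auto)
    then have bijf: "bij ?f" by (rule bij_add_scaled_identity) (use K'0 s in auto)
    have "norm (L *v x - L *v y) \<le> K' * norm (x - y)" for x y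
    proof -
      have "norm (L *v x - L *v y) \<le> norm L * norm (x - y)"
        unfolding matrix_vector_mult_diff_distrib[symmetric] by (rule norm_matrix_vector_mult_le)
      also have "\<dots> \<le> K' * norm (x - y)"
        by (intro mult_right_mono K'0) simp
      finally show ?thesis .
    qed
    then have bijL: "bij ?L" by (rule bij_add_scaled_identity) (use K'0 s in auto)
    have mats: "mat s *v h = s *\<^sub>R h" for h :: "real^'n::_"
      by (subst Finite_Cartesian_Product.vec_eq_iff) (simp add: matrix_vector_mult_def Finite_Cartesian_Product.mat_def if_distrib if_distribR cong: if_cong)
    have Lm: "?L = (*v) (L + mat s)" by (auto simp: matrix_vector_mult_add_rdistrib mats)
    have der': "(?f has_derivative (\<lambda>h. (A x + mat s) *v h)) (at x within ?S)" for x
      unfolding matrix_vector_mult_add_rdistrib mats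
      by (intro derivative_intros has_derivative_at_withinI[OF der])
    have posA: "det (A x + mat s) > 0" for x
    proof (rule \<delta>(2))
      have "norm (A x) \<le> K'" using bdd K'0 order_trans by blast
      also have "\<dots> < \<delta> * s" using s(2) \<delta>(1) by (simp add: divide_less_eq mult.commute)
      finally show "norm (A x) < \<delta> * s" .
    qed
    have posL: "det (L + mat s) > 0"
    proof (rule \<delta>(2))
      have "norm L \<le> K'" using K'0 by blast
      also have "\<dots> < \<delta> * s" using s(2) \<delta>(1) by (simp add: divide_less_eq mult.commute)
      finally show "norm L < \<delta> * s" .
    qed
    have "?f ` ?S = UNIV - ?f ` (- ?S)"
      using bij_image_Compl_eq[OF bijf, of ?S] by blast
    also have "?f ` (- ?S) = ?L ` (- ?S)" using out by (intro image_cong) auto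
    also have "UNIV - ?L ` (- ?S) = ?L ` ?S"
      using bij_image_Compl_eq[OF bijL, of ?S] by blast
    finally have img: "?f ` ?S = ?L ` ?S" .
    have intdet: "(\<lambda>x. det (A x + mat s)) integrable_on ?S"
      unfolding expA by (intro integrable_sum integrable_on_mult_left intc) auto
    have "measure lebesgue (?f ` ?S) = integral ?S (\<lambda>x. \<bar>det (matrix (\<lambda>h. (A x + mat s) *v h))\<bar>)"
      by (rule measure_differentiable_image_eq[OF _ der'])
         (use bijf intdet posA in \<open>auto simp: bij_def abs_of_pos intro: inj_on_subset\<close>)
    moreover have "measure lebesgue (?L ` ?S) = \<bar>det (L + mat s)\<bar> * measure lebesgue ?S"
      unfolding Lm by (subst measure_linear_image) auto
    ultimately show ?thesis using img posA posL by (simp add: abs_of_pos mult.commute)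
  qed
  define P where "P = (\<Sum>p | p permutes (UNIV::'n set). \<Sum>X\<in>Pow UNIV.
      Polynomial.monom (integral ?S (c p X) - content ?S * d p X) (card (UNIV - X)))"
  have polyP: "poly P s = integral ?S (\<lambda>x. det (A x + mat s)) - content ?S * det (L + mat s)" for s
  proof -
    have "integral ?S (\<lambda>x. det (A x + mat s)) =
       (\<Sum>p | p permutes (UNIV::'n set). \<Sum>X\<in>Pow UNIV. integral ?S (c p X) * s ^ card (UNIV - X))"
      unfolding expA
      by (simp add: Henstock_Kurzweil_Integration.integral_sum integrable_sum integrable_on_mult_left intc)
    then show ?thesis
      by (simp add: P_def expL poly_sum poly_monom sum_distrib_left sum_subtractf[symmetric] algebra_simps)
  qed
  have "P = 0"
  proof (rule ccontr)
    assume "P \<noteq> 0"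
    then have "finite {s. poly P s = 0}" by (rule poly_roots_finite)
    moreover have "{max K' (K'/\<delta>)<..} \<subseteq> {s. poly P s = 0}"
      using large by (auto simp: polyP)
    ultimately show False using infinite_Ioi finite_subset by blast
  qed
  then have "integral ?S (\<lambda>x. det (A x + mat 0)) = content ?S * det (L + mat 0)"
    using polyP[of 0] by simp
  moreover have "(mat 0 :: real^'n::_^'n::_) = 0" by (simp add: Finite_Cartesian_Product.vec_eq_iff Finite_Cartesian_Product.mat_def)
  moreover have "(\<lambda>x. det (A x + mat 0)) integrable_on ?S"
    unfolding expA by (intro integrable_sum integrable_on_mult_left intc) auto
  ultimately show ?thesis by (simp add: has_integral_iff)
qed

text \<open>Conjugation with a bijection maps permutations to permutations and preserves signs. The index set
  \<open>K\<close> may live in another type; below it is a set of natural numbers or another finite type.\<close>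

lemma det_transport:
  fixes A :: "real^'n^'n" and e :: "'a \<Rightarrow> 'n"
  assumes e: "bij_betw e K UNIV" and fin: "finite K"
  shows "det A = (\<Sum>p | p permutes K. of_int (sign p) * (\<Prod>i\<in>K. A $ e i $ e (p i)))"
proof -
  have inj: "inj_on e K" and img: "e ` K = UNIV" using e by (auto simp: bij_betw_def)
  have bij: "bij_betw (map_permutation K e) {p. p permutes K} {p. p permutes (UNIV :: 'n set)}"
  proof (rule bij_betw_byWitness[where f' = "map_permutation UNIV (inv_into K e)"])
    have e': "bij_betw (inv_into K e) UNIV K"
      using bij_betw_inv_into[OF e] .
    show "map_permutation K e ` {p. p permutes K} \<subseteq> {p. p permutes UNIV}"
      using map_permutation_permutes[OF e] by auto
    show "map_permutation UNIV (inv_into K e) ` {p. p permutes UNIV} \<subseteq> {p. p permutes K}"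
      using map_permutation_permutes[OF e'] by auto
    show "\<forall>p\<in>{p. p permutes K}. map_permutation UNIV (inv_into K e) (map_permutation K e p) = p"
      using map_permutation_compose_inv[OF e] inj by auto
    show "\<forall>p\<in>{p. p permutes UNIV}. map_permutation K e (map_permutation UNIV (inv_into K e) p) = p"
      using map_permutation_compose_inv[OF e'] img by (auto simp: f_inv_into_f)
  qed
  have "det A = (\<Sum>p | p permutes K. of_int (sign (map_permutation K e p)) * (\<Prod>i\<in>UNIV. A $ i $ map_permutation K e p i))"
    unfolding Determinants.det_def by (subst sum.reindex_bij_betw[OF bij, symmetric]) simp
  also have "\<dots> = (\<Sum>p | p permutes K. of_int (sign p) * (\<Prod>i\<in>K. A $ e i $ e (p i)))"
  proof (intro sum.cong refl)
    fix p assume "p \<in> {p. p permutes K}"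
    then have p: "p permutes K" by simp
    have "(\<Prod>i\<in>UNIV. A $ i $ map_permutation K e p i) = (\<Prod>i\<in>K. A $ e i $ map_permutation K e p (e i))"
      using prod.reindex_bij_betw[OF e, symmetric] .
    also have "\<dots> = (\<Prod>i\<in>K. A $ e i $ e (p i))"
      using inj by (intro prod.cong refl) (simp add: map_permutation_apply)
    finally show "of_int (sign (map_permutation K e p)) * (\<Prod>i\<in>UNIV. A $ i $ map_permutation K e p i)
        = of_int (sign p) * (\<Prod>i\<in>K. A $ e i $ e (p i))"
      using sign_map_permutation[OF inj p fin] by simp
  qed
  finally show ?thesis .
qed

lemma det_reindex:
  fixes A :: "real^'n^'n" and e :: "'m::finite \<Rightarrow> 'n"
  assumes "bij e"
  shows "det (\<chi> i j. A $ e i $ e j) = det A"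
  by (simp add: det_transport[OF assms finite] Determinants.det_def)

text \<open>The change of variables formula for the Jacobian determinant refers to coordinates in a well-ordered
  index type. Every finite type has a well-ordered copy, and relabelling the coordinates along it
  preserves norms, boxes, volumes and determinants.\<close>

typedef 'a well_ordered_copy = "UNIV :: 'a set" by simp

lemma bij_Rep_well_ordered_copy: "bij Rep_well_ordered_copy"
  by (metis Abs_well_ordered_copy_inverse Rep_well_ordered_copy_inverse UNIV_I bijI')

instantiation well_ordered_copy :: (finite) "{finite, wellorder}"
begin

definition less_eq_well_ordered_copy :: "'a well_ordered_copy \<Rightarrow> 'a well_ordered_copy \<Rightarrow> bool" where
  "x \<le> y \<longleftrightarrow> to_nat (Rep_well_ordered_copy x) \<le> to_nat (Rep_well_ordered_copy y)"

definition less_well_ordered_copy :: "'a well_ordered_copy \<Rightarrow> 'a well_ordered_copy \<Rightarrow> bool" where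
  "x < y \<longleftrightarrow> to_nat (Rep_well_ordered_copy x) < to_nat (Rep_well_ordered_copy y)"

instance
proof
  show "finite (UNIV :: 'a well_ordered_copy set)"
    using bij_betw_finite[OF bij_Rep_well_ordered_copy[where 'a = 'a]] by simp
  fix P :: "'a well_ordered_copy \<Rightarrow> bool" and a :: "'a well_ordered_copy"
  assume step: "\<And>x. (\<And>y. y < x \<Longrightarrow> P y) \<Longrightarrow> P x"
  show "P a"
  proof (induction a rule: measure_induct_rule[where f = "\<lambda>x. to_nat (Rep_well_ordered_copy x)"])
    case (less x)
    show ?case by (rule step, rule less) (simp add: less_well_ordered_copy_def)
  qed
qed (auto simp: less_eq_well_ordered_copy_def less_well_ordered_copy_def Rep_well_ordered_copy_inject)

end

definition relabel :: "'b^'n \<Rightarrow> 'b^'n well_ordered_copy" where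
  "relabel x = (\<chi> i. x $ Rep_well_ordered_copy i)"

definition unlabel :: "'b^'n well_ordered_copy \<Rightarrow> 'b^'n" where
  "unlabel x = (\<chi> i. x $ Abs_well_ordered_copy i)"

lemma unlabel_relabel: "unlabel (relabel x) = x"
  by (simp add: unlabel_def relabel_def Abs_well_ordered_copy_inverse)

lemma relabel_unlabel: "relabel (unlabel x) = x"
  by (simp add: unlabel_def relabel_def Rep_well_ordered_copy_inverse)

lemma norm_relabel: "norm (relabel x) = norm x"
  by (simp add: norm_vec_def L2_set_def relabel_def
      sum.reindex_bij_betw[OF bij_Rep_well_ordered_copy, of "\<lambda>i. (norm (x $ i))\<^sup>2"])

lemma bounded_linear_relabel: "bounded_linear (relabel :: real^'n \<Rightarrow> _)"
  by (rule bounded_linear_intro[of _ 1])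
     (simp_all add: norm_relabel, simp_all add: relabel_def Finite_Cartesian_Product.vec_eq_iff)

lemma norm_unlabel: "norm (unlabel x) = norm x"
  by (metis norm_relabel relabel_unlabel)

lemma bounded_linear_unlabel: "bounded_linear (unlabel :: _ \<Rightarrow> real^'n)"
  by (rule bounded_linear_intro[of _ 1])
     (simp_all add: norm_unlabel, simp_all add: unlabel_def Finite_Cartesian_Product.vec_eq_iff)

lemma relabel_cbox: "relabel ` cbox u v = cbox (relabel u) (relabel v)"
  for u v :: "real^'n"
proof -
  have "y \<in> relabel ` cbox u v \<longleftrightarrow> unlabel y \<in> cbox u v" for y
    by (metis image_iff relabel_unlabel unlabel_relabel)
  moreover have "unlabel y \<in> cbox u v \<longleftrightarrow> y \<in> cbox (relabel u) (relabel v)" for y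
    by (simp add: mem_box_cart unlabel_def relabel_def)
       (metis Abs_well_ordered_copy_inverse Rep_well_ordered_copy_inverse UNIV_I)
  ultimately show ?thesis by blast
qed

lemma unlabel_cbox: "unlabel ` cbox u v = cbox (unlabel u) (unlabel v)"
  for u v :: "real^('n::finite) well_ordered_copy"
proof -
  have "unlabel ` cbox u v = unlabel ` relabel ` cbox (unlabel u) (unlabel v)"
    by (simp add: relabel_cbox relabel_unlabel)
  then show ?thesis by (simp add: image_image unlabel_relabel)
qed

lemma content_relabel_cbox: "content (cbox (relabel u) (relabel v)) = content (cbox u v)"
  for u v :: "real^'n"
proof (cases "cbox u v = {}")
  case True
  then have "cbox (relabel u) (relabel v) = {}" by (simp flip: relabel_cbox)
  with True show ?thesis by simp
next
  case False
  then have "cbox (relabel u) (relabel v) \<noteq> {}" by (simp flip: relabel_cbox)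
  with False show ?thesis
    by (simp add: content_cbox_cart relabel_def
        prod.reindex_bij_betw[OF bij_Rep_well_ordered_copy, of "\<lambda>i. v $ i - u $ i"])
qed

lemma integral_det_derivative:
  fixes f :: "real^'n \<Rightarrow> real^'n"
  assumes der: "\<And>x. (f has_derivative (\<lambda>h. A x *v h)) (at x)"
    and bdd: "\<And>x. norm (A x) \<le> K"
    and out: "\<And>x. x \<notin> cbox a b \<Longrightarrow> f x = L *v x"
  shows "((\<lambda>x. det (A x)) has_integral content (cbox a b) * det L) (cbox a b)"
proof -
  define R where "R M = (\<chi> i j. M $ Rep_well_ordered_copy i $ Rep_well_ordered_copy j)"
    for M :: "real^'n^'n"
  have R: "relabel (M *v unlabel h) = R M *v h" for M h
  proof -
    have "(\<Sum>j\<in>UNIV. M $ i $ j * h $ Abs_well_ordered_copy j) =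
        (\<Sum>j\<in>UNIV. M $ i $ Rep_well_ordered_copy j * h $ j)" for i
      by (simp add: Rep_well_ordered_copy_inverse
          flip: sum.reindex_bij_betw[OF bij_Rep_well_ordered_copy, of "\<lambda>j. M $ i $ j * h $ Abs_well_ordered_copy j"])
    then show ?thesis
      by (simp add: Finite_Cartesian_Product.vec_eq_iff relabel_def unlabel_def R_def matrix_vector_mult_def)
  qed
  have normR: "norm (R M) = norm M" for M
  proof -
    have "norm (R M) = norm (relabel (\<chi> i. relabel (M $ i)))"
      by (simp add: R_def relabel_def)
    also have "\<dots> = norm M"
      unfolding norm_relabel by (simp add: norm_vec_def[of "\<chi> i. relabel (M $ i)"] norm_vec_def[of M] norm_relabel)
    finally show ?thesis .
  qed
  have detR: "det (R M) = det M" for M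
    unfolding R_def by (rule det_reindex[OF bij_Rep_well_ordered_copy])
  have "((\<lambda>x. det (R (A (unlabel x)))) has_integral content (cbox (relabel a) (relabel b)) * det (R L))
      (cbox (relabel a) (relabel b))"
  proof (rule integral_det_derivative_wellorder)
    show "((\<lambda>x. relabel (f (unlabel x))) has_derivative (\<lambda>h. R (A (unlabel x)) *v h)) (at x)" for x
      unfolding R[symmetric]
      by (intro bounded_linear.has_derivative[OF bounded_linear_relabel]
          has_derivative_compose[OF bounded_linear_imp_has_derivative[OF bounded_linear_unlabel] der])
    show "norm (R (A (unlabel x))) \<le> K" for x
      using bdd normR by simp
    fix x assume "x \<notin> cbox (relabel a) (relabel b)"
    then have "unlabel x \<notin> cbox a b"
      unfolding relabel_cbox[symmetric] by (metis image_eqI relabel_unlabel)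
    then show "relabel (f (unlabel x)) = R L *v x" by (simp add: out R)
  qed
  then have "((\<lambda>x. det (A (unlabel x))) has_integral content (cbox a b) * det L)
      (cbox (relabel a) (relabel b))"
    by (simp add: detR content_relabel_cbox)
  then have "((\<lambda>x. det (A (unlabel (relabel x)))) has_integral (1 / 1) *\<^sub>R (content (cbox a b) * det L))
      (unlabel ` cbox (relabel a) (relabel b))"
  proof (rule has_integral_twiddle[rotated -1])
    show "isCont relabel x" for x :: "real^'n"
      using bounded_linear_relabel by (rule linear_continuous_at)
    show "\<exists>w z. relabel ` cbox u v = cbox w z" for u v :: "real^'n"
      using relabel_cbox by blast
    show "\<exists>w z. unlabel ` cbox u v = cbox w z" for u v :: "real^'n well_ordered_copy"
      using unlabel_cbox by blast
    show "content (relabel ` cbox u v) = 1 * content (cbox u v)" for u v :: "real^'n"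
      by (simp add: relabel_cbox content_relabel_cbox)
  qed (simp_all add: unlabel_relabel relabel_unlabel)
  then show ?thesis by (simp add: unlabel_relabel unlabel_cbox)
qed

section \<open>The determinant of a weak gradient\<close>

lemma norm_matrix_transpose: "norm (transpose M) = norm M"
  for M :: "real^'n^'m"
  unfolding norm_vec_def L2_set_def
  by (simp add: sum_nonneg transpose_def sum.swap[of "\<lambda>i j. (M $ j $ i)\<^sup>2"])

text \<open>The map \<open>y \<mapsto> y v* A + mollify \<epsilon> u y\<close> is linear outside a fixed box and has derivative
  \<open>transpose (A + mollify \<epsilon> G y)\<close>, so the statement holds with \<open>mollify \<epsilon> G\<close> in place of \<open>G\<close>. The
  determinants are uniformly bounded and converge almost everywhere.\<close>

lemma null_lagrangian_det:
  fixes u :: "real^'n \<Rightarrow> real^'n" and G :: "real^'n \<Rightarrow> real^'n^'n"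
  assumes u: "continuous_on UNIV u" and S: "bounded S" "\<And>y. y \<notin> S \<Longrightarrow> u y = 0" "\<And>y. y \<notin> S \<Longrightarrow> G y = 0"
    and G: "G \<in> borel_measurable lebesgue" and C: "\<And>y. norm (G y) \<le> C"
    and weak: "weak_gradient UNIV u G"
  shows "(LINT y|lebesgue. det (A + G y) - det A) = 0"
proof -
  obtain a where a: "S \<subseteq> cbox (-a) a"
    using bounded_subset_cbox_symmetric[OF S(1)] by blast
  let ?Q = "cbox (-a - One) a"
  define \<epsilon> where "\<epsilon> n = 1 / real (Suc n)" for n
  have \<epsilon>: "0 < \<epsilon> n" "\<epsilon> n \<le> 1" for n by (auto simp: \<epsilon>_def)
  define d where "d n x = det (A + mollify (\<epsilon> n) G x) - det A" for n x
  have G0: "G y = 0" if "y \<notin> ?Q" for y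
  proof -
    have "cbox (-a) a \<subseteq> ?Q" unfolding subset_box by (auto simp: inner_diff_left)
    then show ?thesis using that a S(3) by blast
  qed
  have d0: "d n x = 0" if "x \<notin> ?Q" for n x
  proof -
    have "mollify (\<epsilon> n) G x = 0"
      by (rule mollify_eq_0[of "-a" a]) (use that a S(3) \<epsilon> in auto)
    then show ?thesis by (simp add: d_def)
  qed
  have "compact ((\<lambda>M. det (A + M) - det A) ` cball 0 C)"
    by (intro compact_continuous_image continuous_intros continuous_on_det) auto
  then have "bounded ((\<lambda>M. det (A + M) - det A) ` cball 0 C)"
    by (rule compact_imp_bounded)
  then obtain D where "\<forall>v\<in>(\<lambda>M. det (A + M) - det A) ` cball 0 C. norm v \<le> D"
    unfolding bounded_iff by blast
  then have D: "\<bar>det (A + M) - det A\<bar> \<le> D" if "norm M \<le> C" for M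
    using that by simp
  have bd: "\<bar>d n x\<bar> \<le> D" for n x
    unfolding d_def by (intro D norm_mollify_le[OF G C] \<epsilon>)
  have hi: "(d n has_integral 0) ?Q" for n
  proof -
    let ?M = "\<lambda>x. mollify (\<epsilon> n) G x"
    have "((\<lambda>x. det (transpose (A + ?M x))) has_integral content ?Q * det (transpose A)) ?Q"
    proof (rule integral_det_derivative)
      show "((\<lambda>x. x v* A + mollify (\<epsilon> n) u x) has_derivative (\<lambda>h. transpose (A + ?M x) *v h)) (at x)" for x
      proof -
        have "((\<lambda>x. x v* A) has_derivative (\<lambda>h. h v* A)) (at x)"
        proof -
          have eq: "(\<lambda>x. x v* A) = (*v) (transpose A)" by (rule ext) simp
          show ?thesis
            unfolding eq by (rule bounded_linear_imp_has_derivative[OF matrix_vector_mul_bounded_linear])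
        qed
        moreover have "(mollify (\<epsilon> n) u has_derivative
            (\<lambda>h. \<Sum>j\<in>UNIV. h $ j *\<^sub>R mollify (\<epsilon> n) (\<lambda>y. G y $ j) x)) (at x)"
          by (rule mollify_has_derivative[OF u S(1) _ weak \<epsilon>(1)]) (rule S(2))
        ultimately have "((\<lambda>x. x v* A + mollify (\<epsilon> n) u x) has_derivative
            (\<lambda>h. h v* A + (\<Sum>j\<in>UNIV. h $ j *\<^sub>R mollify (\<epsilon> n) (\<lambda>y. G y $ j) x))) (at x)"
          by (rule has_derivative_add)
        then
        show ?thesis
          by (rule has_derivative_eq_rhs)
             (rule ext, subst Finite_Cartesian_Product.vec_eq_iff, simp add: mollify_component[OF G C \<epsilon>(1)]
               vector_matrix_mult_def algebra_simps sum.distrib)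
      qed
      have "norm (A + ?M x) \<le> norm A + C" for x
        using norm_mollify_le[OF G C \<epsilon>(1), of n x] norm_triangle_ineq[of A "?M x"] by linarith
      moreover have "norm (transpose M) = norm M" for M :: "real^'n^'n"
        by (rule norm_matrix_transpose)
      ultimately show "norm (transpose (A + ?M x)) \<le> norm A + C" for x by simp
      show "x v* A + mollify (\<epsilon> n) u x = transpose A *v x" if "x \<notin> ?Q" for x
      proof -
        have "mollify (\<epsilon> n) u x = 0"
          by (rule mollify_eq_0[of "-a" a]) (use that a S(2) \<epsilon> in auto)
        then show ?thesis by simp
      qed
    qed
    then have "((\<lambda>x. det (A + ?M x)) has_integral content ?Q * det A) ?Q"
      by (simp add: det_transpose)
    from has_integral_diff[OF this has_integral_const[of "det A" "-a - One" a]]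
    show ?thesis by (simp add: d_def[abs_def])
  qed
  have Qs: "?Q \<inter> space lebesgue \<in> sets lebesgue" by simp
  have dmeas: "d n \<in> borel_measurable lebesgue" for n
  proof -
    have "d n \<in> borel_measurable (lebesgue_on ?Q)"
      using hi[of n] by (intro integrable_imp_measurable) (auto simp: integrable_on_def)
    moreover have "(\<lambda>x. indicator ?Q x *\<^sub>R d n x) = d n"
      by (auto simp: fun_eq_iff indicator_def d0)
    ultimately show ?thesis
      using borel_measurable_restrict_space_iff[OF Qs, of "d n"] by simp
  qed
  have intd: "integrable lebesgue (d n)" for n
    using bd d0 by (intro integrable_lebesgue_bounded_support[OF dmeas, of _ D ?Q]) auto
  have "(LINT x|lebesgue. d n x) = 0" for n
    using lebesgue_integral_eq_integral_support[OF intd d0] hi[of n] by (simp add: integral_unique)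
  moreover have "(\<lambda>n. LINT x|lebesgue. d n x) \<longlonglongrightarrow> (LINT y|lebesgue. det (A + G y) - det A)"
  proof (rule integral_dominated_convergence)
    have "continuous_on UNIV (\<lambda>M. det (A + M) - det A)"
      by (intro continuous_intros continuous_on_det)
    from measurable_compose[OF G borel_measurable_continuous_onI[OF this]]
    show "(\<lambda>y. det (A + G y) - det A) \<in> borel_measurable lebesgue" .
    show "integrable lebesgue (\<lambda>x. indicator ?Q x *\<^sub>R D)"
      using lmeasurable_cbox[of "-a - One" a]
      by (intro integrable_scaleR_left integrable_real_indicator) (auto simp: fmeasurable_def)
    show "AE x in lebesgue. norm (d n x) \<le> indicator ?Q x *\<^sub>R D" for n
      using bd d0 by (intro AE_I2) (auto simp: indicator_def)
    have "filterlim \<epsilon> (at_right 0) sequentially"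
      using \<epsilon>(1) LIMSEQ_inverse_real_of_nat
      by (intro tendsto_imp_filterlim_at_right always_eventually) (auto simp: \<epsilon>_def[abs_def] inverse_eq_divide)
    then have comp: "(\<lambda>n. mollify (\<epsilon> n) G x) \<longlonglongrightarrow> G x"
      if "((\<lambda>\<epsilon>. mollify \<epsilon> G x) \<longlongrightarrow> G x) (at_right 0)" for x
      using filterlim_compose[OF that] by blast
    show "AE x in lebesgue. (\<lambda>n. d n x) \<longlonglongrightarrow> det (A + G x) - det A"
      using AE_mollify_tendsto[OF G C]
    proof (rule eventually_mono)
      fix x assume "((\<lambda>\<epsilon>. mollify \<epsilon> G x) \<longlongrightarrow> G x) (at_right 0)"
      from continuous_on_tendsto_compose[OF \<open>continuous_on UNIV (\<lambda>M. det (A + M) - det A)\<close> comp[OF this]]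
      show "(\<lambda>n. d n x) \<longlonglongrightarrow> det (A + G x) - det A" by (simp add: d_def)
    qed
  qed (rule dmeas)
  ultimately have "(\<lambda>n. 0) \<longlonglongrightarrow> (LINT y|lebesgue. det (A + G y) - det A)"
    by simp
  then show ?thesis by (simp add: LIMSEQ_const_iff)
qed

section \<open>Minors as determinants\<close>

lemma det_eq_det_mat:
  fixes A :: "real^'n^'n"
  assumes e: "bij_betw e {0..<d} UNIV"
  shows "det A = Determinant.det (Matrix.mat d d (\<lambda>(a, b). A $ e a $ e b))"
proof -
  have "(\<Prod>i = 0..<d. Matrix.mat d d (\<lambda>(a, b). A $ e a $ e b) $$ (i, p i)) = (\<Prod>i = 0..<d. A $ e i $ e (p i))"
    if "p permutes {0..<d}" for p
    using permutes_in_image[OF that] by (intro prod.cong refl) auto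
  then show ?thesis
    by (auto simp: det_transport[OF e] Determinant.det_def sign_def intro!: sum.cong)
qed

text \<open>Used to order rows and columns so that those in \<open>I\<close> come first and a minor becomes a leading block.\<close>

lemma ex_enumeration_extending:
  fixes I :: "'n::{finite,linorder} set"
  obtains e where "bij_betw e {0..<CARD('n)} UNIV"
    and "\<And>a. a < card I \<Longrightarrow> e a = sorted_list_of_set I ! a"
    and "\<And>a. \<lbrakk>card I \<le> a; a < CARD('n)\<rbrakk> \<Longrightarrow> e a \<notin> I"
proof -
  define xs where "xs = sorted_list_of_set I @ sorted_list_of_set (- I)"
  have "distinct xs" "set xs = UNIV" by (auto simp: xs_def)
  then have len: "length xs = CARD('n)" using distinct_card by metis
  from \<open>distinct xs\<close> \<open>set xs = UNIV\<close> have "bij_betw (\<lambda>a. xs ! a) {0..<CARD('n)} UNIV"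
    using bij_betw_nth[of xs "{..<length xs}" UNIV] len by (simp add: lessThan_atLeast0)
  moreover have "xs ! a = sorted_list_of_set I ! a" if "a < card I" for a
    using that by (simp add: xs_def nth_append)
  moreover have "xs ! a \<notin> I" if "card I \<le> a" "a < CARD('n)" for a
  proof -
    have "a - card I < length (sorted_list_of_set (- I))"
      using that len by (simp add: xs_def)
    then have "sorted_list_of_set (- I) ! (a - card I) \<in> set (sorted_list_of_set (- I))"
      by (rule nth_mem)
    then show ?thesis using that by (simp add: xs_def nth_append)
  qed
  ultimately show ?thesis by (rule that)
qed

text \<open>The map \<open>\<sigma>\<close> is the order isomorphism from \<open>I\<close> to \<open>J\<close>. With the indices in \<open>I\<close> listed first, the
  matrix on the right has the block form \<open>(P 0; C 1)\<close>, where \<open>P\<close> is the submatrix defining the minor.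
  The columns outside \<open>I\<close> are unit vectors, that is, gradients of coordinate functions.\<close>

lemma minor_eq_det:
  fixes I :: "'n::{finite,linorder} set" and J :: "'m::{finite,linorder} set"
  assumes card: "card I = card J"
  obtains \<sigma> where "\<And>A :: real^'m::_^'n::_.
     minor A I J = det (\<chi> i j. if j \<in> I then A $ i $ \<sigma> j else if i = j then 1 else 0)"
proof -
  obtain e where e: "bij_betw e {0..<CARD('n)} UNIV"
    and e1: "\<And>a. a < card I \<Longrightarrow> e a = sorted_list_of_set I ! a"
    and e2: "\<And>a. \<lbrakk>card I \<le> a; a < CARD('n)\<rbrakk> \<Longrightarrow> e a \<notin> I"
    using ex_enumeration_extending[of I] by blast
  define k where "k = card I"
  define d where "d = CARD('n)"
  have kd: "k \<le> d" by (simp add: k_def d_def card_mono)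
  have eI: "e a \<in> I" if "a < k" for a
    using that e1[of a] nth_mem[of a "sorted_list_of_set I"] by (simp add: k_def)
  have einj: "e a = e b \<longleftrightarrow> a = b" if "a < d" "b < d" for a b
    using e that by (auto simp: bij_betw_def inj_on_def d_def)
  define \<sigma> where "\<sigma> j = sorted_list_of_set J ! inv_into {0..<d} e j" for j
  have \<sigma>: "\<sigma> (e b) = sorted_list_of_set J ! b" if "b < d" for b
    using e that by (simp add: \<sigma>_def d_def bij_betw_inv_into_left)
  have "minor A I J = det (\<chi> i j. if j \<in> I then A $ i $ \<sigma> j else if i = j then 1 else 0)"
    for A :: "real^'m::_^'n::_"
  proof -
    let ?N = "(\<chi> i j. if j \<in> I then A $ i $ \<sigma> j else if i = j then 1 else 0) :: real^'n::_^'n::_"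
    let ?P = "Matrix.mat k k (\<lambda>(a, b). A $ (sorted_list_of_set I ! a) $ (sorted_list_of_set J ! b))"
    let ?C = "Matrix.mat (d - k) k (\<lambda>(a, b). A $ e (a + k) $ (sorted_list_of_set J ! b))"
    have "Matrix.mat d d (\<lambda>(a, b). ?N $ e a $ e b) = four_block_mat ?P (0\<^sub>m k (d - k)) ?C (1\<^sub>m (d - k))"
      (is "?M = ?B")
    proof (rule eq_matI)
      fix a b assume "a < dim_row ?B" "b < dim_col ?B"
      then have ab: "a < d" "b < d" using kd by auto
      consider "a < k" "b < k" | "a < k" "k \<le> b" | "k \<le> a" "b < k" | "k \<le> a" "k \<le> b" by linarith
      then show "?M $$ (a, b) = ?B $$ (a, b)"
      proof cases
        case 1
        then show ?thesis using ab kd e1[of a] eI \<sigma>[of b] by (simp add: k_def)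
      next
        case 2
        then show ?thesis using ab kd e2[of b] einj[of a b] by (simp add: k_def d_def)
      next
        case 3
        then show ?thesis using ab kd eI \<sigma>[of b] by (simp add: k_def)
      next
        case 4
        have "a - k = b - k \<longleftrightarrow> a = b" using 4 by auto
        then show ?thesis using 4 ab kd e2[of b] einj[of a b] by (simp add: k_def d_def)
      qed
    qed (use kd in auto)
    then have "det ?N = Determinant.det ?B"
      using det_eq_det_mat[OF e, of ?N] by (simp add: d_def)
    also have "\<dots> = Determinant.det ?P * Determinant.det (1\<^sub>m (d - k))"
      by (rule det_four_block_mat_upper_right_zero) auto
    finally show ?thesis by (simp add: minor_def k_def card)
  qed
  then show ?thesis by (rule that)
qed

text \<open>The tangent matrix at a fixed base point, freed from the dependence of the basis on that point.\<close>

definition pairing_matrix :: "('m \<Rightarrow> real^'n) \<Rightarrow> (real^'n)^'n \<Rightarrow> real^'m^'n" where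
  "pairing_matrix w F = (\<chi> i j. F $ i \<bullet> w j)"

lemma tangent_matrix_eq_pairing_matrix:
  "tangent_matrix v x F = pairing_matrix (\<lambda>j. v j x) F"
  by (simp add: tangent_matrix_def pairing_matrix_def matrix_vector_mul_component)

text \<open>This form exhibits a minor of \<open>D\<phi>\<close> as the Jacobian determinant of \<open>T \<circ> \<phi>\<close> plus a fixed linear map.\<close>

lemma minor_pairing_matrix_eq_det:
  fixes I :: "'n::{finite,linorder} set" and J :: "'m::{finite,linorder} set" and w :: "'m \<Rightarrow> real^'n::_"
  assumes "card I = card J"
  obtains T P where "bounded_linear T"
    and "\<And>F. minor (pairing_matrix w F) I J = det (P + (\<chi> i. T (F $ i)))"
proof -
  obtain \<sigma> where \<sigma>: "\<And>A :: real^'m::_^'n::_.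
     minor A I J = det (\<chi> i j. if j \<in> I then A $ i $ \<sigma> j else if i = j then 1 else 0)"
    using minor_eq_det[OF assms] by blast
  define T where "T x = (\<chi> j. if j \<in> I then x \<bullet> w (\<sigma> j) else 0)" for x :: "real^'n::_"
  \<comment> \<open>Constant part: the identity in the columns outside \<open>I\<close>.\<close>
  define P where "P = ((\<chi> i j. if j \<in> I then 0 else if i = j then 1 else 0) :: real^'n::_^'n::_)"
  have "linear T"
    by (rule linearI) (auto simp: T_def Finite_Cartesian_Product.vec_eq_iff inner_add_left)
  then have "bounded_linear T" by (rule linear_conv_bounded_linear[THEN iffD1])
  moreover have "minor (pairing_matrix w F) I J = det (P + (\<chi> i. T (F $ i)))" for F
  proof -
    have "(\<chi> i j. if j \<in> I then pairing_matrix w F $ i $ \<sigma> j else if i = j then 1 else 0) = P + (\<chi> i. T (F $ i))"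
      by (auto simp: P_def T_def pairing_matrix_def Finite_Cartesian_Product.vec_eq_iff)
    then show ?thesis by (simp add: \<sigma>)
  qed
  ultimately show ?thesis by (rule that)
qed

lemma continuous_on_minors_pairing_matrix:
  fixes w :: "'m::{finite,linorder} \<Rightarrow> real^'n::{finite,linorder}"
  shows "continuous_on UNIV (\<lambda>F. minors (pairing_matrix w F))"
proof -
  have "continuous_on UNIV (\<lambda>F. minor (pairing_matrix w F) I J)" if card: "card I = card J" for I J
  proof -
    obtain T P where T: "bounded_linear T" and eq: "\<And>F. minor (pairing_matrix w F) I J = det (P + (\<chi> i. T (F $ i)))"
      by (rule minor_pairing_matrix_eq_det[OF card, of w]) blast
    show ?thesis unfolding eq
      by (intro continuous_on_det continuous_intros bounded_linear.continuous_on[OF T])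
  qed
  then have "continuous_on UNIV (\<lambda>F. minors (pairing_matrix w F) $ p)" for p
    using Rep_minor_index[of p] by (auto simp: minors_def split: prod.split)
  then show ?thesis
    by (subst continuous_on_vec_lambda[of UNIV "\<lambda>p F. minors (pairing_matrix w F) $ p", simplified]) auto
qed

text \<open>Subtract the linear boundary values from \<open>\<phi>\<close>, apply \<open>T\<close>, extend by zero and use
  \<open>null_lagrangian_det\<close>; the integrand there vanishes outside the ball.\<close>

lemma integral_minor_weak_gradient:
  fixes \<phi> :: "real^'n::{finite,linorder} \<Rightarrow> real^'n::_" and w :: "'m::{finite,linorder} \<Rightarrow> real^'n::_"
  assumes ess: "ess_bounded (ball 0 1) \<phi>" "ess_bounded (ball 0 1) G" and weak: "weak_gradient (ball 0 1) \<phi> G"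
    and cont: "continuous_on (cball 0 1) \<phi>"
    and bdry: "\<And>y. y \<in> sphere 0 1 \<Longrightarrow> \<phi> y = (\<Sum>j\<in>UNIV. y $ j *\<^sub>R \<xi> $ j)"
    and card: "card I = card J"
  shows "(LINT y|lebesgue_on (ball 0 1). minor (pairing_matrix w (G y)) I J) =
    measure lebesgue (ball (0 :: real^'n::_) 1) * minor (pairing_matrix w \<xi>) I J"
proof -
  let ?B = "ball 0 1 :: (real^'n::_) set" and ?l = "\<lambda>y. \<Sum>j\<in>UNIV. y $ j *\<^sub>R \<xi> $ j"
  have B: "open ?B" "bounded ?B" by auto
  obtain T P where T: "bounded_linear T"
    and minor: "\<And>F. minor (pairing_matrix w F) I J = det (P + (\<chi> i. T (F $ i)))"
    by (rule minor_pairing_matrix_eq_det[OF card, of w]) blast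
  note lin = bounded_linear.linear[OF T]
  define A where "A = P + (\<chi> i. T (\<xi> $ i))"
  define G1 where "G1 y = (\<chi> j. T ((G y - \<xi>) $ j))" for y
  have AG1: "A + G1 y = P + (\<chi> i. T (G y $ i))" for y
    by (simp add: A_def G1_def Finite_Cartesian_Product.vec_eq_iff linear_diff[OF lin])
  have l: "continuous_on S ?l" for S by (intro continuous_intros)
  have ess_l: "ess_bounded ?B ?l" "ess_bounded ?B (\<lambda>_. \<xi>)"
    by (intro ess_bounded_continuous B l continuous_on_const)+
  have weak1: "weak_gradient ?B (\<lambda>y. T (\<phi> y - ?l y)) G1"
    unfolding G1_def[abs_def]
    by (intro weak_gradient_compose_linear weak_gradient_diff weak_gradient_linear weak B ess ess_l
        ess_bounded_diff T)
  have "continuous_on UNIV (\<lambda>F. \<chi> j. T (F $ j))"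
    by (intro continuous_intros bounded_linear.continuous_on[OF T])
  from ess_bounded_compose[OF ess_bounded_diff[OF ess(2) ess_l(2)] this]
  have essG1: "ess_bounded ?B G1" by (simp add: G1_def[abs_def])
  obtain G0 C where G0: "G0 \<in> borel_measurable lebesgue" "\<And>y. norm (G0 y) \<le> C"
    and out: "\<And>y. y \<notin> ?B \<Longrightarrow> G0 y = 0" and ae: "AE y in lebesgue_on ?B. G0 y = G1 y"
    by (rule ess_bounded_representative[OF essG1 B(1)]) blast
  let ?u = "\<lambda>y. if y \<in> ?B then T (\<phi> y - ?l y) else 0"
  have cu: "continuous_on (cball 0 1) (\<lambda>y. T (\<phi> y - ?l y))"
    by (intro bounded_linear.continuous_on[OF T] continuous_intros cont)
  have bu: "T (\<phi> y - ?l y) = 0" if "y \<in> sphere 0 1" for y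
    using bdry[OF that] linear_0[OF lin] by simp
  have mG1: "G1 \<in> borel_measurable (lebesgue_on ?B)" using essG1 unfolding ess_bounded_def by blast
  note ext = weak_gradient_extension_by_zero[OF cu bu mG1 G0 out ae weak1]
  define h where "h y = det (A + G0 y) - det A" for y
  have h0: "(LINT y|lebesgue. h y) = 0"
    unfolding h_def by (rule null_lagrangian_det[OF ext(1) B(2) _ _ G0 ext(2)]) (use out in auto)
  have "continuous_on UNIV (\<lambda>M. det (A + M) - det A)"
    by (intro continuous_intros continuous_on_det)
  moreover have "ess_bounded ?B G0"
    using G0 unfolding ess_bounded_def by (intro conjI measurable_restrict_space1 exI[of _ C] AE_I2) auto
  ultimately have "ess_bounded ?B h"
    unfolding h_def[abs_def] by (rule ess_bounded_compose[rotated])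
  from integrable_ess_bounded[OF this B continuous_on_const[of _ 1]]
  have ih: "integrable (lebesgue_on ?B) h" by simp
  have "(LINT y|lebesgue_on ?B. h y) = (LINT y|lebesgue. indicator ?B y *\<^sub>R h y)"
    by (rule integral_restrict_space) simp
  also have "\<dots> = (LINT y|lebesgue. h y)"
    by (intro Bochner_Integration.integral_cong refl) (auto simp: h_def out indicator_def)
  finally have hB: "(LINT y|lebesgue_on ?B. h y) = 0" by (simp add: h0)
  have "?B \<in> lmeasurable" by simp
  then interpret finite_measure "lebesgue_on ?B" by (rule finite_measure_lebesgue_on)
  have contm: "continuous_on UNIV (\<lambda>F. det (P + (\<chi> i. T (F $ i))))"
    by (intro continuous_on_det continuous_intros bounded_linear.continuous_on[OF T])
  have "(LINT y|lebesgue_on ?B. minor (pairing_matrix w (G y)) I J) = (LINT y|lebesgue_on ?B. h y + det A)"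
  proof (rule integral_cong_AE)
    show "(\<lambda>y. minor (pairing_matrix w (G y)) I J) \<in> borel_measurable (lebesgue_on ?B)"
      using ess_bounded_compose[OF ess(2) contm] unfolding ess_bounded_def minor by blast
    show "(\<lambda>y. h y + det A) \<in> borel_measurable (lebesgue_on ?B)"
      using borel_measurable_integrable[OF ih] by simp
    show "AE y in lebesgue_on ?B. minor (pairing_matrix w (G y)) I J = h y + det A"
      using ae by eventually_elim (simp add: minor h_def AG1)
  qed
  also have "\<dots> = (LINT y|lebesgue_on ?B. h y) + (LINT y|lebesgue_on ?B. det A)"
    by (intro Bochner_Integration.integral_add ih integrable_const)
  also have "\<dots> = measure lebesgue ?B * det A"
    by (simp add: hB measure_restrict_space)
  finally show ?thesis by (simp add: minor A_def)
qed

section \<open>Jensen's inequality and quasiconvexity\<close>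

text \<open>The epigraph of \<open>\<Phi>\<close> is closed and convex. If the mean of \<open>(X, \<Phi> \<circ> X)\<close> were outside it, a hyperplane
  would separate the two strictly, which contradicts integrating the separating inequality.\<close>

lemma jensen_inequality_euclidean:
  fixes \<Phi> :: "'b::euclidean_space \<Rightarrow> real" and X :: "'a \<Rightarrow> 'b"
  assumes conv: "convex_on UNIV \<Phi>" and fin: "finite_measure M" and pos: "measure M (space M) > 0"
    and intX: "integrable M X" and int\<Phi>: "integrable M (\<lambda>x. \<Phi> (X x))"
  shows "\<Phi> ((LINT x|M. X x) /\<^sub>R measure M (space M)) \<le> (LINT x|M. \<Phi> (X x)) / measure M (space M)"
proof (rule ccontr)
  interpret finite_measure M by fact
  let ?m = "measure M (space M)"
  let ?z = "((LINT x|M. X x) /\<^sub>R ?m, (LINT x|M. \<Phi> (X x)) / ?m)"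
  assume "\<not> ?thesis"
  then have z: "?z \<notin> epigraph UNIV \<Phi>" by (simp add: mem_epigraph)
  have cont: "continuous_on UNIV \<Phi>" using conv by (rule convex_on_continuous[OF open_UNIV])
  have "epigraph UNIV \<Phi> = {xy. \<Phi> (fst xy) \<le> snd xy}" by (auto simp: epigraph_def)
  also have "closed \<dots>"
    by (intro closed_Collect_le continuous_intros continuous_on_compose2[OF cont]) auto
  finally have "closed (epigraph UNIV \<Phi>)" .
  then obtain w b where w: "w \<bullet> ?z < b" and b: "\<forall>x\<in>epigraph UNIV \<Phi>. b < w \<bullet> x"
    using separating_hyperplane_closed_point[OF _ _ z] convex_epigraphI[OF conv] by blast
  have "b * ?m = (LINT x|M. b)" by simp
  also have "\<dots> \<le> (LINT x|M. fst w \<bullet> X x + snd w * \<Phi> (X x))"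
  proof (rule integral_mono)
    show "integrable M (\<lambda>x. fst w \<bullet> X x + snd w * \<Phi> (X x))"
      using intX int\<Phi> by (intro Bochner_Integration.integrable_add integrable_inner_right integrable_mult_right) auto
    fix x
    have "(X x, \<Phi> (X x)) \<in> epigraph UNIV \<Phi>" by (simp add: mem_epigraph)
    then show "b \<le> fst w \<bullet> X x + snd w * \<Phi> (X x)"
      using b by (fastforce simp: inner_prod_def)
  qed simp
  also have "\<dots> = fst w \<bullet> (LINT x|M. X x) + snd w * (LINT x|M. \<Phi> (X x))"
    using intX int\<Phi> by (subst Bochner_Integration.integral_add) auto
  also have "\<dots> = (w \<bullet> ?z) * ?m"
    using pos by (simp add: inner_prod_def algebra_simps)
  also have "\<dots> < b * ?m"
    using w pos by (rule mult_strict_right_mono)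
  finally show False by simp
qed

text \<open>The function \<open>U (z, \<cdot>)\<close> is known only on tangential tuples, so \<open>y \<mapsto> U (z, G y)\<close> agrees with the
  measurable function \<open>y \<mapsto> \<Phi> z (X (G y))\<close> only off a null set; its integrability then comes from
  the completeness of Lebesgue measure.\<close>

lemma polyconvex_at_imp_quasiconvex_at:
  fixes \<Omega> :: "'n::{finite,linorder} point set" and v :: "'m::{finite,linorder} \<Rightarrow> 'n point \<Rightarrow> 'n point"
  assumes z: "z \<in> regular_boundary \<Omega>" and rep: "polyconvex_representation_at \<Omega> U v \<Phi> z"
  shows "tangentially_quasiconvex_at \<Omega> U z"
  unfolding tangentially_quasiconvex_at_def
proof (intro allI impI, elim conjE)
  fix \<xi> \<phi> G
  assume \<xi>: "(z, \<xi>) \<in> tangent_bundle_d \<Omega>"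
    and sob: "sobolev_W1inf (ball 0 1) (tangent_cone (frontier \<Omega>) z) \<phi> G"
    and cont: "continuous_on (cball 0 1) \<phi>"
    and bdry: "\<forall>y \<in> sphere 0 1. \<phi> y = (\<Sum>j\<in>UNIV. (y $ j) *\<^sub>R (\<xi> $ j))"
  let ?B = "ball 0 1 :: 'n point set" and ?T = "tangent_cone (frontier \<Omega>) z"
  define X where "X F = minors (pairing_matrix (\<lambda>j. v j z) F)" for F :: "'n tuple"
  have conv: "convex_on UNIV (\<Phi> z)"
    and U: "\<And>F. (z, F) \<in> tangent_bundle_d \<Omega> \<Longrightarrow> U (z, F) = \<Phi> z (X F)"
    using rep unfolding polyconvex_representation_at_def X_def tangent_matrix_eq_pairing_matrix by auto
  have ess: "ess_bounded ?B \<phi>" "ess_bounded ?B G" and weak: "weak_gradient ?B \<phi> G"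
    using sob unfolding sobolev_W1inf_def by auto
  have B: "open ?B" "bounded ?B" by auto
  have X: "continuous_on UNIV X"
    unfolding X_def[abs_def] by (rule continuous_on_minors_pairing_matrix)
  have \<Phi>: "continuous_on UNIV (\<Phi> z)" using conv by (rule convex_on_continuous[OF open_UNIV])
  have iX: "integrable (lebesgue_on ?B) (\<lambda>y. X (G y))"
    using integrable_ess_bounded[OF ess_bounded_compose[OF ess(2) X] B continuous_on_const[of _ 1]] by simp
  have i\<Phi>: "integrable (lebesgue_on ?B) (\<lambda>y. \<Phi> z (X (G y)))"
    using integrable_ess_bounded[OF ess_bounded_compose[OF ess_bounded_compose[OF ess(2) X] \<Phi>] B
        continuous_on_const[of _ 1]] by simp
  have "subspace ?T" using z by (simp add: regular_boundary_def)
  from AE_weak_gradient_in_subspace[OF sob this B]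
  have "AE y in lebesgue_on ?B. (z, G y) \<in> tangent_bundle_d \<Omega>"
    by eventually_elim (simp add: tangent_bundle_d_def z)
  then have ae: "AE y in lebesgue_on ?B. \<Phi> z (X (G y)) = U (z, G y)"
    by eventually_elim (simp add: U)
  then have "AE y in lebesgue. y \<in> ?B \<longrightarrow> \<Phi> z (X (G y)) = U (z, G y)"
    by (simp add: AE_restrict_space_iff)
  then obtain N where N: "N \<in> null_sets lebesgue" "{y. \<not> (y \<in> ?B \<longrightarrow> \<Phi> z (X (G y)) = U (z, G y))} \<subseteq> N"
    unfolding eventually_ae_filter by auto
  have iU: "integrable (lebesgue_on ?B) (\<lambda>y. U (z, G y))"
  proof -
    have "(\<lambda>y. \<Phi> z (X (G y))) absolutely_integrable_on ?B"
      using i\<Phi> by (simp add: integrable_restrict_space set_integrable_def)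
    then have "(\<lambda>y. U (z, G y)) absolutely_integrable_on ?B"
      by (rule absolutely_integrable_spike[of _ _ N]) (use N in \<open>auto simp: negligible_iff_null_sets\<close>)
    then show ?thesis by (simp add: integrable_restrict_space set_integrable_def)
  qed
  have "?B \<in> lmeasurable" by simp
  then have fin: "finite_measure (lebesgue_on ?B)" by (rule finite_measure_lebesgue_on)
  have vol: "measure (lebesgue_on ?B) (space (lebesgue_on ?B)) = measure lebesgue ?B"
    by (simp add: measure_restrict_space)
  have pos: "measure lebesgue ?B > 0" by (simp add: content_ball)
  have mean: "(LINT y|lebesgue_on ?B. X (G y)) /\<^sub>R measure lebesgue ?B = X \<xi>"
  proof -
    have "(LINT y|lebesgue_on ?B. X (G y)) $ p = measure lebesgue ?B * X \<xi> $ p" for p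
    proof -
      obtain I J where p: "Rep_minor_index p = (I, J)" by (cases "Rep_minor_index p")
      then have card: "card I = card J" using Rep_minor_index[of p] by simp
      have "(LINT y|lebesgue_on ?B. X (G y)) $ p = (LINT y|lebesgue_on ?B. X (G y) $ p)"
        by (rule integral_bounded_linear[OF bounded_linear_vec_nth iX, symmetric])
      also have "\<dots> = measure lebesgue ?B * X \<xi> $ p"
        using integral_minor_weak_gradient[OF ess weak cont _ card, of \<xi> "\<lambda>j. v j z"] bdry
        by (simp add: X_def minors_def p)
      finally show ?thesis .
    qed
    then show ?thesis using pos by (simp add: Finite_Cartesian_Product.vec_eq_iff)
  qed
  have "U (z, \<xi>) = \<Phi> z ((LINT y|lebesgue_on ?B. X (G y)) /\<^sub>R measure lebesgue ?B)"
    unfolding mean by (rule U[OF \<xi>])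
  also have "\<dots> \<le> (LINT y|lebesgue_on ?B. \<Phi> z (X (G y))) / measure lebesgue ?B"
    using jensen_inequality_euclidean[OF conv fin _ iX i\<Phi>] pos unfolding vol by blast
  also have "(LINT y|lebesgue_on ?B. \<Phi> z (X (G y))) = (LINT y|lebesgue_on ?B. U (z, G y))"
    using i\<Phi> iU ae by (intro integral_cong_AE) auto
  finally show "integrable (lebesgue_on ?B) (\<lambda>y. U (z, G y)) \<and>
      U (z, \<xi>) \<le> 1 / measure lebesgue ?B * (LINT y|lebesgue_on ?B. U (z, G y))"
    using iU by simp
qed

theorem proposition7p7:
  fixes \<Omega> :: "'n::{finite,linorder} point set"
    and U :: "'n point \<times> 'n tuple \<Rightarrow> real"
  assumes "CARD('n) \<ge> 2"
    and "CARD('m::{finite,linorder}) = CARD('n) - 1"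
    and "bounded \<Omega>" and "open \<Omega>" and "lipschitz_boundary \<Omega>"
  shows "(tangentially_polyconvex TYPE('m) \<Omega> U \<longrightarrow> tangentially_quasiconvex_ae \<Omega> U) \<and>
         (tangentially_polyconvex_everywhere TYPE('m) \<Omega> U \<longrightarrow> tangentially_quasiconvex \<Omega> U)"
proof (intro conjI impI)
  assume "tangentially_polyconvex TYPE('m) \<Omega> U"
  then obtain v :: "'m \<Rightarrow> 'n point \<Rightarrow> 'n point" and \<Phi> where
    "AE x in hausdorff_measure (CARD('n) - 1).
       x \<in> regular_boundary \<Omega> \<longrightarrow> polyconvex_representation_at \<Omega> U v \<Phi> x"
    unfolding tangentially_polyconvex_def by blast
  then show "tangentially_quasiconvex_ae \<Omega> U"
    unfolding tangentially_quasiconvex_ae_def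
    by (rule eventually_mono) (blast intro: polyconvex_at_imp_quasiconvex_at)
next
  assume "tangentially_polyconvex_everywhere TYPE('m) \<Omega> U"
  then obtain v :: "'m \<Rightarrow> 'n point \<Rightarrow> 'n point" and \<Phi> where
    "\<forall>x \<in> regular_boundary \<Omega>. polyconvex_representation_at \<Omega> U v \<Phi> x"
    unfolding tangentially_polyconvex_everywhere_def by blast
  then show "tangentially_quasiconvex \<Omega> U"
    unfolding tangentially_quasiconvex_def by (blast intro: polyconvex_at_imp_quasiconvex_at)
qed

end
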